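(* Let $\tau$ be a Liouville number and let $0\le\beta\le1$. Then there exists a $C^\infty$ orientation-preserving diffeomorphism $f$ of the circle $S^1=\mathbb R/\mathbb Z$ with rotation number $\tau$ such that its unique invariant Borel probability measure $\mu$ satisfies: (1) $\underline d_\mu(x)=\beta$ and $\overline d_\mu(x)=1$ for $\mu$-almost every $x\in S^1$; (2) $\dim_H\mu=\underline{\dim}_B\,\mu=\beta$ and $\overline{\dim}_B\,\mu=1$.
   Context: An irrational number $\tau$ is a Liouville number if for every $n\ge1$ there exist integers $p,q$ with $q>1$ and $|\tau-p/q|<1/q^n$. The rotation number of an orientation-preserving circle homeomorphism $f$ is $\tau(f)=\pi(\lim_{|n|\to\infty}\frac1n(F^n(x)-x))$, where $F$ is a lift of $f$ to $\mathbb R$ and $\pi:\mathbb R\to\mathbb R/\mathbb Z$ the projection. For a Borel measure $\mu$ on $S^1$ (with its standard metric), $\underline d_\mu(x)=\liminf_{r\to0}\frac{\log\mu(B(x,r))}{\log r}$ and $\overline d_\mu(x)=\limsup_{r\to0}\frac{\log\mu(B(x,r))}{\log r}$, $B(x,r)$ the ball of radius $r$ about $x$. For a set $Z$, $\overline{\dim}_B Z$ and $\underline{\dim}_B Z$ are the $\limsup$ and $\liminf$ as $\varepsilon\to0$ of $\frac{\log N(Z,\varepsilon)}{\log(1/\varepsilon)}$, $N(Z,\varepsilon)$ being the least number of balls of diameter $\varepsilon$ covering $Z$; $\dim_H Z$ is the Hausdorff dimension. For a Borel probability measure $\mu$: $\dim_H\mu=\inf\{\dim_H Z:\mu(Z)=1\}$,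 $\underline{\dim}_B\mu=\lim_{\varepsilon\to0}\inf\{\underline{\dim}_B Z:\mu(Z)>1-\varepsilon\}$, $\overline{\dim}_B\mu=\lim_{\varepsilon\to0}\inf\{\overline{\dim}_B Z:\mu(Z)>1-\varepsilon\}$. *)

theory Defs
  imports "HOL-Probability.Probability"
begin

definition liouville :: "real \<Rightarrow> bool" where
  "liouville t \<longleftrightarrow> t \<notin> \<rat> \<and>
     (\<forall>n::nat. n \<ge> 1 \<longrightarrow> (\<exists>p q :: int. q > 1 \<and> \<bar>t - real_of_int p / real_of_int q\<bar> < 1 / (real_of_int q) ^ n))"

definition circ :: "real set" where "circ = {0..<1}"

definition proj :: "real \<Rightarrow> real" where "proj x = frac x"

definition cdist :: "real \<Rightarrow> real \<Rightarrow> real" where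
  "cdist x y = \<bar>(x - y) - real_of_int (round (x - y))\<bar>"

definition cball_open :: "real \<Rightarrow> real \<Rightarrow> real set" where
  "cball_open x r = {y \<in> circ. cdist x y < r}"

definition cball_closed :: "real \<Rightarrow> real \<Rightarrow> real set" where
  "cball_closed x r = {y \<in> circ. cdist x y \<le> r}"

definition cdiam :: "real set \<Rightarrow> real" where
  "cdiam U = (if U = {} then 0 else Sup {cdist x y |x y. x \<in> U \<and> y \<in> U})"

definition smooth_real :: "(real \<Rightarrow> real) \<Rightarrow> (nat \<Rightarrow> real \<Rightarrow> real) \<Rightarrow> bool" where
  "smooth_real F D \<longleftrightarrow> D 0 = F \<and> (\<forall>k x. (D k has_real_derivative D (Suc k) x) (at x))"

(* F is a lift of a C^infinity orientation-preserving diffeomorphism of R/Z: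
   smooth, F(x+1) = F(x)+1, with everywhere positive derivative
   (hence an increasing diffeomorphism of R with smooth inverse) *)
definition circle_diffeo_lift :: "(real \<Rightarrow> real) \<Rightarrow> bool" where
  "circle_diffeo_lift F \<longleftrightarrow>
     (\<exists>D. smooth_real F D \<and> (\<forall>x. D 1 x > 0)) \<and> (\<forall>x. F (x + 1) = F x + 1)"

definition circ_map :: "(real \<Rightarrow> real) \<Rightarrow> real \<Rightarrow> real" where
  "circ_map F x = proj (F x)"

definition has_rotation_number :: "(real \<Rightarrow> real) \<Rightarrow> real \<Rightarrow> bool" where
  "has_rotation_number F t \<longleftrightarrow>
     (\<exists>\<rho>. (\<forall>x. (\<lambda>n. ((F ^^ n) x - x) / real n) \<longlonglongrightarrow> \<rho>
             \<and> (\<lambda>n. ((inv F ^^ n) x - x) / (- real n)) \<longlonglongrightarrow> \<rho>)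
          \<and> proj \<rho> = proj t)"

definition circ_prob :: "real measure \<Rightarrow> bool" where
  "circ_prob \<mu> \<longleftrightarrow> prob_space \<mu> \<and> sets \<mu> = sets borel \<and> emeasure \<mu> (UNIV - circ) = 0"

definition invariant_measure :: "(real \<Rightarrow> real) \<Rightarrow> real measure \<Rightarrow> bool" where
  "invariant_measure f \<mu> \<longleftrightarrow> circ_prob \<mu> \<and> distr \<mu> borel f = \<mu>"

(* log m / log r, with the convention log 0 = -infinity (so the quotient is +infinity) *)
definition log_ratio :: "real \<Rightarrow> real \<Rightarrow> ereal" where
  "log_ratio m r = (if m = 0 then \<infinity> else ereal (ln m / ln r))"

definition lower_local_dim :: "real measure \<Rightarrow> real \<Rightarrow> ereal" where
  "lower_local_dim \<mu> x = Liminf (at_right 0) (\<lambda>r. log_ratio (measure \<mu> (cball_open x r)) r)"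

definition upper_local_dim :: "real measure \<Rightarrow> real \<Rightarrow> ereal" where
  "upper_local_dim \<mu> x = Limsup (at_right 0) (\<lambda>r. log_ratio (measure \<mu> (cball_open x r)) r)"

definition diam_pow :: "real \<Rightarrow> real set \<Rightarrow> real" where
  "diam_pow s U = (if U = {} then 0 else if s = 0 then 1 else cdiam U powr s)"

definition hausdorff_delta :: "real \<Rightarrow> real \<Rightarrow> real set \<Rightarrow> ennreal" where
  "hausdorff_delta s \<delta> Z = (INF U \<in> {U :: nat \<Rightarrow> real set.
        (\<forall>n. U n \<subseteq> circ \<and> cdiam (U n) \<le> \<delta>) \<and> Z \<subseteq> (\<Union>n. U n)}.
      (\<Sum>n. ennreal (diam_pow s (U n))))"

definition hausdorff_measure :: "real \<Rightarrow> real set \<Rightarrow> ennreal" where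
  "hausdorff_measure s Z = (SUP \<delta> \<in> {0<..}. hausdorff_delta s \<delta> Z)"

definition dim_H :: "real set \<Rightarrow> ereal" where
  "dim_H Z = Inf {ereal s |s. s \<ge> 0 \<and> hausdorff_measure s Z = 0}"

definition cover_number :: "real set \<Rightarrow> real \<Rightarrow> nat" where
  "cover_number Z \<epsilon> = (LEAST n. \<exists>C. finite C \<and> card C = n \<and> C \<subseteq> circ \<and>
                                    Z \<subseteq> (\<Union>c\<in>C. cball_closed c (\<epsilon> / 2)))"

definition upper_box_dim :: "real set \<Rightarrow> ereal" where
  "upper_box_dim Z = Limsup (at_right 0) (\<lambda>\<epsilon>. ereal (ln (real (cover_number Z \<epsilon>)) / ln (1 / \<epsilon>)))"

definition lower_box_dim :: "real set \<Rightarrow> ereal" where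
  "lower_box_dim Z = Liminf (at_right 0) (\<lambda>\<epsilon>. ereal (ln (real (cover_number Z \<epsilon>)) / ln (1 / \<epsilon>)))"

definition dim_H_measure :: "real measure \<Rightarrow> ereal" where
  "dim_H_measure \<mu> = Inf {dim_H Z |Z. Z \<in> sets \<mu> \<and> Z \<subseteq> circ \<and> measure \<mu> Z = 1}"

definition lower_box_dim_measure :: "real measure \<Rightarrow> ereal" where
  "lower_box_dim_measure \<mu> = Lim (at_right 0) (\<lambda>\<epsilon>.
      Inf {lower_box_dim Z |Z. Z \<in> sets \<mu> \<and> Z \<subseteq> circ \<and> measure \<mu> Z > 1 - \<epsilon>})"

definition upper_box_dim_measure :: "real measure \<Rightarrow> ereal" where
  "upper_box_dim_measure \<mu> = Lim (at_right 0) (\<lambda>\<epsilon>.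
      Inf {upper_box_dim Z |Z. Z \<in> sets \<mu> \<and> Z \<subseteq> circ \<and> measure \<mu> Z > 1 - \<epsilon>})"

end

theory Submission
  imports Defs "HOL-Real_Asymp.Real_Asymp"
begin

text \<open>
  The diffeomorphism is built by the Anosov--Katok method of conjugation by approximation: it is the limit
  of the conjugates of the rotation by \<open>\<tau>\<close> under \<open>H\<^sub>n\<^sub>+\<^sub>1 = H\<^sub>n \<circ> A\<^sub>n\<close>, where \<open>A\<^sub>n\<close> commutes with the rotation by
  a rational \<open>p/q\<close> extremely close to \<open>\<tau>\<close>. The factor \<open>A\<^sub>n\<close> is a lift of a Moebius map of the circle to
  its \<open>q\<close>-fold cover, with maximal contraction \<open>L = q\<^sup>\<gamma>\<close> and \<open>1/(1+\<gamma>)\<close> close to \<open>\<beta>\<close>; it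
  concentrates almost all of the mass \<open>1/q\<close> of each of \<open>q\<close> intervals in an interval of length about
  \<open>1/(q L) = q\<^sup>-\<^sup>1\<^sup>-\<^sup>\<gamma>\<close>. At the scale \<open>1/q\<close> the invariant measure looks one-dimensional, at the scale
  \<open>1/(q L)\<close> it looks \<open>\<beta>\<close>-dimensional, and between these scales its local exponents stay above \<open>\<beta>\<close>.

  For \<open>C\<^sup>\<infinity>\<close> convergence only the following is needed: all derivatives of the maps of the next stage are
  bounded by powers of \<open>q\<close> with exponents that do not depend on \<open>q\<close>. Families with this property are
  closed under products, composition, solutions of autonomous differential equations and difference
  quotients, so no explicit formula for higher derivatives of a composition enters. A Liouville number then
  supplies \<open>q\<close> with \<open>\<bar>\<tau> - p/q\<bar>\<close> below any fixed power of \<open>1/q\<close>.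
\<close>

section \<open>Families of polynomial growth\<close>

text \<open>The exponents of the polynomial bounds have to be known before q is chosen, because a
  Liouville number offers approximations that beat any one prescribed power of 1/q, not all powers
  at once. So stage n controls only the derivatives of order at most n, by 2^-n; every fixed order
  is still controlled from some stage on. The bounds also have to be uniform in the numerator p. All
  estimates of the measure are read off its distribution function, the limit of \<open>G n\<close>.
  Replacing an increment of the limit by one of \<open>G n\<close> costs at most 4/q, which is
  harmless at scales r \<ge> 1/q, so only Lipschitz constants of consecutive stages enter. Those are
  fixed before the next q and therefore cost a factor q^\<epsilon> with \<epsilon> tending to 0. The
  exponent aimed at in stage n is some b in (0,1) tending to \<beta>, since \<gamma> = 1/b - 1 must
  be positive and finite even if \<beta> is 0 or 1. Invariance and uniqueness rest on the lifted
  distribution function of a measure: in the coordinate of the conjugacy, invariance says that it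
  intertwines two translations, one of them irrational.\<close>

definition poly_bdd :: "('i \<Rightarrow> real) \<Rightarrow> ('i \<Rightarrow> real \<Rightarrow> real) \<Rightarrow> bool" where
  "poly_bdd w u \<longleftrightarrow> (\<exists>C N. \<forall>i x. \<bar>u i x\<bar> \<le> C * w i ^ N)"

text \<open>Constants and exponents may depend on the order but not on the index. Being
  \<open>moderate w k u\<close> for every k means smoothness with bounds that are polynomial in the
  weight at each order.\<close>

fun moderate :: "('i \<Rightarrow> real) \<Rightarrow> nat \<Rightarrow> ('i \<Rightarrow> real \<Rightarrow> real) \<Rightarrow> bool" where
  "moderate w 0 u \<longleftrightarrow> poly_bdd w u"
| "moderate w (Suc k) u \<longleftrightarrow> poly_bdd w u \<and> (\<forall>i x. u i field_differentiable (at x))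
     \<and> moderate w k (\<lambda>i. deriv (u i))"

locale weight =
  fixes w :: "'i \<Rightarrow> real"
  assumes w_ge_1: "w i \<ge> 1"
begin

lemma poly_bddE:
  assumes "poly_bdd w u"
  obtains C N where "C \<ge> 0" "\<And>i x. \<bar>u i x\<bar> \<le> C * w i ^ N"
proof -
  obtain C N where *: "\<And>i x. \<bar>u i x\<bar> \<le> C * w i ^ N"
    using assms unfolding poly_bdd_def by blast
  have "w i ^ N \<ge> 0" for i using w_ge_1[of i] by simp
  then have "\<bar>u i x\<bar> \<le> \<bar>C\<bar> * w i ^ N" for i x
    using *[of i x] by (smt (verit) mult_right_mono)
  then show thesis using that[of "\<bar>C\<bar>" N] by auto
qed

lemma poly_bdd_mono:
  assumes "poly_bdd w v" "\<And>i x. \<bar>u i x\<bar> \<le> \<bar>v i x\<bar>"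
  shows "poly_bdd w u"
  using assms unfolding poly_bdd_def by (meson order_trans)

lemma poly_bdd_compose: "poly_bdd w u \<Longrightarrow> poly_bdd w (\<lambda>i x. u i (v i x))"
  unfolding poly_bdd_def by blast

lemma poly_bdd_bound: "(\<And>i x. \<bar>u i x\<bar> \<le> C) \<Longrightarrow> poly_bdd w u"
  unfolding poly_bdd_def by (rule exI[of _ C], rule exI[of _ 0]) simp

lemma poly_bdd_add:
  assumes "poly_bdd w u" "poly_bdd w v"
  shows "poly_bdd w (\<lambda>i x. u i x + v i x)"
proof -
  obtain C N where 1: "C \<ge> 0" "\<And>i x. \<bar>u i x\<bar> \<le> C * w i ^ N" using poly_bddE[OF assms(1)] by blast
  obtain D K where 2: "D \<ge> 0" "\<And>i x. \<bar>v i x\<bar> \<le> D * w i ^ K" using poly_bddE[OF assms(2)] by blast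
  have "\<bar>u i x + v i x\<bar> \<le> (C + D) * w i ^ (N + K)" for i x
  proof -
    have "w i ^ N \<le> w i ^ (N+K)" "w i ^ K \<le> w i ^ (N+K)"
      using w_ge_1[of i] by (auto intro: power_increasing)
    then have "C * w i ^ N \<le> C * w i ^ (N+K)" "D * w i ^ K \<le> D * w i ^ (N+K)"
      using 1(1) 2(1) by (auto intro: mult_left_mono)
    then show ?thesis using 1(2)[of i x] 2(2)[of i x] by (simp add: distrib_right)
  qed
  then show ?thesis unfolding poly_bdd_def by blast
qed

lemma poly_bdd_mult:
  assumes "poly_bdd w u" "poly_bdd w v"
  shows "poly_bdd w (\<lambda>i x. u i x * v i x)"
proof -
  obtain C N where 1: "C \<ge> 0" "\<And>i x. \<bar>u i x\<bar> \<le> C * w i ^ N" using poly_bddE[OF assms(1)] by blast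
  obtain D K where 2: "D \<ge> 0" "\<And>i x. \<bar>v i x\<bar> \<le> D * w i ^ K" using poly_bddE[OF assms(2)] by blast
  have "\<bar>u i x * v i x\<bar> \<le> (C * D) * w i ^ (N + K)" for i x
  proof -
    have "\<bar>u i x\<bar> * \<bar>v i x\<bar> \<le> (C * w i ^ N) * (D * w i ^ K)"
      by (rule mult_mono) (use 1 2 w_ge_1[of i] in auto)
    then show ?thesis by (simp add: abs_mult power_add mult_ac)
  qed
  then show ?thesis unfolding poly_bdd_def by blast
qed

lemma poly_bdd_cmult: "poly_bdd w u \<Longrightarrow> poly_bdd w (\<lambda>i x. c * u i x)"
  by (rule poly_bdd_mult[OF poly_bdd_bound[of _ "\<bar>c\<bar>"]]) auto

lemma moderate_poly_bdd: "moderate w k u \<Longrightarrow> poly_bdd w u"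
  by (cases k) auto

lemma moderate_SucI:
  assumes "poly_bdd w u" "\<And>i x. (u i has_real_derivative u' i x) (at x)" "moderate w k u'"
  shows "moderate w (Suc k) u"
proof -
  have "(\<lambda>i. deriv (u i)) = u'"
    using assms(2) by (intro ext) (simp add: DERIV_imp_deriv)
  then show ?thesis using assms by (auto simp: field_differentiable_def)
qed

lemma moderate_has_deriv:
  "moderate w (Suc k) u \<Longrightarrow> (u i has_real_derivative deriv (u i) x) (at x)"
  using DERIV_deriv_iff_field_differentiable by auto

lemma moderate_Suc_D: "moderate w (Suc k) u \<Longrightarrow> moderate w k u"
proof (induction k arbitrary: u)
  case (Suc k)
  then show ?case by (metis moderate.simps(2))
qed auto

lemma moderate_add:
  "moderate w k u \<Longrightarrow> moderate w k v \<Longrightarrow> moderate w k (\<lambda>i x. u i x + v i x)"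
proof (induction k arbitrary: u v)
  case (Suc k)
  show ?case
  proof (rule moderate_SucI)
    show "poly_bdd w (\<lambda>i x. u i x + v i x)" using Suc.prems by (auto intro: poly_bdd_add)
    show "((\<lambda>x. u i x + v i x) has_real_derivative deriv (u i) x + deriv (v i) x) (at x)" for i x
      using Suc.prems by (intro DERIV_add moderate_has_deriv) auto
    show "moderate w k (\<lambda>i x. deriv (u i) x + deriv (v i) x)"
      using Suc by auto
  qed
qed (auto intro: poly_bdd_add)

lemma moderate_mult:
  "moderate w k u \<Longrightarrow> moderate w k v \<Longrightarrow> moderate w k (\<lambda>i x. u i x * v i x)"
proof (induction k arbitrary: u v)
  case (Suc k)
  show ?case
  proof (rule moderate_SucI)
    show "poly_bdd w (\<lambda>i x. u i x * v i x)" using Suc.prems by (auto intro: poly_bdd_mult)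
    show "((\<lambda>x. u i x * v i x) has_real_derivative (deriv (u i) x * v i x + deriv (v i) x * u i x)) (at x)" for i x
      using Suc.prems by (intro DERIV_mult moderate_has_deriv) auto
    show "moderate w k (\<lambda>i x. deriv (u i) x * v i x + deriv (v i) x * u i x)"
      using Suc.IH[of "\<lambda>i. deriv (u i)" v] Suc.IH[of "\<lambda>i. deriv (v i)" u]
        Suc.prems[THEN moderate_Suc_D] Suc.prems by (intro moderate_add) auto
  qed
qed (auto intro: poly_bdd_mult)

lemma moderate_const:
  assumes "poly_bdd w (\<lambda>i x. c i)" shows "moderate w k (\<lambda>i x. c i)"
proof (cases k)
  case (Suc j)
  have 0: "moderate w j (\<lambda>i x. 0)" for j
  proof (induction j)
    case (Suc j)
    show ?case by (rule moderate_SucI[OF _ _ Suc]) (auto intro: poly_bdd_bound[of _ 0])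
  qed (auto intro: poly_bdd_bound[of _ 0])
  show ?thesis unfolding Suc by (rule moderate_SucI[OF assms _ 0]) auto
qed (use assms in auto)

lemma moderate_const': "moderate w k (\<lambda>i x. c)"
  by (rule moderate_const, rule poly_bdd_bound[of _ "\<bar>c\<bar>"]) simp

lemma moderate_cmult: "moderate w k u \<Longrightarrow> moderate w k (\<lambda>i x. c * u i x)"
  by (rule moderate_mult[OF moderate_const'])

text \<open>Boundedness is assumed for the derivative of the inner family and not for the family
  itself, because lifts of circle maps are unbounded. That derivative is taken at one order less
  than the result; this gain of one order drives \<open>moderate_ode\<close>.\<close>

lemma moderate_compose:
  assumes "moderate w k u" "\<And>i x. (v i has_real_derivative v' i x) (at x)"
    "k > 0 \<Longrightarrow> moderate w (k - 1) v'"
  shows "moderate w k (\<lambda>i x. u i (v i x))"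
  using assms(1,3)
proof (induction k arbitrary: u)
  case (Suc k)
  show ?case
  proof (rule moderate_SucI)
    show "poly_bdd w (\<lambda>i x. u i (v i x))"
      using Suc.prems by (auto intro: poly_bdd_compose)
    show "((\<lambda>x. u i (v i x)) has_real_derivative deriv (u i) (v i x) * v' i x) (at x)" for i x
      by (rule DERIV_chain2[OF moderate_has_deriv[OF Suc.prems(1)] assms(2)])
    have "moderate w k (\<lambda>i x. deriv (u i) (v i x))"
    proof (rule Suc.IH)
      show "moderate w (k - 1) v'" if "k > 0"
        using that Suc.prems(2) moderate_Suc_D[of "k - 1" v'] by simp
    qed (use Suc.prems in auto)
    then show "moderate w k (\<lambda>i x. deriv (u i) (v i x) * v' i x)"
      by (rule moderate_mult) (use Suc.prems in auto)
  qed
qed (auto intro: poly_bdd_compose)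

text \<open>Bootstrapping: if \<phi>(v) is moderate of order k, then so is v' = \<phi>(v), and
  composing \<phi> with v then gives order k + 1.\<close>

lemma moderate_ode:
  assumes "\<And>k. moderate w k \<phi>" "\<And>i x. (v i has_real_derivative \<phi> i (v i x)) (at x)"
  shows "moderate w k (\<lambda>i x. \<phi> i (v i x))"
proof (induction k)
  case 0
  show ?case using assms(1)[of 0] by (auto intro: poly_bdd_compose)
next
  case (Suc k)
  show ?case by (rule moderate_compose[OF assms]) (simp add: Suc)
qed

text \<open>The derivative of 1/\<phi> is -\<phi>' times two factors 1/\<phi>, so a bound on the
  reciprocal alone starts an induction on the order.\<close>

lemma moderate_inverse:
  assumes "moderate w k \<phi>" "poly_bdd w (\<lambda>i x. 1 / \<phi> i x)" "\<And>i x. \<phi> i x \<noteq> 0"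
  shows "moderate w k (\<lambda>i x. 1 / \<phi> i x)"
  using assms
proof (induction k)
  case (Suc k)
  have IH: "moderate w k (\<lambda>i x. 1 / \<phi> i x)"
    using Suc moderate_Suc_D by blast
  show ?case
  proof (rule moderate_SucI[OF Suc.prems(2)])
    show "((\<lambda>x. 1 / \<phi> i x) has_real_derivative (- 1) * (deriv (\<phi> i) x * (1 / \<phi> i x * (1 / \<phi> i x)))) (at x)" for i x
      using Suc.prems(3) by (auto intro!: derivative_eq_intros moderate_has_deriv[OF Suc.prems(1)])
    show "moderate w k (\<lambda>i x. (- 1) * (deriv (\<phi> i) x * (1 / \<phi> i x * (1 / \<phi> i x))))"
      by (intro moderate_cmult moderate_mult IH) (use Suc.prems in auto)
  qed
qed simp

lemma moderate_trig:
  assumes "poly_bdd w (\<lambda>i x. c i)" "poly_bdd w (\<lambda>i x. d i)"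
  shows "moderate w k (\<lambda>i x. c i * cos (d i * x)) \<and> moderate w k (\<lambda>i x. c i * sin (d i * x))"
  using assms(1)
proof (induction k arbitrary: c)
  case 0
  have "\<bar>c i * cos (d i * x)\<bar> \<le> \<bar>c i\<bar>" "\<bar>c i * sin (d i * x)\<bar> \<le> \<bar>c i\<bar>" for i x
    by (auto simp: abs_mult intro: mult_left_le)
  then show ?case
    using poly_bdd_mono[OF 0] by auto
next
  case (Suc k)
  have b: "\<bar>c i * cos (d i * x)\<bar> \<le> \<bar>c i\<bar>" "\<bar>c i * sin (d i * x)\<bar> \<le> \<bar>c i\<bar>" for i x
    by (auto simp: abs_mult intro: mult_left_le)
  have cd: "poly_bdd w (\<lambda>i x. c i * d i)" "poly_bdd w (\<lambda>i x. - (c i * d i))"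
    using poly_bdd_mult[OF Suc.prems assms(2)] poly_bdd_cmult[OF poly_bdd_mult[OF Suc.prems assms(2)], of "-1"] by auto
  have "moderate w (Suc k) (\<lambda>i x. c i * cos (d i * x))"
  proof (rule moderate_SucI)
    show "poly_bdd w (\<lambda>i x. c i * cos (d i * x))"
      using poly_bdd_mono[OF Suc.prems] b by auto
    show "((\<lambda>x. c i * cos (d i * x)) has_real_derivative - (c i * d i) * sin (d i * x)) (at x)" for i x
      by (auto intro!: derivative_eq_intros)
    show "moderate w k (\<lambda>i x. - (c i * d i) * sin (d i * x))"
      using Suc.IH[OF cd(2)] by auto
  qed
  moreover have "moderate w (Suc k) (\<lambda>i x. c i * sin (d i * x))"
  proof (rule moderate_SucI)
    show "poly_bdd w (\<lambda>i x. c i * sin (d i * x))"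
      using poly_bdd_mono[OF Suc.prems] b by auto
    show "((\<lambda>x. c i * sin (d i * x)) has_real_derivative (c i * d i) * cos (d i * x)) (at x)" for i x
      by (auto intro!: derivative_eq_intros)
    show "moderate w k (\<lambda>i x. (c i * d i) * cos (d i * x))"
      using Suc.IH[OF cd(1)] by auto
  qed
  ultimately show ?case by blast
qed

text \<open>The mean value theorem bounds the quotient through u', however small the gap
  \<open>s i - t i\<close> is. Differentiating gives the same quotient formed with u', times v', so
  the induction runs over u. For equal shifts the quotient is 0, as division by zero.\<close>

lemma moderate_diff_quotient:
  assumes "\<And>i x. (u i has_real_derivative u' i x) (at x)" "\<And>k. moderate w k u'"
    "\<And>i x. (v i has_real_derivative v' i x) (at x)" "\<And>k. moderate w k v'"
  shows "moderate w k (\<lambda>i x. (u i (v i x + s i) - u i (v i x + t i)) / (s i - t i))"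
  using assms(1,2)
proof (induction k arbitrary: u u')
  have pb: "poly_bdd w (\<lambda>i x. (u i (v i x + s i) - u i (v i x + t i)) / (s i - t i))"
    if d: "\<And>i x. (u i has_real_derivative u' i x) (at x)" and m: "moderate w 0 u'" for u u'
  proof -
    obtain C N where CN: "C \<ge> 0" "\<And>i x. \<bar>u' i x\<bar> \<le> C * w i ^ N" using poly_bddE m by (metis moderate.simps(1))
    have lip: "\<bar>u i a - u i b\<bar> \<le> C * w i ^ N * \<bar>a - b\<bar>" for i a b
      using field_differentiable_bound[of UNIV "u i" "u' i" "C * w i ^ N" a b] d CN
      by auto
    have "\<bar>(u i (v i x + s i) - u i (v i x + t i)) / (s i - t i)\<bar> \<le> C * w i ^ N" for i x
    proof (cases "s i = t i")
      case True
      then show ?thesis using CN(2)[of i 0] by simp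
    next
      case False
      then show ?thesis using lip[of i "v i x + s i" "v i x + t i"]
        by (simp add: divide_le_eq abs_divide)
    qed
    then show ?thesis unfolding poly_bdd_def by blast
  qed
  {
    case 0
    then show ?case using pb[OF 0(1) 0(2)[of 0]] by simp
  next
    case (Suc k)
    have d': "(u' i has_real_derivative deriv (u' i) x) (at x)" for i x
      using moderate_has_deriv[OF Suc.prems(2)] .
    have m': "moderate w k (\<lambda>i. deriv (u' i))" for k
      using Suc.prems(2)[of "Suc k"] by simp
    show ?case
    proof (rule moderate_SucI)
      show "poly_bdd w (\<lambda>i x. (u i (v i x + s i) - u i (v i x + t i)) / (s i - t i))"
        using pb[OF Suc.prems] .
      show "((\<lambda>x. (u i (v i x + s i) - u i (v i x + t i)) / (s i - t i)) has_real_derivative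
         ((u' i (v i x + s i) - u' i (v i x + t i)) / (s i - t i)) * v' i x) (at x)" for i x
      proof -
        have 1: "((\<lambda>x. u i (v i x + c)) has_real_derivative u' i (v i x + c) * v' i x) (at x)" for c
          by (rule DERIV_chain2[OF Suc.prems(1)]) (auto intro!: derivative_eq_intros assms(3))
        show ?thesis
          using DERIV_cdivide[OF DERIV_diff[OF 1[of "s i"] 1[of "t i"]], of "s i - t i"]
          by (simp add: algebra_simps)
      qed
      show "moderate w k (\<lambda>i x. ((u' i (v i x + s i) - u' i (v i x + t i)) / (s i - t i)) * v' i x)"
        by (rule moderate_mult[OF Suc.IH[OF d' m'] assms(4)])
    qed
  }
qed

lemma moderate_diff:
  assumes "moderate w k u" "moderate w k v"
  shows "moderate w k (\<lambda>i x. u i x - v i x)"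
  using moderate_add[OF assms(1) moderate_cmult[OF assms(2), of "-1"]] by simp

lemma moderate_deriv_bound:
  assumes "moderate w k u" "j \<le> k"
  shows "poly_bdd w (\<lambda>i. (deriv ^^ j) (u i))"
  using assms
proof (induction j arbitrary: k u)
  case 0
  then show ?case using moderate_poly_bdd by auto
next
  case (Suc j)
  then obtain k' where k: "k = Suc k'" by (cases k) auto
  have "poly_bdd w (\<lambda>i. (deriv ^^ j) (deriv (u i)))"
    by (rule Suc.IH[of k' "\<lambda>i. deriv (u i)"]) (use Suc.prems k in auto)
  then show ?case by (simp add: funpow_swap1)
qed

lemma moderate_iter_deriv:
  assumes "\<And>k. moderate w k u"
  shows "((deriv ^^ j) (u i) has_real_derivative (deriv ^^ Suc j) (u i) x) (at x)"
  using assms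
proof (induction j arbitrary: u)
  case 0
  then show ?case using moderate_has_deriv[OF 0[of "Suc 0"]] by simp
next
  case (Suc j)
  have "moderate w k (\<lambda>i. deriv (u i))" for k using Suc.prems[of "Suc k"] by simp
  from Suc.IH[OF this] show ?case by (simp add: funpow_swap1)
qed

lemma moderate_iter_deriv_cmult:
  assumes "\<And>k. moderate w k u"
  shows "(deriv ^^ j) (\<lambda>x. c * u i x) = (\<lambda>x. c * (deriv ^^ j) (u i) x)"
  using assms
proof (induction j arbitrary: u)
  case (Suc j)
  have 1: "moderate w k (\<lambda>i. deriv (u i))" for k using Suc.prems[of "Suc k"] by simp
  have "deriv (\<lambda>x. c * u i x) = (\<lambda>x. c * deriv (u i) x)"
    using moderate_has_deriv[OF Suc.prems] by (intro ext DERIV_imp_deriv DERIV_cmult) auto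
  then show ?case using Suc.IH[OF 1] by (simp add: funpow_swap1)
qed simp

text \<open>One fixed member of a family, read as a constant family, has bounds free of the new
  index, which are admissible for any weight.\<close>

lemma moderate_transfer:
  assumes "weight w'" "moderate w k u"
  shows "moderate w' k (\<lambda>j. u i)"
  using assms(2)
proof (induction k arbitrary: u)
  have pb: "poly_bdd w' (\<lambda>j. u i)" if u: "poly_bdd w u" for u
  proof -
    interpret w': weight w' by fact
    obtain C N where "\<And>i x. \<bar>u i x\<bar> \<le> C * w i ^ N" using u unfolding poly_bdd_def by blast
    then show ?thesis by (intro w'.poly_bdd_bound)
  qed
  {
    case 0
    then show ?case using pb by auto
  next
    case (Suc k)
    then show ?case using pb by (auto)
  }
qed

end

section \<open>The concentrating circle maps\<close>

text \<open>The lift of the Moebius map \<open>z \<mapsto> (z + r) / (1 + r z)\<close> of the unit circle, \<open>r = (L - 1) / (L + 1)\<close>: its derivative is a Poisson kernel with maximum \<open>L\<close> at \<open>1/2\<close>.\<close>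
definition bulge :: "real \<Rightarrow> real \<Rightarrow> real" where
  "bulge L y = y - arctan ((L - 1) / (L + 1) * sin (2 * pi * y) / (1 + (L - 1) / (L + 1) * cos (2 * pi * y))) / pi"

text \<open>The reciprocal of the derivative of \<open>bulge L\<close>.\<close>
definition bulge_speed :: "real \<Rightarrow> real \<Rightarrow> real" where
  "bulge_speed L y = (L + 1 / L) / 2 + (L - 1 / L) / 2 * cos (2 * pi * y)"

context
  fixes L :: real assumes L: "L \<ge> 1"
begin

lemma amplitude_nonneg: "(L - 1 / L) / 2 \<ge> 0"
proof -
  have "1 / L \<le> 1" using L by simp
  then have "1 / L \<le> L" using L by linarith
  then show ?thesis by simp
qed

lemma bulge_speed_ge: "bulge_speed L y \<ge> 1 / L"
proof -
  have "(L - 1 / L) / 2 * cos (2 * pi * y) \<ge> (L - 1 / L) / 2 * (- 1)"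
    by (rule mult_left_mono) (use amplitude_nonneg in auto)
  then show ?thesis by (simp add: bulge_speed_def field_simps)
qed

lemma bulge_speed_pos: "bulge_speed L y > 0"
  using bulge_speed_ge[of y] L by (smt (verit) divide_pos_pos)

text \<open>With \<open>r = (L - 1) / (L + 1)\<close> one has \<open>L = (1 + r) / (1 - r)\<close>,
  and \<open>bulge_speed L y\<close> equals |1 + r e^(2 pi i y)|^2 / (1 - r^2). The quotient rule
  under arctan leads to the reciprocal of the same expression.\<close>

lemma bulge_deriv: "(bulge L has_real_derivative 1 / bulge_speed L y) (at y)"
proof -
  define r where "r = (L - 1) / (L + 1)"
  define c s where "c = cos (2 * pi * y)" and "s = sin (2 * pi * y)"
  have r: "0 \<le> r" "r < 1" using L by (auto simp: r_def field_simps)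
  have cs: "c\<^sup>2 + s\<^sup>2 = 1" by (simp add: c_def s_def)
  have "\<bar>r * c\<bar> \<le> r * 1" unfolding abs_mult
    by (intro mult_mono) (use r in \<open>auto simp: c_def\<close>)
  then have d: "1 + r * c > 0" using r by linarith
  have L': "L = (1 + r) / (1 - r)" using L r by (simp add: r_def field_simps)
  have e: "(1 + r * c)\<^sup>2 + (r * s)\<^sup>2 = 1 + 2 * r * c + r\<^sup>2"
  proof -
    have "(1 + r * c)\<^sup>2 + (r * s)\<^sup>2 = 1 + 2 * r * c + r\<^sup>2 * (c\<^sup>2 + s\<^sup>2)"
      by (simp add: power2_eq_square algebra_simps)
    then show ?thesis by (simp add: cs)
  qed
  have "(1 + r * c)\<^sup>2 > 0" using d by simp
  then have epos: "1 + 2 * r * c + r\<^sup>2 > 0" using e zero_le_power2[of "r * s"] by linarith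
  have sp: "1 / bulge_speed L y = (1 - r\<^sup>2) / (1 + 2 * r * c + r\<^sup>2)"
  proof -
    have "bulge_speed L y = (1 + 2 * r * c + r\<^sup>2) / (1 - r\<^sup>2)"
    proof -
      have "1 - r\<^sup>2 = (1 - r) * (1 + r)" by (simp add: power2_eq_square algebra_simps)
      moreover have "1 / L = (1 - r) / (1 + r)" using L' by simp
      moreover have "((1 + r) / (1 - r) + (1 - r) / (1 + r)) / 2 + ((1 + r) / (1 - r) - (1 - r) / (1 + r)) / 2 * c
        = (1 + 2 * r * c + r\<^sup>2) / ((1 - r) * (1 + r))"
      proof -
        have *: "(a / D + b / D) / 2 + (a / D - b / D) / 2 * c = ((a + b) / 2 + (a - b) / 2 * c) / D" for a b D :: real
          by (cases "D = 0") (simp_all add: field_simps)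
        have "(1 + r) / (1 - r) = (1 + r)\<^sup>2 / ((1 - r) * (1 + r))" "(1 - r) / (1 + r) = (1 - r)\<^sup>2 / ((1 - r) * (1 + r))"
          using r by (simp_all add: power2_eq_square)
        then have "((1 + r) / (1 - r) + (1 - r) / (1 + r)) / 2 + ((1 + r) / (1 - r) - (1 - r) / (1 + r)) / 2 * c
          = (((1 + r)\<^sup>2 + (1 - r)\<^sup>2) / 2 + ((1 + r)\<^sup>2 - (1 - r)\<^sup>2) / 2 * c) / ((1 - r) * (1 + r))"
          using * by metis
        also have "((1 + r)\<^sup>2 + (1 - r)\<^sup>2) / 2 + ((1 + r)\<^sup>2 - (1 - r)\<^sup>2) / 2 * c = 1 + 2 * r * c + r\<^sup>2"
          by (simp add: power2_eq_square field_simps)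
        finally show ?thesis .
      qed
      ultimately show ?thesis unfolding bulge_speed_def c_def[symmetric] using L' by metis
    qed
    then show ?thesis by simp
  qed
  have "((\<lambda>y. y - arctan (r * sin (2 * pi * y) / (1 + r * cos (2 * pi * y))) / pi) has_real_derivative
     1 - (inverse (1 + (r * s / (1 + r * c))\<^sup>2) * (((r * (c * (2 * pi))) * (1 + r * c) - (r * s) * (r * (- s * (2 * pi)))) / (1 + r * c)\<^sup>2)) / pi) (at y)"
  proof (intro DERIV_diff DERIV_ident DERIV_cdivide)
    have "((\<lambda>y. r * sin (2 * pi * y)) has_real_derivative r * (c * (2 * pi))) (at y)"
      "((\<lambda>y. 1 + r * cos (2 * pi * y)) has_real_derivative r * (- s * (2 * pi))) (at y)"
      unfolding c_def s_def by (auto intro!: derivative_eq_intros)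
    from DERIV_quotient[OF this] d
    have "((\<lambda>y. r * sin (2 * pi * y) / (1 + r * cos (2 * pi * y))) has_real_derivative
       ((r * (c * (2 * pi))) * (1 + r * c) - (r * s) * (r * (- s * (2 * pi)))) / (1 + r * c)\<^sup>2) (at y)"
      unfolding c_def s_def by (simp only: numeral_2_eq_2 mult.commute)
    from DERIV_chain2[OF DERIV_arctan this]
    show "((\<lambda>y. arctan (r * sin (2 * pi * y) / (1 + r * cos (2 * pi * y)))) has_real_derivative
      inverse (1 + (r * s / (1 + r * c))\<^sup>2) * (((r * (c * (2 * pi))) * (1 + r * c) - (r * s) * (r * (- s * (2 * pi)))) / (1 + r * c)\<^sup>2)) (at y)"
      unfolding c_def s_def .
  qed
  moreover have "1 - (inverse (1 + (r * s / (1 + r * c))\<^sup>2) * (((r * (c * (2 * pi))) * (1 + r * c) - (r * s) * (r * (- s * (2 * pi)))) / (1 + r * c)\<^sup>2)) / pi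
     = (1 - r\<^sup>2) / (1 + 2 * r * c + r\<^sup>2)"
  proof -
    have 1: "inverse (1 + (r * s / (1 + r * c))\<^sup>2) = (1 + r * c)\<^sup>2 / (1 + 2 * r * c + r\<^sup>2)"
    proof -
      have "1 + (r * s / (1 + r * c))\<^sup>2 = (1 + 2 * r * c + r\<^sup>2) / (1 + r * c)\<^sup>2"
        using d by (simp add: e[symmetric] power_divide add_divide_distrib)
      then show ?thesis by simp
    qed
    have 2: "(r * (c * (2 * pi))) * (1 + r * c) - (r * s) * (r * (- s * (2 * pi))) = 2 * pi * (r * c + r\<^sup>2)"
    proof -
      have "(r * (c * (2 * pi))) * (1 + r * c) - (r * s) * (r * (- s * (2 * pi))) = 2 * pi * (r * c + r\<^sup>2 * (c\<^sup>2 + s\<^sup>2))"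
        by (simp add: algebra_simps power2_eq_square)
      then show ?thesis by (simp add: cs)
    qed
    have "1 - (((1 + r * c)\<^sup>2 / (1 + 2 * r * c + r\<^sup>2)) * (2 * pi * (r * c + r\<^sup>2) / (1 + r * c)\<^sup>2)) / pi
       = 1 - 2 * (r * c + r\<^sup>2) / (1 + 2 * r * c + r\<^sup>2)"
      using d by simp
    also have "\<dots> = (1 - r\<^sup>2) / (1 + 2 * r * c + r\<^sup>2)"
      using epos by (simp add: field_simps)
    finally show ?thesis by (simp only: 1 2)
  qed
  ultimately show ?thesis unfolding bulge_def[abs_def] r_def[symmetric] sp by simp
qed

text \<open>The arctan is bounded by pi/2. Rescaled by q, this gives the step size 1/q of the
  sequence \<open>G n\<close>.\<close>

lemma bulge_near: "\<bar>bulge L y - y\<bar> < 1"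
  using arctan_bounded[of "(L - 1) / (L + 1) * sin (2 * pi * y) / (1 + (L - 1) / (L + 1) * cos (2 * pi * y))"]
  by (simp add: bulge_def abs_less_iff field_simps)

lemma bulge_plus_1: "bulge L (y + 1) = bulge L y + 1"
  by (simp add: bulge_def distrib_left)

lemma bulge_zero [simp]: "bulge L 0 = 0" by (simp add: bulge_def)

text \<open>Oddness of arctan. The symmetry about 1/2 lets one tail estimate serve both sides of the
  peak.\<close>

lemma bulge_half: "bulge L (1 - y) = 1 - bulge L y"
proof -
  have "sin (2 * pi * (1 - y)) = - sin (2 * pi * y)" "cos (2 * pi * (1 - y)) = cos (2 * pi * y)"
    by (simp_all add: right_diff_distrib sin_diff cos_diff)
  then have "arctan ((L - 1) / (L + 1) * sin (2 * pi * (1 - y)) / (1 + (L - 1) / (L + 1) * cos (2 * pi * (1 - y))))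
    = - arctan ((L - 1) / (L + 1) * sin (2 * pi * y) / (1 + (L - 1) / (L + 1) * cos (2 * pi * y)))"
    by (simp only: arctan_minus[symmetric] mult_minus_right minus_divide_left)
  then show ?thesis unfolding bulge_def by (simp only:)
qed

lemma bulge_strict_mono: "strict_mono (bulge L)"
  unfolding strict_mono_def
  by (metis DERIV_pos_imp_increasing bulge_deriv bulge_speed_pos zero_less_divide_1_iff)

lemma bulge_isCont: "isCont (bulge L) y"
  using bulge_deriv DERIV_isCont by blast

lemma bulge_bij: "bij (bulge L)"
proof (rule bijI)
  show "inj (bulge L)" using bulge_strict_mono strict_mono_imp_inj_on by blast
  show "surj (bulge L)"
  proof (rule surjI[of _ "\<lambda>y. SOME x. bulge L x = y"])
    fix y
    have "\<exists>x\<ge>y - 1. x \<le> y + 1 \<and> bulge L x = y"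
      using bulge_near[of "y - 1"] bulge_near[of "y + 1"]
      by (intro IVT) (auto simp: bulge_isCont)
    then show "bulge L (SOME x. bulge L x = y) = y" by (metis (mono_tags, lifting) someI_ex)
  qed
qed

definition unbulge :: "real \<Rightarrow> real" where "unbulge = inv (bulge L)"

lemma bulge_unbulge [simp]: "bulge L (unbulge y) = y"
  unfolding unbulge_def using bulge_bij by (simp add: bij_is_surj surj_f_inv_f)

lemma unbulge_bulge [simp]: "unbulge (bulge L y) = y"
  unfolding unbulge_def using bulge_bij by (simp add: bij_is_inj)

text \<open>The inverse solves an autonomous equation whose right-hand side is a trigonometric
  polynomial; this is the form that \<open>moderate_ode\<close> accepts.\<close>

lemma unbulge_deriv: "(unbulge has_real_derivative bulge_speed L (unbulge y)) (at y)"
proof -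
  have c: "isCont unbulge y" for y
    using isCont_inverse_function2[of "unbulge y - 1" "unbulge y" "unbulge y + 1" unbulge "bulge L"]
    by (simp add: bulge_isCont)
  have "(unbulge has_real_derivative inverse (1 / bulge_speed L (unbulge y))) (at y)"
    by (rule DERIV_inverse_function[of "bulge L" _ _ _ "y - 1" "y + 1"])
       (use bulge_deriv bulge_speed_pos[of "unbulge y"] c in auto)
  then show ?thesis by simp
qed

text \<open>At distance u from the peak 1/2 the slope of \<open>bulge L\<close> is at most 1/(8 s
  u^2), where s = (L - 1/L)/2. Integrating this bound from 0 up to distance w leaves a tail of order
  1/(L w).\<close>

lemma bulge_tail:
  assumes "0 < w" "w \<le> 1/2" "L > 1"
  shows "bulge L (1/2 - w) \<le> 1 / (4 * (L - 1 / L) * w)"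
proof -
  define s where "s = (L - 1 / L) / 2"
  have s: "s > 0" using assms(3) less_1_mult[of L L] by (simp add: s_def field_simps)
  \<comment> \<open>Subtracts a primitive of the comparison slope 1/(8 s u^2), so it is enough that
    f is nonincreasing.\<close>
  define f where "f = (\<lambda>y. bulge L y - 1 / (8 * s * (1/2 - y)))"
  have "f (1/2 - w) \<le> f 0"
  proof (rule DERIV_nonpos_imp_nonincreasing[of 0 "1/2 - w" f])
    fix y assume y: "0 \<le> y" "y \<le> 1/2 - w"
    define u where "u = 1/2 - y"
    have u: "0 < u" "u \<le> 1/2" using y assms by (auto simp: u_def)
    have "cos (2 * pi * y) = - cos (2 * (pi * u))"
      unfolding u_def by (simp add: right_diff_distrib cos_diff algebra_simps)
    also have "cos (2 * (pi * u)) = 1 - 2 * (sin (pi * u))\<^sup>2" by (rule cos_double_sin)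
    finally have c: "cos (2 * pi * y) = 2 * (sin (pi * u))\<^sup>2 - 1" by simp
    \<comment> \<open>Jordan's inequality: the concave sine lies above its chord from 0 to
      pi/2.\<close>
    have "sin (pi * u) \<ge> 2 * u"
    proof -
      have "concave_on {0..pi} sin"
        by (rule f''_le0_imp_concave[of _ _ cos "\<lambda>x. - sin x"])
           (auto intro!: derivative_eq_intros sin_ge_zero)
      from concave_onD[OF this, of "2 * u" 0 "pi/2"] u
      show ?thesis by (simp add: algebra_simps)
    qed
    then have "(sin (pi * u))\<^sup>2 \<ge> (2 * u)\<^sup>2" using u by (intro power_mono) auto
    then have "s * (1 + cos (2 * pi * y)) \<ge> s * (8 * u\<^sup>2)"
      using s by (intro mult_left_mono) (auto simp: c power_mult_distrib)
    moreover have "bulge_speed L y = 1 / L + s * (1 + cos (2 * pi * y))"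
      by (simp add: bulge_speed_def s_def field_simps)
    ultimately have sp: "bulge_speed L y \<ge> 8 * s * u\<^sup>2"
      using L by (simp add: mult_ac add_increasing)
    have "(f has_real_derivative 1 / bulge_speed L y - 1 / (8 * s * u\<^sup>2)) (at y)"
    proof -
      have d: "((\<lambda>y. 1 / (8 * s) * inverse (1/2 - y)) has_real_derivative
          1 / (8 * s) * (- (inverse u * (-1) * inverse u))) (at y)"
        using u(1) s unfolding u_def by (auto intro!: derivative_eq_intros)
      have "((\<lambda>y. 1 / (8 * s * (1/2 - y))) has_real_derivative 1 / (8 * s * u\<^sup>2)) (at y)"
      proof -
        have *: "1 / (8 * s) * inverse x = 1 / (8 * s * x)" for x by (simp add: inverse_eq_divide)
        have "1 / (8 * s) * (- (inverse u * (-1) * inverse u)) = 1 / (8 * s * u\<^sup>2)"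
          by (simp add: inverse_eq_divide power2_eq_square)
        with d show ?thesis by (simp only: *)
      qed
      then show ?thesis unfolding f_def by (rule DERIV_diff[OF bulge_deriv])
    qed
    moreover have "1 / bulge_speed L y \<le> 1 / (8 * s * u\<^sup>2)"
      using sp s u by (intro divide_left_mono) (auto simp: bulge_speed_pos)
    ultimately show "\<exists>z. (f has_real_derivative z) (at y) \<and> z \<le> 0" by (intro exI conjI) auto
  qed (use assms in auto)
  moreover have "f 0 \<le> 0" using s by (simp add: f_def)
  moreover have "8 * s * (1/2 - (1/2 - w)) = 4 * (L - 1 / L) * w" by (simp add: s_def)
  then have "f (1/2 - w) = bulge L (1/2 - w) - 1 / (4 * (L - 1 / L) * w)"
    unfolding f_def by (simp only:)
  ultimately show ?thesis by linarith
qed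

end

lemma periodic_plus_int:
  fixes H :: "real \<Rightarrow> real"
  assumes "\<And>x. H (x + 1) = H x + 1" shows "H (x + of_int j) = H x + of_int j"
proof (induction j rule: int_induct[of _ 0])
  case (step1 i)
  then show ?case using assms[of "x + of_int i"] by (simp add: add.assoc)
next
  case (step2 i)
  then show ?case using assms[of "x + of_int i - 1"] by (simp add: algebra_simps)
qed simp

section \<open>Conjugating pairs of lifts and their refinement\<close>

lemma weight_one: "weight (\<lambda>_. 1)" by unfold_locales simp

text \<open>A one-point index set with weight 1 specialises \<open>moderate\<close> to a single
  function with all derivatives bounded.\<close>

definition bdd_smooth :: "(real \<Rightarrow> real) \<Rightarrow> bool" where
  "bdd_smooth u \<longleftrightarrow> (\<forall>k. moderate (\<lambda>_::unit. 1) k (\<lambda>_. u))"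

lemma bdd_smooth_bounded: "bdd_smooth u \<Longrightarrow> \<exists>C\<ge>1. \<forall>x. \<bar>u x\<bar> \<le> C"
proof -
  assume "bdd_smooth u"
  then have "poly_bdd (\<lambda>_::unit. 1) (\<lambda>_. u)" unfolding bdd_smooth_def
    by (metis weight.moderate_poly_bdd weight_one)
  then obtain C where C: "\<And>x. \<bar>u x\<bar> \<le> C" unfolding poly_bdd_def by auto
  have "\<bar>u x\<bar> \<le> max 1 C" for x using C[of x] by linarith
  then show ?thesis by (intro exI[of _ "max 1 C"]) auto
qed

text \<open>Boundedness is imposed on the derivatives because lifts grow linearly. The normalisation
  \<open>G 0 = 0\<close> makes the lifts preserve [0,1) and fixes the additive constant of the later
  distribution function.\<close>

definition conj_pair :: "(real \<Rightarrow> real) \<Rightarrow> (real \<Rightarrow> real) \<Rightarrow> bool" where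
  "conj_pair H G \<longleftrightarrow> (\<forall>x. G (H x) = x) \<and> (\<forall>x. H (G x) = x) \<and> (\<forall>x. H (x + 1) = H x + 1) \<and> G 0 = 0
    \<and> (\<forall>x. (H has_real_derivative deriv H x) (at x) \<and> deriv H x > 0)
    \<and> (\<forall>x. (G has_real_derivative deriv G x) (at x) \<and> deriv G x > 0)
    \<and> bdd_smooth (deriv H) \<and> bdd_smooth (deriv G)"

text \<open>\<open>next_G\<close> and \<open>next_H\<close> turn mutually inverse maps into mutually
  inverse maps. The bulge sits on the G side because the limit of the G becomes the distribution
  function of the measure: mass concentrates where G is steep.\<close>

definition next_G :: "real \<Rightarrow> real \<Rightarrow> (real \<Rightarrow> real) \<Rightarrow> real \<Rightarrow> real" where
  "next_G q L G x = bulge L (q * G x) / q"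

definition next_H :: "real \<Rightarrow> real \<Rightarrow> (real \<Rightarrow> real) \<Rightarrow> real \<Rightarrow> real" where
  "next_H q L H x = H (unbulge L (q * x) / q)"

lemma bulge_plus_int: "L \<ge> 1 \<Longrightarrow> bulge L (y + of_int j) = bulge L y + of_int j"
  by (rule periodic_plus_int[of "bulge L"]) (rule bulge_plus_1)

lemma unbulge_plus_int:
  assumes "L \<ge> 1" shows "unbulge L (y + of_int j) = unbulge L y + of_int j"
  by (metis assms bulge_plus_int bulge_unbulge unbulge_bulge)

lemma unbulge_near: "L \<ge> 1 \<Longrightarrow> \<bar>unbulge L y - y\<bar> < 1"
  by (metis bulge_near bulge_unbulge abs_minus_commute)

lemma conj_pair_G_plus_1: "conj_pair H G \<Longrightarrow> G (x + 1) = G x + 1"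
  unfolding conj_pair_def by metis

text \<open>The new conjugacy factor commutes with the rotation by p/q, so that rotation conjugates to the same map as before.\<close>
lemma next_conj_rational:
  assumes "conj_pair H G" "L \<ge> 1" "q > 0"
  shows "next_H q L H (next_G q L G x + of_int p / q) = H (G x + of_int p / q)"
proof -
  have "q * (bulge L (q * G x) / q + of_int p / q) = bulge L (q * G x) + of_int p"
    using assms(3) by (simp add: field_simps)
  then have "next_H q L H (next_G q L G x + of_int p / q) = H ((q * G x + of_int p) / q)"
    using assms(2) by (simp add: next_H_def next_G_def unbulge_plus_int)
  then show ?thesis
    using assms(3) by (simp add: add_divide_distrib)
qed

lemma next_G_deriv:
  assumes "conj_pair H G" "L \<ge> 1" "q > 0"
  shows "(next_G q L G has_real_derivative 1 / bulge_speed L (q * G x) * deriv G x) (at x)"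
proof -
  have "(G has_real_derivative deriv G x) (at x)" using assms by (auto simp: conj_pair_def)
  then have "((\<lambda>x. bulge L (q * G x)) has_real_derivative 1 / bulge_speed L (q * G x) * (q * deriv G x)) (at x)"
    by (intro DERIV_chain2[OF bulge_deriv] assms DERIV_cmult)
  from DERIV_cdivide[OF this, of q] show ?thesis using assms(3) unfolding next_G_def[abs_def] by simp
qed

lemma next_H_deriv:
  assumes "conj_pair H G" "L \<ge> 1" "q > 0"
  shows "(next_H q L H has_real_derivative
     deriv H (unbulge L (q * x) / q) * bulge_speed L (q * (unbulge L (q * x) / q))) (at x)"
proof -
  have "(H has_real_derivative deriv H y) (at y)" for y using assms by (auto simp: conj_pair_def)
  moreover have "((\<lambda>x. unbulge L (q * x)) has_real_derivative bulge_speed L (unbulge L (q * x)) * q) (at x)"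
    by (rule DERIV_chain2[OF unbulge_deriv]) (auto intro!: derivative_eq_intros assms)
  from DERIV_cdivide[OF this, of q]
  have "((\<lambda>x. unbulge L (q * x) / q) has_real_derivative bulge_speed L (q * (unbulge L (q * x) / q))) (at x)"
    using assms(3) by simp
  ultimately show ?thesis unfolding next_H_def[abs_def] by (rule DERIV_chain2)
qed

text \<open>An index is a pair of q - 1 and a real shift, later taken to be p/q. The weight sees
  only the denominator, so every polynomial bound is uniform in the numerator.\<close>

definition stage_weight :: "nat \<times> real \<Rightarrow> real" where "stage_weight i = real (Suc (fst i))"

interpretation sw: weight stage_weight
  by unfold_locales (simp add: stage_weight_def)

lemma bdd_smooth_moderate:
  assumes "bdd_smooth u" shows "moderate stage_weight k (\<lambda>_. u)"
  using weight.moderate_transfer[OF weight_one sw.weight_axioms, where u = "\<lambda>_::unit. u"] assms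
  by (simp add: bdd_smooth_def)

lemma moderate_bdd_smooth: "(\<And>k. moderate stage_weight k u) \<Longrightarrow> bdd_smooth (u i)"
  unfolding bdd_smooth_def using sw.moderate_transfer[OF weight_one] by blast

text \<open>The change of the conjugated rotation by t in passing to the next stage. Summed over the
  stages, these differences telescope to the limit diffeomorphism.\<close>

definition stage_shift :: "real \<Rightarrow> real \<Rightarrow> (real \<Rightarrow> real) \<Rightarrow> (real \<Rightarrow> real) \<Rightarrow> real \<Rightarrow> real \<Rightarrow> real" where
  "stage_shift q L H G t x = next_H q L H (next_G q L G x + t) - H (G x + t)"

section \<open>Derivative bounds for one stage, uniform in the approximating fraction\<close>

context
  fixes H G :: "real \<Rightarrow> real" and \<gamma> :: real
  assumes HG: "conj_pair H G" and gam: "\<gamma> \<ge> 0"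
begin

definition "stage_slope i = stage_weight i powr \<gamma>"

lemma stage_slope_ge_1: "stage_slope i \<ge> 1"
  unfolding stage_slope_def using sw.w_ge_1 gam by (simp add: ge_one_powr_ge_zero)

lemma stage_weight_pos: "stage_weight i > 0" by (simp add: stage_weight_def)

lemma poly_bdd_stage_slope: "poly_bdd stage_weight (\<lambda>i x. stage_slope i)"
  unfolding poly_bdd_def
proof (intro exI allI)
  fix i :: "nat \<times> real" and x :: real
  have "stage_slope i \<le> stage_weight i powr real (nat \<lceil>\<gamma>\<rceil>)"
    unfolding stage_slope_def using sw.w_ge_1[of i] by (intro powr_mono) (auto simp: of_nat_ceiling)
  then show "\<bar>stage_slope i\<bar> \<le> 1 * stage_weight i ^ nat \<lceil>\<gamma>\<rceil>"
    using stage_slope_ge_1[of i] stage_weight_pos[of i] by (simp add: powr_realpow)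
qed

lemma poly_bdd_weight: "poly_bdd stage_weight (\<lambda>i x. stage_weight i)"
  unfolding poly_bdd_def by (rule exI[of _ 1], rule exI[of _ 1]) (auto simp: stage_weight_def)

lemma moderate_speed: "moderate stage_weight k (\<lambda>i x. bulge_speed (stage_slope i) (stage_weight i * x))"
proof -
  have i: "poly_bdd stage_weight (\<lambda>i x. 1 / stage_slope i)"
  proof (rule sw.poly_bdd_bound)
    fix i and x :: real
    show "\<bar>1 / stage_slope i\<bar> \<le> 1" using stage_slope_ge_1[of i] by simp
  qed
  have "poly_bdd stage_weight (\<lambda>i x. (1/2) * (stage_slope i + 1 / stage_slope i))"
    by (intro sw.poly_bdd_cmult sw.poly_bdd_add poly_bdd_stage_slope i)
  then have 1: "moderate stage_weight k (\<lambda>i x. (1/2) * (stage_slope i + 1 / stage_slope i))"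
    by (rule sw.moderate_const)
  have "poly_bdd stage_weight (\<lambda>i x. (1/2) * (stage_slope i + (- 1) * (1 / stage_slope i)))"
    by (intro sw.poly_bdd_cmult sw.poly_bdd_add poly_bdd_stage_slope i)
  then have 2: "moderate stage_weight k (\<lambda>i x. ((1/2) * (stage_slope i + (- 1) * (1 / stage_slope i))) * cos ((2 * pi * stage_weight i) * x))"
    by (rule sw.moderate_trig[OF _ sw.poly_bdd_cmult[OF poly_bdd_weight, of "2 * pi"], THEN conjunct1])
  show ?thesis
    using sw.moderate_add[OF 1 2] by (simp add: bulge_speed_def mult_ac)
qed

text \<open>The speed is at least 1/L, so its reciprocal is at most L = q^\<gamma>, which is
  polynomial in q.\<close>

lemma moderate_inv_speed: "moderate stage_weight k (\<lambda>i x. 1 / bulge_speed (stage_slope i) (stage_weight i * x))"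
proof (rule sw.moderate_inverse[OF moderate_speed])
  show "bulge_speed (stage_slope i) (stage_weight i * x) \<noteq> 0" for i x
    using bulge_speed_pos[OF stage_slope_ge_1] by (metis less_irrefl)
  show "poly_bdd stage_weight (\<lambda>i x. 1 / bulge_speed (stage_slope i) (stage_weight i * x))"
  proof (rule sw.poly_bdd_mono[OF poly_bdd_stage_slope])
    fix i and x :: real
    have "1 / bulge_speed (stage_slope i) (stage_weight i * x) \<le> stage_slope i"
      using bulge_speed_ge[OF stage_slope_ge_1, of i "stage_weight i * x"] bulge_speed_pos[OF stage_slope_ge_1, of i "stage_weight i * x"] stage_slope_ge_1[of i]
      by (simp add: field_simps)
    then show "\<bar>1 / bulge_speed (stage_slope i) (stage_weight i * x)\<bar> \<le> \<bar>stage_slope i\<bar>"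
      using bulge_speed_pos[OF stage_slope_ge_1, of i "stage_weight i * x"] stage_slope_ge_1[of i] by simp
  qed
qed

definition "stage_H i = next_H (stage_weight i) (stage_slope i) H"
definition "stage_G i = next_G (stage_weight i) (stage_slope i) G"

lemma stage_H_deriv: "(stage_H i has_real_derivative
     deriv H (unbulge (stage_slope i) (stage_weight i * x) / stage_weight i) * bulge_speed (stage_slope i) (stage_weight i * (unbulge (stage_slope i) (stage_weight i * x) / stage_weight i))) (at x)"
  unfolding stage_H_def by (rule next_H_deriv[OF HG stage_slope_ge_1 stage_weight_pos])

lemma stage_G_deriv: "(stage_G i has_real_derivative 1 / bulge_speed (stage_slope i) (stage_weight i * G x) * deriv G x) (at x)"
  unfolding stage_G_def by (rule next_G_deriv[OF HG stage_slope_ge_1 stage_weight_pos])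

lemma G_deriv: "(G has_real_derivative deriv G x) (at x)"
  and H_deriv: "(H has_real_derivative deriv H x) (at x)"
  using HG by (auto simp: conj_pair_def)

lemma moderate_G: "moderate stage_weight k (\<lambda>i. deriv G)"
  and moderate_H: "moderate stage_weight k (\<lambda>i. deriv H)"
  using HG by (auto simp: conj_pair_def intro: bdd_smooth_moderate)

lemma moderate_stage_G: "moderate stage_weight k (\<lambda>i. deriv (stage_G i))"
proof -
  have "moderate stage_weight k (\<lambda>i x. 1 / bulge_speed (stage_slope i) (stage_weight i * G x) * deriv G x)"
  proof (rule sw.moderate_mult[OF _ moderate_G])
    show "moderate stage_weight k (\<lambda>i x. 1 / bulge_speed (stage_slope i) (stage_weight i * G x))"
      using sw.moderate_compose[OF moderate_inv_speed G_deriv moderate_G] .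
  qed
  moreover have "deriv (stage_G i) x = 1 / bulge_speed (stage_slope i) (stage_weight i * G x) * deriv G x" for i x
    using stage_G_deriv DERIV_imp_deriv by blast
  ultimately show ?thesis by presburger
qed

lemma moderate_stage_H: "moderate stage_weight k (\<lambda>i. deriv (stage_H i))"
proof -
  define A where "A = (\<lambda>i x. unbulge (stage_slope i) (stage_weight i * x) / stage_weight i)"
  \<comment> \<open>\<open>A i\<close> solves an autonomous equation with moderate right-hand side,
    so \<open>moderate_ode\<close> takes the place of a higher-order chain rule for the
    inverse.\<close>
  have dA: "(A i has_real_derivative bulge_speed (stage_slope i) (stage_weight i * A i x)) (at x)" for i x
  proof -
    have "((\<lambda>x. unbulge (stage_slope i) (stage_weight i * x)) has_real_derivative
      bulge_speed (stage_slope i) (unbulge (stage_slope i) (stage_weight i * x)) * stage_weight i) (at x)"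
      by (rule DERIV_chain2[OF unbulge_deriv[OF stage_slope_ge_1]]) (auto intro!: derivative_eq_intros)
    from DERIV_cdivide[OF this, of "stage_weight i"] show ?thesis
      using stage_weight_pos[of i] unfolding A_def by simp
  qed
  have mA: "moderate stage_weight k (\<lambda>i x. bulge_speed (stage_slope i) (stage_weight i * A i x))" for k
    using sw.moderate_ode[OF moderate_speed dA] .
  have "moderate stage_weight k (\<lambda>i x. deriv H (A i x))"
    using sw.moderate_compose[OF moderate_H dA mA] .
  from sw.moderate_mult[OF this mA]
  have "moderate stage_weight k (\<lambda>i x. deriv H (A i x) * bulge_speed (stage_slope i) (stage_weight i * A i x))" .
  moreover have "deriv (stage_H i) x = deriv H (A i x) * bulge_speed (stage_slope i) (stage_weight i * A i x)" for i x
    using stage_H_deriv[of i x] DERIV_imp_deriv unfolding A_def by blast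
  ultimately show ?thesis by presburger
qed

lemma conj_pair_next: "conj_pair (stage_H i) (stage_G i)"
proof -
  let ?q = "stage_weight i" and ?L = "stage_slope i"
  have q: "?q > 0" by (rule stage_weight_pos)
  have "deriv (stage_H i) x = deriv H (unbulge ?L (?q * x) / ?q) * bulge_speed ?L (?q * (unbulge ?L (?q * x) / ?q))" for x
    using stage_H_deriv DERIV_imp_deriv by blast
  then have 1: "(stage_H i has_real_derivative deriv (stage_H i) x) (at x) \<and> deriv (stage_H i) x > 0" for x
    using stage_H_deriv[of i x] HG bulge_speed_pos[OF stage_slope_ge_1] by (simp add: conj_pair_def)
  have "deriv (stage_G i) x = 1 / bulge_speed ?L (?q * G x) * deriv G x" for x
    using stage_G_deriv DERIV_imp_deriv by blast
  then have 2: "(stage_G i has_real_derivative deriv (stage_G i) x) (at x) \<and> deriv (stage_G i) x > 0" for x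
    using stage_G_deriv[of i x] HG bulge_speed_pos[OF stage_slope_ge_1] by (simp add: conj_pair_def)
  have 3: "stage_H i (x + 1) = stage_H i x + 1" for x
  proof -
    \<comment> \<open>Here q has to be an integer: the rescaled map then still commutes with the
      translation by 1.\<close>
    have "?q * (x + 1) = ?q * x + of_int (int (Suc (fst i)))"
      by (simp add: stage_weight_def algebra_simps)
    then have "unbulge ?L (?q * (x + 1)) = unbulge ?L (?q * x) + ?q"
      using unbulge_plus_int[OF stage_slope_ge_1, of i "?q * x" "int (Suc (fst i))"] by (simp add: stage_weight_def)
    then have "stage_H i (x + 1) = H (unbulge ?L (?q * x) / ?q + 1)"
      using q by (simp add: stage_H_def next_H_def add_divide_distrib)
    then show ?thesis using HG by (simp add: stage_H_def next_H_def conj_pair_def)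
  qed
  have 4: "stage_G i (stage_H i x) = x" "stage_H i (stage_G i x) = x" for x
    using HG stage_slope_ge_1[of i] q by (simp_all add: stage_H_def stage_G_def next_H_def next_G_def conj_pair_def)
  have 5: "stage_G i 0 = 0" using HG stage_slope_ge_1[of i] by (simp add: stage_G_def next_G_def conj_pair_def)
  show ?thesis unfolding conj_pair_def
    using 1 2 3 4 5 moderate_bdd_smooth[of "\<lambda>i. deriv (stage_H i)"] moderate_bdd_smooth[of "\<lambda>i. deriv (stage_G i)"] moderate_stage_H moderate_stage_G
    by blast
qed

lemma conj_pair_next_stage:
  "conj_pair (next_H (Suc m) (Suc m powr \<gamma>) H) (next_G (Suc m) (Suc m powr \<gamma>) G)"
  using conj_pair_next[of "(m, 0)"] unfolding stage_H_def stage_G_def stage_slope_def stage_weight_def fst_conv .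

text \<open>The rotation by p/q has the same conjugate before and after the refinement, so the stage
  shift at p/q vanishes. Subtracting it from the stage shift at t and dividing by t - p/q leaves
  difference quotients, which are moderate uniformly in p; multiplying back yields the factor |t -
  p/q|.\<close>

lemma stage_shift_bound:
  "\<exists>C N. C \<ge> 0 \<and> (\<forall>m p x. \<bar>(deriv ^^ k) (stage_shift (Suc m) (Suc m powr \<gamma>) H G t) x\<bar>
      \<le> C * real (Suc m) ^ N * \<bar>t - of_int p / Suc m\<bar>)" (is ?thesis1)
  and bdd_smooth_stage_shift: "bdd_smooth (stage_shift (Suc m) (Suc m powr \<gamma>) H G t)" (is ?thesis2)
proof -
  define \<Delta> where "\<Delta> = (\<lambda>i x. (stage_H i (stage_G i x + t) - stage_H i (stage_G i x + snd i)) / (t - snd i)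
    - (H (G x + t) - H (G x + snd i)) / (t - snd i))"
  have stage_H_deriv': "(stage_H i has_real_derivative deriv (stage_H i) x) (at x)" for i x
    using conj_pair_next[of i] by (simp add: conj_pair_def)
  have stage_G_deriv': "(stage_G i has_real_derivative deriv (stage_G i) x) (at x)" for i x
    using conj_pair_next[of i] by (simp add: conj_pair_def)
  have m: "moderate stage_weight k \<Delta>" for k
    unfolding \<Delta>_def
    by (intro sw.moderate_diff
          sw.moderate_diff_quotient[where s = "\<lambda>_. t" and t = snd, OF stage_H_deriv' moderate_stage_H stage_G_deriv' moderate_stage_G]
          sw.moderate_diff_quotient[where s = "\<lambda>_. t" and t = snd and u = "\<lambda>_. H" and v = "\<lambda>_. G", OF H_deriv moderate_H G_deriv moderate_G])
  obtain C N where CN: "C \<ge> 0" "\<And>i x. \<bar>(deriv ^^ k) (\<Delta> i) x\<bar> \<le> C * stage_weight i ^ N"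
    using sw.poly_bddE[OF sw.moderate_deriv_bound[OF m order_refl]] by blast
  have eq: "stage_shift (Suc m) (Suc m powr \<gamma>) H G t
    = (\<lambda>x. (t - of_int p / Suc m) * \<Delta> (m, of_int p / Suc m) x)" for m and p :: int
  proof -
    let ?i = "(m, of_int p / real (Suc m))"
    have r: "stage_H ?i (stage_G ?i x + of_int p / Suc m) = H (G x + of_int p / Suc m)" for x
      unfolding stage_H_def stage_G_def stage_weight_def fst_conv
      by (rule next_conj_rational[OF HG stage_slope_ge_1]) simp
    have "stage_H ?i (stage_G ?i x + t) - H (G x + t) = (t - of_int p / Suc m) * \<Delta> ?i x" for x
    proof (cases "t = of_int p / Suc m")
      case True
      then show ?thesis using r[of x] by simp
    next
      case False
      have cancel: "d * (A / d - B / d) = A - B" if "d \<noteq> 0" for A B d :: real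
        using that by (simp add: right_diff_distrib)
      have "(t - of_int p / Suc m) * \<Delta> ?i x = (stage_H ?i (stage_G ?i x + t) - stage_H ?i (stage_G ?i x + of_int p / Suc m))
          - (H (G x + t) - H (G x + of_int p / Suc m))"
        unfolding \<Delta>_def snd_conv by (rule cancel) (use False in simp)
      then show ?thesis using r[of x] by simp
    qed
    then show ?thesis unfolding stage_H_def stage_G_def stage_slope_def stage_weight_def fst_conv stage_shift_def[abs_def] by presburger
  qed
  have "\<bar>(deriv ^^ k) (stage_shift (Suc m) (Suc m powr \<gamma>) H G t) x\<bar>
      \<le> C * real (Suc m) ^ N * \<bar>t - of_int p / Suc m\<bar>" for m p x
  proof -
    have "\<bar>(t - of_int p / Suc m) * (deriv ^^ k) (\<Delta> (m, of_int p / Suc m)) x\<bar> \<le> C * stage_weight (m, of_int p / Suc m) ^ N * \<bar>t - of_int p / Suc m\<bar>"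
      unfolding abs_mult using CN(2)[of "(m, of_int p / Suc m)" x]
      by (metis abs_ge_zero mult.commute mult_right_mono)
    then show ?thesis
      unfolding eq[of m p] sw.moderate_iter_deriv_cmult[OF m] by (simp add: stage_weight_def)
  qed
  then show ?thesis1 using CN(1) by blast
  \<comment> \<open>Smoothness of one fixed stage is qualitative, so any numerator serves; p = 0 is
    taken.\<close>
  have "moderate stage_weight k (\<lambda>i x. (t - of_int 0 / Suc m) * \<Delta> i x)" for k
    by (rule sw.moderate_cmult[OF m])
  from moderate_bdd_smooth[OF this, of "(m, of_int 0 / Suc m)"]
  show ?thesis2 unfolding eq[of m 0] .
qed

end

section \<open>Construction of the stages\<close>

text \<open>The definition promises good approximations with q > 1 but not that q is large. The
  fractions with denominator at most Q + 1 keep a positive distance d from the irrational \<tau>,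
  and a high exponent forces the approximation closer than d.\<close>

lemma liouville_large_denominator:
  assumes "liouville \<tau>"
  shows "\<exists>(p::int) m. Suc m \<ge> Q \<and> \<bar>\<tau> - of_int p / real (Suc m)\<bar> < 1 / real (Suc m) ^ N"
proof -
  \<comment> \<open>For q \<ge> 1 this is the distance from \<tau> to the nearest fraction with
    denominator q.\<close>
  define e where "e = (\<lambda>q::nat. \<bar>real q * \<tau> - of_int (round (real q * \<tau>))\<bar> / real q)"
  define d where "d = Min (e ` {1..Suc Q})"
  have epos: "e q > 0" if "q \<ge> 1" for q
  proof -
    have "real q * \<tau> \<noteq> of_int j" for j
    proof
      assume "real q * \<tau> = of_int j"
      then have "\<tau> = of_int j / of_nat q" using that by (simp add: field_simps)
      then show False using assms by (auto simp: liouville_def)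
    qed
    then show ?thesis using that by (simp add: e_def)
  qed
  then have "d > 0" unfolding d_def by (subst Min_gr_iff) auto
  then obtain k where k: "(1/2::real) ^ k < d" using real_arch_pow_inv[of d "1/2"] by auto
  define n where "n = Suc (max k N)"
  obtain p q :: int where pq: "q > 1" "\<bar>\<tau> - of_int p / of_int q\<bar> < 1 / (of_int q) ^ n"
    using assms unfolding liouville_def by (metis n_def le_add1 plus_1_eq_Suc)
  define m where "m = nat q - 1"
  have qm: "real_of_int q = real (Suc m)" using pq(1) by (simp add: m_def)
  have "1 / real (Suc m) ^ n < d"
  proof -
    have "1 / real (Suc m) ^ n \<le> 1 / 2 ^ n"
      using pq(1) qm by (intro divide_left_mono power_mono) auto
    also have "\<dots> \<le> (1/2) ^ k" by (simp add: power_one_over n_def field_simps)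
       (metis le_SucI max.cobounded1 one_le_numeral power_increasing power_Suc)
    finally show ?thesis using k by simp
  qed
  then have lt: "\<bar>\<tau> - of_int p / Suc m\<bar> < d" using pq qm by auto
  have "Suc m > Q"
  proof (rule ccontr)
    assume "\<not> Suc m > Q"
    then have "d \<le> e (Suc m)" unfolding d_def by (intro Min_le) auto
    moreover have "e (Suc m) \<le> \<bar>\<tau> - of_int p / Suc m\<bar>"
    proof -
      have "e (Suc m) \<le> \<bar>real (Suc m) * \<tau> - of_int p\<bar> / real (Suc m)"
        unfolding e_def using round_diff_minimal[of "real (Suc m) * \<tau>" p]
        by (intro divide_right_mono) (auto simp: abs_minus_commute)
      also have "\<dots> = \<bar>(real (Suc m) * \<tau> - of_int p) / real (Suc m)\<bar>" by simp
      also have "(real (Suc m) * \<tau> - of_int p) / real (Suc m) = \<tau> - of_int p / real (Suc m)"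
        by (simp add: field_simps)
      finally show ?thesis .
    qed
    ultimately show False using lt by simp
  qed
  moreover have "1 / real (Suc m) ^ n \<le> 1 / real (Suc m) ^ N"
    by (intro divide_left_mono power_increasing) (auto simp: n_def)
  ultimately show ?thesis using pq(2) qm by (intro exI[of _ p] exI[of _ m]) auto
qed

text \<open>Finitely many orders k \<le> n matter, so one constant c and one exponent K serve them
  all. A Liouville approximation of order K + 1 leaves c/q, which is at most 2^-n for large q; the
  three conditions on B hold for all large q.\<close>

lemma next_stage_exists:
  assumes "liouville \<tau>" "conj_pair H G" "\<gamma> > 0" "\<epsilon> > 0"
  shows "\<exists>m. B \<le> real (Suc m) \<and> B \<le> real (Suc m) powr \<epsilon> \<and> B \<le> real (Suc m) powr \<gamma> \<and>
    (\<forall>k\<le>n. \<forall>x. \<forall>t\<in>{\<tau>, -\<tau>}. \<bar>(deriv ^^ k) (stage_shift (Suc m) (Suc m powr \<gamma>) H G t) x\<bar> \<le> (1/2) ^ n)"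
proof -
  have "\<forall>k. \<exists>C N. C \<ge> 0 \<and> (\<forall>m p x. \<forall>t\<in>{\<tau>, -\<tau>}. \<bar>(deriv ^^ k) (stage_shift (Suc m) (Suc m powr \<gamma>) H G t) x\<bar>
      \<le> C * real (Suc m) ^ N * \<bar>t - of_int p / Suc m\<bar>)"
  proof
    fix k
    have g: "\<gamma> \<ge> 0" using assms by simp
    obtain C N where 1: "C \<ge> 0" "\<And>m p x. \<bar>(deriv ^^ k) (stage_shift (Suc m) (Suc m powr \<gamma>) H G \<tau>) x\<bar>
      \<le> C * real (Suc m) ^ N * \<bar>\<tau> - of_int p / Suc m\<bar>" using stage_shift_bound[OF assms(2) g] by metis
    obtain D K where 2: "D \<ge> 0" "\<And>m p x. \<bar>(deriv ^^ k) (stage_shift (Suc m) (Suc m powr \<gamma>) H G (-\<tau>)) x\<bar>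
      \<le> D * real (Suc m) ^ K * \<bar>-\<tau> - of_int p / Suc m\<bar>" using stage_shift_bound[OF assms(2) g] by metis
    have a: "C * real (Suc m) ^ N \<le> (C + D) * real (Suc m) ^ (N + K)" for m
      using 1(1) 2(1) by (intro mult_mono power_increasing) auto
    have b: "D * real (Suc m) ^ K \<le> (C + D) * real (Suc m) ^ (N + K)" for m
      using 1(1) 2(1) by (intro mult_mono power_increasing) auto
    show "\<exists>C N. C \<ge> 0 \<and> (\<forall>m p x. \<forall>t\<in>{\<tau>, -\<tau>}. \<bar>(deriv ^^ k) (stage_shift (Suc m) (Suc m powr \<gamma>) H G t) x\<bar>
      \<le> C * real (Suc m) ^ N * \<bar>t - of_int p / Suc m\<bar>)"
      using 1(1) 2(1) order_trans[OF 1(2) mult_right_mono[OF a abs_ge_zero]] order_trans[OF 2(2) mult_right_mono[OF b abs_ge_zero]]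
      by (intro exI[of _ "C + D"] exI[of _ "N + K"]) auto
  qed
  then obtain C N where C: "\<And>k. C k \<ge> 0" and
    CN: "\<And>k m p x t. t\<in>{\<tau>, -\<tau>} \<Longrightarrow> \<bar>(deriv ^^ k) (stage_shift (Suc m) (Suc m powr \<gamma>) H G t) x\<bar>
      \<le> C k * real (Suc m) ^ N k * \<bar>t - of_int p / Suc m\<bar>" by metis
  define c where "c = Max (C ` {..n})"
  define K where "K = Max (N ` {..n})"
  have ck: "C k \<le> c" "N k \<le> K" if "k \<le> n" for k
    using that by (auto simp: c_def K_def)
  have "eventually (\<lambda>q::nat. B \<le> real q \<and> B \<le> real q powr \<epsilon> \<and> B \<le> real q powr \<gamma> \<and> c * 2 ^ n \<le> real q) sequentially"
  proof -
    have "filterlim (\<lambda>q::nat. real q powr \<epsilon>) at_top sequentially" "filterlim (\<lambda>q::nat. real q powr \<gamma>) at_top sequentially"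
      using assms(3,4) by real_asymp+
    then show ?thesis
      using filterlim_real_sequentially unfolding filterlim_at_top
      by (auto intro!: eventually_conj)
  qed
  then obtain q1 :: nat where q1: "\<And>q. q \<ge> q1 \<Longrightarrow> B \<le> real q \<and> B \<le> real q powr \<epsilon> \<and> B \<le> real q powr \<gamma> \<and> c * 2 ^ n \<le> real q"
    unfolding eventually_sequentially by blast
  obtain p :: int and m where pm: "Suc m \<ge> q1" "\<bar>\<tau> - of_int p / real (Suc m)\<bar> < 1 / real (Suc m) ^ Suc K"
    using liouville_large_denominator[OF assms(1)] by blast
  have "\<bar>(deriv ^^ k) (stage_shift (Suc m) (Suc m powr \<gamma>) H G t) x\<bar> \<le> (1/2) ^ n" if k: "k \<le> n" and t: "t \<in> {\<tau>, -\<tau>}" for k x t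
  proof -
    \<comment> \<open>For -\<tau> the fraction -p/q is as good as p/q is for \<tau>.\<close>
    obtain p' :: int where p': "\<bar>t - of_int p' / Suc m\<bar> < 1 / real (Suc m) ^ Suc K"
    proof (cases "t = \<tau>")
      case True
      then show ?thesis using that pm by blast
    next
      case False
      then have "\<bar>t - of_int (-p) / Suc m\<bar> < 1 / real (Suc m) ^ Suc K"
        using t pm(2) by (auto simp: abs_if split: if_splits)
      then show ?thesis using that by blast
    qed
    have "C k * real (Suc m) ^ N k * \<bar>t - of_int p' / Suc m\<bar> \<le> c * real (Suc m) ^ K * (1 / real (Suc m) ^ Suc K)"
      using p' ck[OF k] C[of k] by (intro mult_mono power_increasing) auto
    also have "\<dots> = c / real (Suc m)"
    proof -
      have "c * a ^ K * (1 / a ^ Suc K) = c / a" if "a > 0" for a :: real using that by simp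
      then show ?thesis by simp
    qed
    also have "\<dots> \<le> (1/2) ^ n" using q1[OF pm(1)] by (simp add: field_simps power_one_over)
    finally show ?thesis using CN[OF t, of k m x p'] by linarith
  qed
  then show ?thesis using q1[OF pm(1)] by blast
qed

lemma conj_pair_id: "conj_pair (\<lambda>x. x) (\<lambda>x. x)"
proof -
  have "bdd_smooth (\<lambda>x. 1)" unfolding bdd_smooth_def
    by (intro allI weight.moderate_const'[OF weight_one])
  then show ?thesis by (simp add: conj_pair_def)
qed

text \<open>\<open>M n\<close> and \<open>m n\<close> bound the Lipschitz constants of
  \<open>G n\<close> and \<open>H n\<close>, which are fixed before \<open>q n\<close> is chosen;
  \<open>q_large\<close> makes them negligible against small powers of \<open>q n\<close>. The
  factor 64 * 2 ^ n absorbs the numerical constants of all later estimates, and \<open>q_Suc\<close>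
  makes 1/q(n+1) small even against 2^-n/q(n). Both \<tau> and -\<tau> occur in \<open>close\<close>
  so that the inverse of the limit is smooth as well.\<close>

locale stages =
  fixes \<tau> :: real and \<gamma> \<epsilon> :: "nat \<Rightarrow> real" and H G :: "nat \<Rightarrow> real \<Rightarrow> real" and q :: "nat \<Rightarrow> nat" and M m :: "nat \<Rightarrow> real"
  assumes gamma: "\<And>n. \<gamma> n > 0" and eps: "\<And>n. \<epsilon> n > 0"
    and HG: "\<And>n. conj_pair (H n) (G n)" and H0: "H 0 = (\<lambda>x. x)" and G0: "G 0 = (\<lambda>x. x)"
    and q_ge_1: "\<And>n. q n \<ge> 1" and M_ge_1: "\<And>n. M n \<ge> 1" and m_ge_1: "\<And>n. m n \<ge> 1"
    and M: "\<And>n x. deriv (G n) x \<le> M n" and m: "\<And>n x. deriv (H n) x \<le> m n"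
    and H_Suc: "\<And>n. H (Suc n) = next_H (q n) (q n powr \<gamma> n) (H n)"
    and G_Suc: "\<And>n. G (Suc n) = next_G (q n) (q n powr \<gamma> n) (G n)"
    and q_large: "\<And>n. 64 * 2 ^ n * M n * m n \<le> q n" "\<And>n. 64 * 2 ^ n * M n * m n \<le> q n powr \<epsilon> n"
    "\<And>n. 64 * 2 ^ n * M n * m n \<le> q n powr \<gamma> n" and q_Suc: "\<And>n. 64 * 2 ^ n * real (q n) \<le> q (Suc n)"
    and close: "\<And>n k t x. k \<le> n \<Longrightarrow> t \<in> {\<tau>, -\<tau>} \<Longrightarrow>
       \<bar>(deriv ^^ k) (stage_shift (q n) (q n powr \<gamma> n) (H n) (G n) t) x\<bar> \<le> (1/2) ^ n"

lemma stages_exist: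
  fixes \<gamma> \<epsilon> :: "nat \<Rightarrow> real"
  assumes "liouville \<tau>" "\<And>n. \<gamma> n > 0" "\<And>n. \<epsilon> n > 0"
  shows "\<exists>H G q M m. stages \<tau> \<gamma> \<epsilon> H G q M m"
proof -
  \<comment> \<open>A state consists of H, G and the denominator that led to them, which is
    arbitrary at stage 0. The bounds M and m belong to the old state, and q1 is chosen after
    them.\<close>
  define R where "R = (\<lambda>(n::nat) (H, G, q0::nat) (H', G', q1::nat). \<exists>M m :: real. M \<ge> 1 \<and> m \<ge> 1 \<and>
    (\<forall>x. deriv G x \<le> M) \<and> (\<forall>x. deriv H x \<le> m) \<and> q1 \<ge> 1 \<and>
    H' = next_H q1 (q1 powr \<gamma> n) H \<and> G' = next_G q1 (q1 powr \<gamma> n) G \<and>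
    64 * 2 ^ n * M * m \<le> q1 \<and> 64 * 2 ^ n * M * m \<le> q1 powr \<epsilon> n \<and> 64 * 2 ^ n * M * m \<le> q1 powr \<gamma> n \<and>
    64 * 2 ^ n * real q0 \<le> q1 \<and> (\<forall>k\<le>n. \<forall>x. \<forall>t\<in>{\<tau>, -\<tau>}. \<bar>(deriv ^^ k) (stage_shift q1 (q1 powr \<gamma> n) H G t) x\<bar> \<le> (1/2) ^ n))"
  define P where "P = (\<lambda>(n::nat) (H, G, q0::nat). conj_pair H G \<and> (n = 0 \<longrightarrow> H = (\<lambda>x. x) \<and> G = (\<lambda>x. x)))"
  have "\<exists>f. \<forall>n. P n (f n) \<and> R n (f n) (f (Suc n))"
  proof (rule dependent_nat_choice)
    show "\<exists>s. P 0 s" unfolding P_def using conj_pair_id by auto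
    fix s n assume "P n s"
    obtain H G q0 where s: "s = (H, G, q0)" by (cases s) auto
    have HG: "conj_pair H G" using \<open>P n s\<close> by (simp add: P_def s)
    obtain M where M: "M \<ge> 1" "\<And>x. \<bar>deriv G x\<bar> \<le> M" using bdd_smooth_bounded[of "deriv G"] HG by (auto simp: conj_pair_def)
    obtain m where m: "m \<ge> 1" "\<And>x. \<bar>deriv H x\<bar> \<le> m" using bdd_smooth_bounded[of "deriv H"] HG by (auto simp: conj_pair_def)
    define B where "B = max (64 * 2 ^ n * M * m) (64 * 2 ^ n * real q0)"
    obtain j where j: "B \<le> real (Suc j)" "B \<le> real (Suc j) powr \<epsilon> n" "B \<le> real (Suc j) powr \<gamma> n"
      "\<forall>k\<le>n. \<forall>x. \<forall>t\<in>{\<tau>, -\<tau>}. \<bar>(deriv ^^ k) (stage_shift (Suc j) (Suc j powr \<gamma> n) H G t) x\<bar> \<le> (1/2) ^ n"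
      using next_stage_exists[OF assms(1) HG assms(2)[of n] assms(3)[of n]] by blast
    define s' where "s' = (next_H (Suc j) (Suc j powr \<gamma> n) H, next_G (Suc j) (Suc j powr \<gamma> n) G, Suc j)"
    have "P (Suc n) s'"
      using conj_pair_next_stage[OF HG less_imp_le[OF assms(2)[of n]], of j]
      unfolding P_def s'_def by simp
    moreover have "R n s s'"
      unfolding R_def s s'_def prod.case
      by (intro exI[of _ M] exI[of _ m] conjI)
         (use M m j in \<open>auto simp: B_def simp del: of_nat_Suc intro: order_trans[OF abs_ge_self]\<close>)
    ultimately show "\<exists>s'. P (Suc n) s' \<and> R n s s'" by blast
  qed
  then obtain f where f: "\<And>n. P n (f n)" "\<And>n. R n (f n) (f (Suc n))" by blast
  define H where "H = (\<lambda>n. fst (f n))"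
  define G where "G = (\<lambda>n. fst (snd (f n)))"
  \<comment> \<open>Shifted by one: \<open>q n\<close> leads from stage n to stage n + 1 and is
    stored in the later state.\<close>
  define q where "q = (\<lambda>n. snd (snd (f (Suc n))))"
  have fs: "f n = (H n, G n, snd (snd (f n)))" for n by (simp add: H_def G_def)
  have "\<exists>M m :: real. M \<ge> 1 \<and> m \<ge> 1 \<and>
    (\<forall>x. deriv (G n) x \<le> M) \<and> (\<forall>x. deriv (H n) x \<le> m) \<and> q n \<ge> 1 \<and>
    H (Suc n) = next_H (q n) (q n powr \<gamma> n) (H n) \<and> G (Suc n) = next_G (q n) (q n powr \<gamma> n) (G n) \<and>
    64 * 2 ^ n * M * m \<le> q n \<and> 64 * 2 ^ n * M * m \<le> q n powr \<epsilon> n \<and> 64 * 2 ^ n * M * m \<le> q n powr \<gamma> n \<and>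
    64 * 2 ^ n * real (snd (snd (f n))) \<le> q n \<and> (\<forall>k\<le>n. \<forall>x. \<forall>t\<in>{\<tau>, -\<tau>}. \<bar>(deriv ^^ k) (stage_shift (q n) (q n powr \<gamma> n) (H n) (G n) t) x\<bar> \<le> (1/2) ^ n)" for n
    using f(2)[of n] unfolding R_def by (simp add: H_def G_def q_def split: prod.splits)
  then obtain M m :: "nat \<Rightarrow> real" where *: "\<And>n. M n \<ge> 1 \<and> m n \<ge> 1 \<and>
    (\<forall>x. deriv (G n) x \<le> M n) \<and> (\<forall>x. deriv (H n) x \<le> m n) \<and> q n \<ge> 1 \<and>
    H (Suc n) = next_H (q n) (q n powr \<gamma> n) (H n) \<and> G (Suc n) = next_G (q n) (q n powr \<gamma> n) (G n) \<and>
    64 * 2 ^ n * M n * m n \<le> q n \<and> 64 * 2 ^ n * M n * m n \<le> q n powr \<epsilon> n \<and> 64 * 2 ^ n * M n * m n \<le> q n powr \<gamma> n \<and>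
    64 * 2 ^ n * real (snd (snd (f n))) \<le> q n \<and> (\<forall>k\<le>n. \<forall>x. \<forall>t\<in>{\<tau>, -\<tau>}. \<bar>(deriv ^^ k) (stage_shift (q n) (q n powr \<gamma> n) (H n) (G n) t) x\<bar> \<le> (1/2) ^ n)" by metis
  have c: "conj_pair (H n) (G n)" for n using f(1)[of n] fs[of n] unfolding P_def by (metis (no_types, lifting) case_prod_conv)
  have z: "H 0 = (\<lambda>x. x)" "G 0 = (\<lambda>x. x)" using f(1)[of 0] unfolding P_def H_def G_def by auto
  have d: "2 ^ n * 64 * real (q n) \<le> q (Suc n)" for n
  proof -
    have "64 * 2 ^ n * real (q n) \<le> 64 * 2 ^ Suc n * real (q n)" by (simp add: mult_right_mono)
    also have "\<dots> \<le> q (Suc n)" using *[of "Suc n"] unfolding q_def by blast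
    finally show ?thesis by (simp add: mult_ac)
  qed
  have "stages \<tau> \<gamma> \<epsilon> H G q M m"
    by unfold_locales (use * c z d assms in \<open>auto simp: mult_ac\<close>)
  then show ?thesis by blast
qed

section \<open>The limit diffeomorphism\<close>

lemma fast_limit:
  fixes X :: "nat \<Rightarrow> real \<Rightarrow> real" and e :: "nat \<Rightarrow> real"
  assumes step: "\<And>n x. \<bar>X (Suc n) x - X n x\<bar> \<le> e n" and half: "\<And>n. e (Suc n) \<le> e n / 2" and pos: "\<And>n. e n \<ge> 0"
  obtains Y where "\<And>n x. \<bar>Y x - X n x\<bar> \<le> 2 * e n" "\<And>x. (\<lambda>n. X n x) \<longlonglongrightarrow> Y x" "e \<longlonglongrightarrow> 0"
proof -
  \<comment> \<open>Halving gives e(k) \<le> 2 e(k) - 2 e(k+1), so the single steps telescope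
    against this bound.\<close>
  have diff: "\<bar>X (n + k) x - X n x\<bar> \<le> 2 * e n - 2 * e (n + k)" for n k x
  proof (induction k)
    case (Suc k)
    then show ?case using step[of "n + k" x] half[of "n + k"] by simp
  qed simp
  have ebound: "e n \<le> e 0 * (1/2) ^ n" for n
  proof (induction n)
    case (Suc n)
    then show ?case using half[of n] by simp
  qed simp
  have e0: "e \<longlonglongrightarrow> 0"
  proof (rule tendsto_sandwich[OF _ _ tendsto_const])
    have "(\<lambda>n. e 0 * (1/2::real) ^ n) \<longlonglongrightarrow> e 0 * 0" by (intro tendsto_intros LIMSEQ_power_zero) simp
    then show "(\<lambda>n. e 0 * (1/2::real) ^ n) \<longlonglongrightarrow> 0" by simp
  qed (use pos ebound in \<open>auto intro: always_eventually\<close>)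
  have "Cauchy (\<lambda>n. X n x)" for x
  proof (rule metric_CauchyI)
    fix \<delta> :: real assume "\<delta> > 0"
    then have "\<forall>\<^sub>F n in sequentially. e n < \<delta> / 4" by (intro order_tendstoD(2)[OF e0]) auto
    then obtain N where N: "e N < \<delta> / 4" unfolding eventually_sequentially by blast
    have "\<bar>X n x - X N x\<bar> < \<delta> / 2" if "n \<ge> N" for n
      using diff[of N "n - N" x] that N pos[of n] by auto
    then have "dist (X a x) (X b x) < \<delta>" if "a \<ge> N" "b \<ge> N" for a b
      using that by (smt (verit) dist_real_def field_sum_of_halves)
    then show "\<exists>M. \<forall>m\<ge>M. \<forall>n\<ge>M. dist (X m x) (X n x) < \<delta>" by blast
  qed
  then have "\<forall>x. \<exists>y. (\<lambda>n. X n x) \<longlonglongrightarrow> y" by (simp add: Cauchy_convergent_iff convergent_def)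
  then have "\<exists>Y. \<forall>x. (\<lambda>n. X n x) \<longlonglongrightarrow> Y x" by (rule choice)
  then obtain Y where Y: "\<And>x. (\<lambda>n. X n x) \<longlonglongrightarrow> Y x" by blast
  have "\<bar>Y x - X n x\<bar> \<le> 2 * e n" for n x
  proof (rule tendsto_upperbound)
    show "(\<lambda>k. \<bar>X (k + n) x - X n x\<bar>) \<longlonglongrightarrow> \<bar>Y x - X n x\<bar>"
      using LIMSEQ_ignore_initial_segment[OF Y, of n x] by (intro tendsto_intros)
    show "\<forall>\<^sub>F k in sequentially. \<bar>X (k + n) x - X n x\<bar> \<le> 2 * e n"
      using diff[of n _ x] pos by (intro always_eventually allI) (smt (verit) add.commute)
  qed simp
  then show ?thesis using Y e0 that by blast
qed

lemma uniform_limit_isCont: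
  fixes X :: "nat \<Rightarrow> real \<Rightarrow> real"
  assumes "\<And>n x. isCont (X n) x" "\<And>n x. \<bar>Y x - X n x\<bar> \<le> e n" "e \<longlonglongrightarrow> 0"
  shows "isCont Y x"
proof -
  have u: "uniform_limit UNIV X Y sequentially"
  proof (rule uniform_limitI)
    fix \<delta> :: real assume "\<delta> > 0"
    then have "\<forall>\<^sub>F n in sequentially. e n < \<delta>" by (intro order_tendstoD(2)[OF assms(3)])
    then show "\<forall>\<^sub>F n in sequentially. \<forall>x\<in>UNIV. dist (X n x) (Y x) < \<delta>"
      by eventually_elim (use assms(2) in \<open>auto simp: dist_real_def abs_minus_commute intro: le_less_trans\<close>)
  qed
  have "continuous_on UNIV Y"
    using assms(1) by (intro uniform_limit_theorem[OF _ u]) (auto intro!: always_eventually continuous_at_imp_continuous_on)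
  then show ?thesis by (simp add: continuous_on_eq_continuous_at)
qed

lemma bdd_smooth_iter_deriv:
  assumes "bdd_smooth u"
  shows "((deriv ^^ j) u has_real_derivative (deriv ^^ Suc j) u x) (at x)"
  using weight.moderate_iter_deriv[OF weight_one, of "\<lambda>_::unit. u" j "()" x] assms
  unfolding bdd_smooth_def by blast

text \<open>The derivative of order k is controlled only from the k-th term on. Since finitely many
  terms do not affect uniform convergence, the M-test applies at each order and the series may be
  differentiated termwise arbitrarily often.\<close>

lemma smooth_series:
  fixes d :: "nat \<Rightarrow> real \<Rightarrow> real"
  assumes d: "\<And>n. bdd_smooth (d n)" and b: "\<And>n k x. k \<le> n \<Longrightarrow> \<bar>(deriv ^^ k) (d n) x\<bar> \<le> (1/2) ^ n"
    and F: "\<And>x. (\<lambda>n. d n x) sums (F x - (x + t))"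
  shows "\<exists>D. smooth_real F D"
proof -
  define S where "S = (\<lambda>k x. \<Sum>n. (deriv ^^ k) (d n) x)"
  have geo: "summable (\<lambda>n. (1/2::real) ^ n)" by (simp add: summable_geometric)
  have summ: "summable (\<lambda>n. (deriv ^^ k) (d n) x)" for k x
    by (rule summable_comparison_test_ev[OF _ geo])
       (use b in \<open>auto simp: eventually_sequentially intro!: exI[of _ k]\<close>)
  have unif: "uniformly_convergent_on UNIV (\<lambda>n x. \<Sum>i<n. (deriv ^^ k) (d i) x)" for k
    unfolding uniformly_convergent_on_def
    by (rule exI, rule Weierstrass_m_test_ev[OF _ geo])
       (use b in \<open>auto simp: eventually_sequentially intro!: exI[of _ k]\<close>)
  have dS: "(S k has_real_derivative S (Suc k) x) (at x)" for k x
    unfolding S_def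
    by (rule has_field_derivative_series'(2)[of UNIV _ _ 0])
       (use bdd_smooth_iter_deriv[OF d] unif[of "Suc k"] summ in auto)
  define D where "D = (\<lambda>k x. S k x + (if k = 0 then x + t else if k = 1 then 1 else 0))"
  have "F x = D 0 x" for x using sums_unique[OF F[of x]] by (simp add: D_def S_def)
  moreover have "(D k has_real_derivative D (Suc k) x) (at x)" for k x
  proof -
    have "((\<lambda>x. if k = 0 then x + t else if k = 1 then 1 else 0) has_real_derivative
       (if Suc k = 0 then x + t else if Suc k = 1 then 1 else 0)) (at x)"
      by (cases "k = 0"; cases "k = 1") (auto intro!: derivative_eq_intros)
    then show ?thesis unfolding D_def using dS by (intro DERIV_add)
  qed
  ultimately show ?thesis unfolding smooth_real_def by (intro exI[of _ D]) auto
qed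

context stages
begin

definition L where "L n = real (q n) powr \<gamma> n"

lemma q_pos: "real (q n) > 0" using q_ge_1[of n] by simp

lemma L_ge_1: "L n \<ge> 1"
  unfolding L_def using q_ge_1[of n] gamma[of n] by (intro ge_one_powr_ge_zero) auto

lemma big_ge: "64 * 2 ^ n * M n * m n \<ge> 64 * 2 ^ n" "64 * 2 ^ n * M n * m n \<ge> 64 * 2 ^ n * m n"
  "64 * 2 ^ n * M n * m n \<ge> 64 * M n"
proof -
  have 1: "M n * m n \<ge> 1 * m n" "M n * m n \<ge> M n * 1" using M_ge_1[of n] m_ge_1[of n] by (auto intro!: mult_mono)
  have 2: "(64::real) * 2 ^ n \<ge> 64 * 1" by (intro mult_left_mono) auto
  have 3: "64 * 2 ^ n * (M n * m n) \<ge> 64 * 2 ^ n * c" if "M n * m n \<ge> c" for c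
    using that by (intro mult_left_mono) auto
  show "64 * 2 ^ n * M n * m n \<ge> 64 * 2 ^ n * m n" using 3[of "m n"] 1 by (simp add: mult_ac)
  have "64 * 2 ^ n * M n \<ge> 64 * 1 * M n" using 2 M_ge_1[of n] by (intro mult_right_mono) auto
  then show "64 * 2 ^ n * M n * m n \<ge> 64 * M n" using 3[OF 1(2)] by (simp only: mult.assoc mult_1_right mult_1_left)
  have "M n * m n \<ge> 1" using 1(1) m_ge_1[of n] by linarith
  from 3[OF this] show "64 * 2 ^ n * M n * m n \<ge> 64 * 2 ^ n" by (simp only: mult.assoc mult_1_right)
qed

lemma G_deriv: "(G n has_real_derivative deriv (G n) x) (at x)" "deriv (G n) x > 0"
  and H_deriv: "(H n has_real_derivative deriv (H n) x) (at x)" "deriv (H n) x > 0"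
  using HG[of n] unfolding conj_pair_def by blast+

lemma G_H: "G n (H n x) = x" and H_G: "H n (G n x) = x" and G_0: "G n 0 = 0"
  using HG[of n] unfolding conj_pair_def by blast+

lemma G_lipschitz: "\<bar>G n x - G n y\<bar> \<le> M n * \<bar>x - y\<bar>"
  using field_differentiable_bound[of UNIV "G n" "deriv (G n)" "M n" x y] G_deriv M
  by (auto simp: abs_of_pos)

lemma H_lipschitz: "\<bar>H n x - H n y\<bar> \<le> m n * \<bar>x - y\<bar>"
  using field_differentiable_bound[of UNIV "H n" "deriv (H n)" "m n" x y] H_deriv m
  by (auto simp: abs_of_pos)

lemma G_step: "\<bar>G (Suc n) x - G n x\<bar> \<le> 1 / q n"
proof -
  have "\<bar>bulge (L n) (q n * G n x) - q n * G n x\<bar> / q n \<le> 1 / q n"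
    using bulge_near[OF L_ge_1, of n "q n * G n x"] by (intro divide_right_mono) auto
  moreover have "bulge (L n) (q n * G n x) / q n - G n x = (bulge (L n) (q n * G n x) - q n * G n x) / q n"
    using q_pos[of n] by (simp add: diff_divide_distrib)
  ultimately show ?thesis by (simp add: G_Suc next_G_def L_def)
qed

text \<open>The rescaled inverse bulge moves points by at most 1/q. The Lipschitz constant of
  \<open>H n\<close> turns this into m/q, at most 2^-n by the choice of q.\<close>

lemma H_step: "\<bar>H (Suc n) x - H n x\<bar> \<le> (1/2) ^ n"
proof -
  let ?y = "unbulge (L n) (q n * x) / q n"
  have "\<bar>unbulge (L n) (q n * x) - q n * x\<bar> / q n \<le> 1 / q n"
    using unbulge_near[OF L_ge_1, of n "q n * x"] by (intro divide_right_mono) auto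
  moreover have "?y - x = (unbulge (L n) (q n * x) - q n * x) / q n"
    using q_pos[of n] by (simp add: diff_divide_distrib)
  ultimately have "\<bar>?y - x\<bar> \<le> 1 / q n" by simp
  then have "m n * \<bar>?y - x\<bar> \<le> m n * (1 / q n)" using m_ge_1[of n] by (intro mult_left_mono) auto
  also have "\<dots> \<le> (1/2) ^ n"
  proof -
    have "2 ^ n * m n \<le> 64 * 2 ^ n * m n" using m_ge_1[of n] by simp
    then have "2 ^ n * m n \<le> q n" using q_large(1)[of n] big_ge(2)[of n] by linarith
    then show ?thesis using q_pos[of n] by (simp add: field_simps power_one_over)
  qed
  finally show ?thesis using H_lipschitz[of n ?y x] by (simp add: H_Suc next_H_def L_def)
qed

definition "lim_G = (SOME Y. (\<forall>n x. \<bar>Y x - G n x\<bar> \<le> 2 * (1 / real (q n))) \<and> (\<forall>x. (\<lambda>n. G n x) \<longlonglongrightarrow> Y x))"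
definition "lim_H = (SOME Y. (\<forall>n x. \<bar>Y x - H n x\<bar> \<le> 2 * (1/2) ^ n) \<and> (\<forall>x. (\<lambda>n. H n x) \<longlonglongrightarrow> Y x))"

lemma q_inverse_half: "1 / real (q (Suc n)) \<le> 1 / real (q n) / 2"
proof -
  have "1 \<le> (2::real) ^ n" by simp
  then have "2 \<le> 64 * (2::real) ^ n" by linarith
  then have "2 * real (q n) \<le> 64 * 2 ^ n * real (q n)" by (intro mult_right_mono) auto
  then have "2 * real (q n) \<le> q (Suc n)" using q_Suc[of n] by linarith
  then show ?thesis using q_pos[of n] q_pos[of "Suc n"] by (simp add: field_simps)
qed

lemma lim_G: "\<bar>lim_G x - G n x\<bar> \<le> 2 / q n" "(\<lambda>n. G n x) \<longlonglongrightarrow> lim_G x"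
  and q_lim: "(\<lambda>n. 1 / real (q n)) \<longlonglongrightarrow> 0"
proof -
  obtain Y where Y: "\<And>n x. \<bar>Y x - G n x\<bar> \<le> 2 * (1 / real (q n))" "\<And>x. (\<lambda>n. G n x) \<longlonglongrightarrow> Y x"
    and q: "(\<lambda>n. 1 / real (q n)) \<longlonglongrightarrow> 0"
    using fast_limit[of G "\<lambda>n. 1 / real (q n)", OF G_step q_inverse_half] by auto
  show "(\<lambda>n. 1 / real (q n)) \<longlonglongrightarrow> 0" by fact
  have "(\<forall>n x. \<bar>lim_G x - G n x\<bar> \<le> 2 * (1 / real (q n))) \<and> (\<forall>x. (\<lambda>n. G n x) \<longlonglongrightarrow> lim_G x)"
    unfolding lim_G_def by (rule someI[of _ Y]) (use Y in auto)
  then show "\<bar>lim_G x - G n x\<bar> \<le> 2 / q n" "(\<lambda>n. G n x) \<longlonglongrightarrow> lim_G x" by auto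
qed

lemma lim_H: "\<bar>lim_H x - H n x\<bar> \<le> 2 * (1/2) ^ n" "(\<lambda>n. H n x) \<longlonglongrightarrow> lim_H x"
proof -
  obtain Y where Y: "\<And>n x. \<bar>Y x - H n x\<bar> \<le> 2 * (1/2) ^ n" "\<And>x. (\<lambda>n. H n x) \<longlonglongrightarrow> Y x"
  proof (rule fast_limit[of H "\<lambda>n. (1/2) ^ n", OF H_step])
    show "(1/2::real) ^ Suc n \<le> (1/2) ^ n / 2" "(0::real) \<le> (1/2) ^ n" for n by simp_all
  qed blast
  have "(\<forall>n x. \<bar>lim_H x - H n x\<bar> \<le> 2 * (1/2) ^ n) \<and> (\<forall>x. (\<lambda>n. H n x) \<longlonglongrightarrow> lim_H x)"
    unfolding lim_H_def by (rule someI[of _ Y]) (use Y in auto)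
  then show "\<bar>lim_H x - H n x\<bar> \<le> 2 * (1/2) ^ n" "(\<lambda>n. H n x) \<longlonglongrightarrow> lim_H x" by auto
qed

lemma lim_G_isCont: "isCont lim_G x"
proof (rule uniform_limit_isCont[of G])
  show "(\<lambda>n. 2 / real (q n)) \<longlonglongrightarrow> 0" using tendsto_mult[OF tendsto_const[of 2] q_lim] by simp
qed (use G_deriv lim_G DERIV_isCont in blast)+

lemma lim_H_isCont: "isCont lim_H x"
proof (rule uniform_limit_isCont[of H])
  show "(\<lambda>n. 2 * (1/2::real) ^ n) \<longlonglongrightarrow> 0" using tendsto_mult[OF tendsto_const[of 2] LIMSEQ_power_zero[of "1/2::real"]] by simp
qed (use H_deriv lim_H DERIV_isCont in blast)+

text \<open>Uniform convergence to a continuous limit lets map and argument vary together. With y n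
  = \<open>G n x\<close> this passes \<open>H n (G n x) = x\<close> to the limit, and with y n =
  \<open>G n x + t\<close> the conjugated rotations.\<close>

lemma lim_H_diagonal: "y \<longlonglongrightarrow> z \<Longrightarrow> (\<lambda>n. H n (y n)) \<longlonglongrightarrow> lim_H z"
proof -
  assume y: "y \<longlonglongrightarrow> z"
  have 1: "(\<lambda>n. lim_H (y n)) \<longlonglongrightarrow> lim_H z" using isCont_tendsto_compose[OF lim_H_isCont y] .
  have "(\<lambda>n. 2 * (1/2::real) ^ n) \<longlonglongrightarrow> 0" using tendsto_mult[OF tendsto_const[of 2] LIMSEQ_power_zero[of "1/2::real"]] by simp
  then have 2: "(\<lambda>n. H n (y n) - lim_H (y n)) \<longlonglongrightarrow> 0"
    by (rule Lim_null_comparison[rotated]) (use lim_H(1) in \<open>auto simp: abs_minus_commute intro!: always_eventually\<close>)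
  show ?thesis using tendsto_add[OF 2 1] by simp
qed

lemma lim_G_diagonal: "y \<longlonglongrightarrow> z \<Longrightarrow> (\<lambda>n. G n (y n)) \<longlonglongrightarrow> lim_G z"
proof -
  assume y: "y \<longlonglongrightarrow> z"
  have 1: "(\<lambda>n. lim_G (y n)) \<longlonglongrightarrow> lim_G z" using isCont_tendsto_compose[OF lim_G_isCont y] .
  have "(\<lambda>n. 2 / real (q n)) \<longlonglongrightarrow> 0" using tendsto_mult[OF tendsto_const[of 2] q_lim] by simp
  then have 2: "(\<lambda>n. G n (y n) - lim_G (y n)) \<longlonglongrightarrow> 0"
    by (rule Lim_null_comparison[rotated]) (use lim_G(1) in \<open>auto simp: abs_minus_commute intro!: always_eventually\<close>)
  show ?thesis using tendsto_add[OF 2 1] by simp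
qed

lemma lim_G_lim_H [simp]: "lim_G (lim_H x) = x"
  using lim_G_diagonal[OF lim_H(2), of x] unfolding G_H LIMSEQ_const_iff by simp

lemma lim_H_lim_G [simp]: "lim_H (lim_G x) = x"
  using lim_H_diagonal[OF lim_G(2), of x] unfolding H_G LIMSEQ_const_iff by simp

lemma lim_G_plus_1: "lim_G (x + 1) = lim_G x + 1"
proof (rule LIMSEQ_unique[OF lim_G(2)])
  show "(\<lambda>n. G n (x + 1)) \<longlonglongrightarrow> lim_G x + 1"
    unfolding conj_pair_G_plus_1[OF HG] by (intro tendsto_add lim_G(2) tendsto_const)
qed

lemma lim_H_plus_1: "lim_H (x + 1) = lim_H x + 1"
  by (metis lim_G_plus_1 lim_G_lim_H lim_H_lim_G)

lemma lim_G_0 [simp]: "lim_G 0 = 0"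
  using lim_G(2)[of 0] unfolding G_0 LIMSEQ_const_iff by simp

lemma G_strict_mono: "x < y \<Longrightarrow> G n x < G n y"
  by (rule DERIV_pos_imp_increasing) (use G_deriv in blast)+

lemma lim_G_strict_mono: "strict_mono lim_G"
proof (rule strict_monoI)
  fix x y :: real assume "x < y"
  then have "G n x \<le> G n y" for n by (intro less_imp_le G_strict_mono)
  then have "lim_G x \<le> lim_G y" by (intro LIMSEQ_le[OF lim_G(2) lim_G(2)]) blast
  moreover have "lim_G x \<noteq> lim_G y" using \<open>x < y\<close> by (metis lim_H_lim_G less_irrefl)
  ultimately show "lim_G x < lim_G y" by simp
qed

lemma lim_H_strict_mono: "strict_mono lim_H"
  by (rule strict_monoI) (metis lim_G_lim_H lim_G_strict_mono strict_mono_less)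

section \<open>Conjugated rotations: smoothness and rotation number\<close>

definition shift where "shift t x = lim_H (lim_G x + t)"

text \<open>Stage 0 is the identity, so the stage shifts below n sum to
  \<open>H n (G n x + t) - (x + t)\<close>. Their series therefore represents \<open>shift t\<close>
  minus the translation by t.\<close>

lemma shift_smooth:
  assumes t: "t \<in> {\<tau>, -\<tau>}" shows "\<exists>D. smooth_real (shift t) D"
proof (rule smooth_series[of "\<lambda>n. stage_shift (q n) (q n powr \<gamma> n) (H n) (G n) t"])
  fix n
  obtain j where j: "q n = Suc j" using q_ge_1[of n] by (cases "q n") auto
  show "bdd_smooth (stage_shift (q n) (q n powr \<gamma> n) (H n) (G n) t)"
    unfolding j by (rule bdd_smooth_stage_shift[OF HG less_imp_le[OF gamma]])
next
  fix x
  have s: "(\<Sum>i<n. stage_shift (q i) (q i powr \<gamma> i) (H i) (G i) t x) = H n (G n x + t) - (x + t)" for n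
    by (induction n) (auto simp: H0 G0 stage_shift_def H_Suc G_Suc)
  show "(\<lambda>n. stage_shift (q n) (q n powr \<gamma> n) (H n) (G n) t x) sums (shift t x - (x + t))"
    unfolding sums_def s shift_def
    by (intro tendsto_diff tendsto_const lim_H_diagonal tendsto_add lim_G(2))
qed (use close t in auto)

lemma shift_shift [simp]: "shift s (shift t x) = shift (t + s) x"
  by (simp add: shift_def add.assoc)

lemma shift_0 [simp]: "shift 0 x = x" by (simp add: shift_def)

lemma shift_plus_1: "shift t (x + 1) = shift t x + 1"
  using lim_H_plus_1[of "lim_G x + t"] unfolding shift_def lim_G_plus_1 by (simp add: add_ac)

lemma shift_strict_mono: "strict_mono (shift t)"
  using lim_G_strict_mono lim_H_strict_mono by (simp add: strict_mono_def shift_def)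

text \<open>The shifts by \<tau> and -\<tau> are smooth and inverse to each other. By the chain rule
  their derivatives multiply to 1, so the nonnegative derivative of the increasing map cannot
  vanish.\<close>

lemma shift_diffeo: "circle_diffeo_lift (shift \<tau>)"
proof -
  obtain D D' where D: "smooth_real (shift \<tau>) D" and D': "smooth_real (shift (-\<tau>)) D'"
    using shift_smooth by blast
  have d: "(shift \<tau> has_real_derivative D 1 x) (at x)" for x
    using D unfolding smooth_real_def by (metis One_nat_def)
  have d': "(shift (-\<tau>) has_real_derivative D' 1 x) (at x)" for x
    using D' unfolding smooth_real_def by (metis One_nat_def)
  have "D 1 x > 0" for x
  proof -
    have "((\<lambda>x. shift (-\<tau>) (shift \<tau> x)) has_real_derivative D' 1 (shift \<tau> x) * D 1 x) (at x)"
      by (rule DERIV_chain2[OF d' d])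
    then have "((\<lambda>x. x) has_real_derivative D' 1 (shift \<tau> x) * D 1 x) (at x)" by simp
    then have "D' 1 (shift \<tau> x) * D 1 x = 1" using DERIV_unique[OF _ DERIV_ident] by blast
    then have "D 1 x \<noteq> 0" by auto
    moreover have "D 1 x \<ge> 0"
      using mono_on_imp_deriv_nonneg[of UNIV "shift \<tau>" "D 1 x" x] d strict_mono_mono[OF shift_strict_mono]
      by (simp add: mono_on_def mono_def)
    ultimately show ?thesis by simp
  qed
  then show ?thesis unfolding circle_diffeo_lift_def using D shift_plus_1 by blast
qed

lemma lim_H_near: "\<bar>lim_H y - y\<bar> \<le> 2"
  using lim_H(1)[of y 0] by (simp add: H0)

lemma shift_iterate: "(shift t ^^ n) x = shift (n * t) x"
  by (induction n) (auto simp: algebra_simps)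

lemma inv_shift: "inv (shift t) = shift (- t)"
  by (rule inv_equality) auto

text \<open>\<open>lim_H\<close> differs from the identity by at most 2, so the displacement under
  the conjugated translation by n t is n t up to an error bounded independently of n.\<close>

lemma shift_displacement_lim: "(\<lambda>n. (shift (real n * t) x - x) / real n) \<longlonglongrightarrow> t"
proof -
  define c where "c = lim_G x - x"
  have b: "\<bar>(shift (real n * t) x - x) - (real n * t + c)\<bar> \<le> 2" for n
    using lim_H_near[of "lim_G x + real n * t"] by (simp add: shift_def c_def algebra_simps)
  have n0: "(\<lambda>n. a / real n) \<longlonglongrightarrow> 0" for a :: real by (rule lim_const_over_n)
  have 1: "(\<lambda>n. ((shift (real n * t) x - x) - (real n * t + c)) / real n) \<longlonglongrightarrow> 0"
    by (rule Lim_null_comparison[OF _ n0[of 2]])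
       (use b in \<open>auto intro!: always_eventually divide_right_mono simp: abs_divide\<close>)
  have 2: "(\<lambda>n. (real n * t + c) / real n) \<longlonglongrightarrow> t"
  proof (rule Lim_transform_eventually)
    show "(\<lambda>n. t + c / real n) \<longlonglongrightarrow> t" using tendsto_add[OF tendsto_const[of t] n0[of c]] by simp
    show "\<forall>\<^sub>F n in sequentially. t + c / real n = (real n * t + c) / real n"
      using eventually_gt_at_top[of 0] by eventually_elim (simp add: field_simps)
  qed
  show ?thesis using tendsto_add[OF 1 2] by (simp add: add_divide_distrib[symmetric])
qed

lemma shift_rotation_number: "has_rotation_number (shift \<tau>) \<tau>"
proof -
  have "(\<lambda>n. ((inv (shift \<tau>) ^^ n) x - x) / (- real n)) \<longlonglongrightarrow> \<tau>" for x
    using tendsto_minus[OF shift_displacement_lim[of "-\<tau>" x]]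
    by (simp add: inv_shift shift_iterate)
  moreover have "(\<lambda>n. ((shift \<tau> ^^ n) x - x) / real n) \<longlonglongrightarrow> \<tau>" for x
    using shift_displacement_lim[of \<tau> x] by (simp add: shift_iterate)
  ultimately show ?thesis unfolding has_rotation_number_def by blast
qed

end

section \<open>Local dimension on the circle\<close>

lemma cdist_le: "cdist x y \<le> \<bar>x - y - of_int m\<bar>"
  unfolding cdist_def using round_diff_minimal[of "x - y" m] by (simp add: abs_minus_commute)

lemma cdist_witness: "\<exists>m. cdist x y = \<bar>x - y - of_int m\<bar>"
  unfolding cdist_def by blast

lemma cdist_nonneg [simp]: "cdist x y \<ge> 0" by (simp add: cdist_def)

lemma cdist_commute: "cdist x y = cdist y x"
proof -
  have "cdist x y \<le> cdist y x" for x y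
  proof -
    obtain m where "cdist y x = \<bar>y - x - of_int m\<bar>" using cdist_witness by blast
    then show ?thesis using cdist_le[of x y "- m"] by (simp add: abs_minus_commute algebra_simps)
  qed
  then show ?thesis by (meson antisym)
qed

lemma cdist_triangle: "cdist x z \<le> cdist x y + cdist y z"
proof -
  obtain m k where "cdist x y = \<bar>x - y - of_int m\<bar>" "cdist y z = \<bar>y - z - of_int k\<bar>"
    using cdist_witness by metis
  then show ?thesis using cdist_le[of x z "m + k"] by simp
qed

lemma cdist_self [simp]: "cdist x x = 0" by (simp add: cdist_def)

lemma cdist_le_half: "cdist x y \<le> 1 / 2"
  unfolding cdist_def using of_int_round_abs_le[of "x - y"] by (simp add: abs_minus_commute)

lemma cdist_measurable [measurable]: "cdist x \<in> borel_measurable borel"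
  unfolding cdist_def[abs_def] round_def by measurable

lemma circ_sets [measurable]: "circ \<in> sets borel" by (simp add: circ_def)

lemma cball_open_sets [measurable]: "cball_open x r \<in> sets borel"
  unfolding cball_open_def circ_def by measurable

lemma cball_closed_sets [measurable]: "cball_closed x r \<in> sets borel"
  unfolding cball_closed_def circ_def by measurable

lemma cdiam_le:
  assumes "\<And>x y. x \<in> U \<Longrightarrow> y \<in> U \<Longrightarrow> cdist x y \<le> d" "d \<ge> 0"
  shows "cdiam U \<le> d"
proof (cases "U = {}")
  case False
  have "Sup {cdist x y |x y. x \<in> U \<and> y \<in> U} \<le> d"
    using False assms(1) by (intro cSup_least) blast+
  then show ?thesis using False by (simp add: cdiam_def)
qed (simp add: cdiam_def assms)

lemma cdist_le_cdiam:
  assumes "x \<in> U" "y \<in> U" shows "cdist x y \<le> cdiam U"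
proof -
  have "bdd_above {cdist x y |x y. x \<in> U \<and> y \<in> U}"
    by (rule bdd_aboveI[of _ "1/2"]) (use cdist_le_half in blast)
  then have "cdist x y \<le> Sup {cdist x y |x y. x \<in> U \<and> y \<in> U}"
    using assms by (intro cSup_upper) auto
  then show ?thesis using assms(1) by (auto simp: cdiam_def)
qed

lemma cdiam_nonneg: "cdiam U \<ge> 0"
proof (cases "U = {}")
  case False
  then obtain x where "x \<in> U" by blast
  then show ?thesis using cdist_le_cdiam[of x U x] by simp
qed (simp add: cdiam_def)

lemma cdiam_cball_closed: "r \<ge> 0 \<Longrightarrow> cdiam (cball_closed c r) \<le> 2 * r"
proof (rule cdiam_le)
  fix x y assume "x \<in> cball_closed c r" "y \<in> cball_closed c r"
  then show "cdist x y \<le> 2 * r"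
    using cdist_triangle[of x y c] by (auto simp: cball_closed_def cdist_commute)
qed auto

lemma cball_closed_subset_open: "r < s \<Longrightarrow> cball_closed x r \<subseteq> cball_open x s"
  by (auto simp: cball_closed_def cball_open_def)

lemma cball_open_mono: "r \<le> s \<Longrightarrow> cball_open x r \<subseteq> cball_open x s"
  by (auto simp: cball_open_def)

lemma Liminf_le_along:
  fixes X :: "'a \<Rightarrow> ereal"
  assumes "filterlim g F G" "eventually (\<lambda>n. X (g n) \<le> C) G" "G \<noteq> bot"
  shows "Liminf F X \<le> C"
proof (rule ccontr)
  assume "\<not> Liminf F X \<le> C"
  then have "eventually (\<lambda>x. C < X x) F" by (intro less_LiminfD) auto
  then have "eventually (\<lambda>n. C < X (g n)) G" by (rule eventually_compose_filterlim[OF _ assms(1)])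
  with assms(2) have "eventually (\<lambda>n. False) G" by eventually_elim auto
  then show False using assms(3) by simp
qed

lemma Limsup_ge_along:
  fixes X :: "'a \<Rightarrow> ereal"
  assumes "filterlim g F G" "eventually (\<lambda>n. C \<le> X (g n)) G" "G \<noteq> bot"
  shows "C \<le> Limsup F X"
proof (rule ccontr)
  assume "\<not> C \<le> Limsup F X"
  then have "eventually (\<lambda>x. X x < C) F" by (intro Limsup_lessD) auto
  then have "eventually (\<lambda>n. X (g n) < C) G" by (rule eventually_compose_filterlim[OF _ assms(1)])
  with assms(2) have "eventually (\<lambda>n. False) G" by eventually_elim auto
  then show False using assms(3) by simp
qed

lemma ereal_le_if_reals_below: "(\<And>s. s < b \<Longrightarrow> ereal s \<le> X) \<Longrightarrow> ereal b \<le> X"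
  by (metis ereal_dense2 ereal_less(2) less_ereal.simps(1) not_le)

lemma ereal_ge_if_reals_above: "(\<And>s. s > b \<Longrightarrow> X \<le> ereal s) \<Longrightarrow> X \<le> ereal b"
  by (metis ereal_dense2 less_ereal.simps(1) not_le)

lemma log_ratio_ge:
  assumes "0 < r" "r < 1" "0 \<le> m" "m \<le> r powr s"
  shows "ereal s \<le> log_ratio m r"
proof (cases "m = 0")
  case False
  then have "ln m \<le> s * ln r" using assms by (metis ln_le_cancel_iff ln_powr order_le_less powr_gt_zero less_le)
  then show ?thesis using assms False by (simp add: log_ratio_def neg_le_divide_eq)
qed (simp add: log_ratio_def)

lemma log_ratio_le:
  assumes "0 < r" "r < 1" "m \<ge> r powr s"
  shows "log_ratio m r \<le> ereal s"
proof -
  have m: "m > 0" using assms by (smt (verit) powr_gt_zero)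
  then have "ln m \<ge> s * ln r" using assms by (metis ln_le_cancel_iff ln_powr powr_gt_zero less_irrefl)
  then show ?thesis using assms m by (simp add: log_ratio_def neg_divide_le_eq)
qed

lemma eventually_unit_interval: "\<forall>\<^sub>F r in at_right (0::real). 0 < r \<and> r < 1"
  using eventually_at_right_real[of 0 1] by (auto elim: eventually_mono)

section \<open>Covering numbers\<close>

lemma cover_number_le:
  assumes "finite C" "C \<subseteq> circ" "Z \<subseteq> (\<Union>c\<in>C. cball_closed c (\<epsilon> / 2))"
  shows "cover_number Z \<epsilon> \<le> card C"
  unfolding cover_number_def by (rule Least_le) (use assms in blast)

text \<open>A grid with spacing 1/N, where N is 2/\<epsilon> rounded up, so that the spacing is at
  most the radius \<epsilon>/2. The existence of a finite cover also gives meaning to the LEAST in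
  \<open>cover_number\<close>.\<close>

lemma circ_cover:
  assumes "0 < \<epsilon>" "\<epsilon> < 1"
  shows "\<exists>C. finite C \<and> C \<subseteq> circ \<and> circ \<subseteq> (\<Union>c\<in>C. cball_closed c (\<epsilon> / 2)) \<and> real (card C) \<le> 4 / \<epsilon>"
proof -
  define N where "N = nat \<lceil>2 / \<epsilon>\<rceil>"
  have N: "real N \<ge> 2 / \<epsilon>" "real N \<le> 2 / \<epsilon> + 1" using assms by (auto simp: N_def)
  have "2 / \<epsilon> \<ge> 2" using assms by (simp add: field_simps)
  then have N0: "N > 0" using N by (intro Nat.gr0I) auto
  let ?C = "(\<lambda>i. real i / N) ` {..<N}"
  have "circ \<subseteq> (\<Union>c\<in>?C. cball_closed c (\<epsilon> / 2))"
  proof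
    fix x assume x: "x \<in> circ"
    define i where "i = nat \<lfloor>x * N\<rfloor>"
    have x': "0 \<le> x" "x < 1" using x by (auto simp: circ_def)
    have i: "real i \<le> x * N" "x * N < real i + 1" using x' by (auto simp: i_def)
    have "x * N < N" using x' N0 by simp
    then have "i < N" using i by linarith
    moreover have "cdist (real i / N) x \<le> \<epsilon> / 2"
    proof -
      have "cdist (real i / N) x \<le> \<bar>real i / N - x\<bar>" using cdist_le[of _ _ 0] by simp
      also have "\<bar>real i / N - x\<bar> \<le> 1 / N"
      proof -
        have "\<bar>real i / N - x\<bar> * N = \<bar>(real i / N - x) * N\<bar>" by (simp add: abs_mult)
        also have "(real i / N - x) * N = real i - x * N" using N0 by (simp add: left_diff_distrib)
        finally show ?thesis using i N0 by (simp add: pos_le_divide_eq)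
      qed
      also have "\<dots> \<le> \<epsilon> / 2" using N(1) N0 assms by (simp add: field_simps)
      finally show ?thesis .
    qed
    ultimately show "x \<in> (\<Union>c\<in>?C. cball_closed c (\<epsilon> / 2))" using x by (auto simp: cball_closed_def)
  qed
  moreover have "?C \<subseteq> circ" using N0 by (auto simp: circ_def)
  moreover have "card ?C \<le> N" using card_image_le[of "{..<N}"] by simp
  then have "real (card ?C) \<le> 4 / \<epsilon>" using N(2) \<open>2 / \<epsilon> \<ge> 2\<close> by (simp add: field_simps)
  ultimately show ?thesis by blast
qed

lemma cover_number_cover:
  assumes "0 < \<epsilon>" "\<epsilon> < 1" "Z \<subseteq> circ"
  obtains C where "finite C" "card C = cover_number Z \<epsilon>" "C \<subseteq> circ" "Z \<subseteq> (\<Union>c\<in>C. cball_closed c (\<epsilon> / 2))"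
proof -
  obtain C where "finite C" "C \<subseteq> circ" "circ \<subseteq> (\<Union>c\<in>C. cball_closed c (\<epsilon> / 2))"
    using circ_cover[OF assms(1,2)] by blast
  then have "\<exists>n C. finite C \<and> card C = n \<and> C \<subseteq> circ \<and> Z \<subseteq> (\<Union>c\<in>C. cball_closed c (\<epsilon> / 2))"
    using assms(3) by blast
  from LeastI_ex[OF this] show ?thesis unfolding cover_number_def[symmetric] using that by blast
qed

lemma upper_box_dim_le_1:
  assumes "Z \<subseteq> circ" shows "upper_box_dim Z \<le> 1"
proof -
  have "upper_box_dim Z \<le> ereal s" if s: "s > 1" for s
    unfolding upper_box_dim_def
  proof (rule Limsup_bounded)
    have "((\<lambda>e::real. ln (4 / e) / ln (1 / e)) \<longlongrightarrow> 1) (at_right 0)" by real_asymp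
    then have "\<forall>\<^sub>F e in at_right (0::real). ln (4 / e) / ln (1 / e) < s"
      using s by (rule order_tendstoD)
    then show "\<forall>\<^sub>F e in at_right 0. ereal (ln (real (cover_number Z e)) / ln (1 / e)) \<le> ereal s"
      using eventually_unit_interval
    proof eventually_elim
      case (elim e)
      obtain C where C: "finite C" "C \<subseteq> circ" "circ \<subseteq> (\<Union>c\<in>C. cball_closed c (e / 2))" "real (card C) \<le> 4 / e"
        using circ_cover[OF conjunct1[OF elim(2)] conjunct2[OF elim(2)]] by auto
      have "cover_number Z e \<le> card C" using C(3) assms by (intro cover_number_le[OF C(1,2)]) blast
      then have N: "real (cover_number Z e) \<le> 4 / e" using C(4) by linarith
      \<comment> \<open>The empty set has covering number 0, and \<open>ln 0 = 0\<close>; in that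
        case the bound needs ln(4/e) to be nonnegative.\<close>
      have "1 \<le> 4 / e" using elim by (simp add: pos_le_divide_eq)
      then have "ln (real (cover_number Z e)) \<le> ln (4 / e)"
        using N ln_ge_zero[of "4 / e"] ln_mono[of "real (cover_number Z e)" "4 / e"]
        by (cases "cover_number Z e = 0") auto
      moreover have "ln (1 / e) > 0" using elim by (simp add: ln_div)
      ultimately have "ln (real (cover_number Z e)) / ln (1 / e) \<le> ln (4 / e) / ln (1 / e)"
        by (intro divide_right_mono) auto
      then show ?case using elim by simp
    qed
  qed
  then show ?thesis using ereal_ge_if_reals_above[of 1] by (simp add: one_ereal_def)
qed

section \<open>Upper local dimension of an arbitrary probability measure\<close>

locale circle_measure =
  fixes \<mu> :: "real measure"
  assumes circ_prob: "circ_prob \<mu>"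
begin

sublocale prob_space \<mu> using circ_prob by (simp add: circ_prob_def)

lemma sets_mu [measurable_cong, simp]: "sets \<mu> = sets borel"
  using circ_prob by (simp add: circ_prob_def)

lemma space_mu [simp]: "space \<mu> = UNIV" using sets_eq_imp_space_eq[OF sets_mu] by simp

lemma AE_circ: "AE x in \<mu>. x \<in> circ"
  using circ_prob by (intro AE_I[of _ _ "UNIV - circ"]) (auto simp: circ_prob_def)

lemma measure_circ: "measure \<mu> circ = 1"
  using prob_eq_1[of circ] AE_circ by simp

text \<open>The dyadic intervals of length 2^-k with mass below 2^(-k(1+\<epsilon>)) number at most
  2^k, so their total mass is at most 2^(-k \<epsilon>). By Borel-Cantelli almost every point
  finally lies outside them, and its small balls contain dyadic intervals that are heavy
  enough.\<close>

lemma upper_local_dim_le_aux: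
  assumes "\<epsilon> > 0"
  shows "AE x in \<mu>. upper_local_dim \<mu> x \<le> ereal (1 + 2 * \<epsilon>)"
proof -
  define J where "J = (\<lambda>k i. {real i / 2 ^ k ..< (real i + 1) / 2 ^ k})"
  define bad where "bad = (\<lambda>k. {i. i < 2 ^ k \<and> measure \<mu> (J k i) < (1 / 2 ^ k) powr (1 + \<epsilon>)})"
  define U where "U = (\<lambda>k. \<Union>i\<in>bad k. J k i)"
  have fin: "finite (bad k)" and card: "card (bad k) \<le> 2 ^ k" for k
  proof -
    have s: "bad k \<subseteq> {..<2 ^ k}" by (auto simp: bad_def)
    then show "finite (bad k)" using finite_subset by blast
    show "card (bad k) \<le> 2 ^ k" using card_mono[OF _ s] by simp
  qed
  have Jm: "J k i \<in> sets \<mu>" for k i by (simp add: J_def)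
  then have Um: "U k \<in> sets \<mu>" for k using fin unfolding U_def by blast
  have U_le: "measure \<mu> (U k) \<le> (2 powr (- \<epsilon>)) ^ k" for k
  proof -
    have "measure \<mu> (U k) \<le> (\<Sum>i\<in>bad k. measure \<mu> (J k i))"
      unfolding U_def using Jm fin by (intro finite_measure_subadditive_finite) auto
    also have "\<dots> \<le> (\<Sum>i\<in>bad k. (1 / 2 ^ k) powr (1 + \<epsilon>))"
      by (intro sum_mono) (auto simp: bad_def)
    also have "\<dots> \<le> 2 ^ k * (1 / 2 ^ k) powr (1 + \<epsilon>)"
      using card[of k] by (simp add: mult_right_mono)
    also have "\<dots> = (2 powr (- \<epsilon>)) ^ k"
      by (simp add: powr_divide powr_add powr_realpow[symmetric] powr_powr powr_minus field_simps)
    finally show ?thesis .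
  qed
  have "summable (\<lambda>k. measure \<mu> (U k))"
  proof -
    have s: "summable (\<lambda>k. (2 powr (- \<epsilon>)) ^ k)" using assms by (intro summable_geometric) (simp add: powr_less_one)
    show ?thesis
      by (rule summable_comparison_test_ev[OF _ s]) (use U_le in auto)
  qed
  then have "AE x in \<mu>. eventually (\<lambda>k. x \<in> space \<mu> - U k) sequentially"
    using Um by (intro borel_cantelli_AE1) (auto simp: emeasure_eq_measure)
  with AE_circ show ?thesis
  proof eventually_elim
    case (elim x)
    then obtain K where K: "\<And>k. k \<ge> K \<Longrightarrow> x \<notin> U k" unfolding eventually_sequentially by auto
    have x: "0 \<le> x" "x < 1" using elim by (auto simp: circ_def)
    have lower: "measure \<mu> (cball_open x (1 / 2 ^ k)) \<ge> (1 / 2 ^ k) powr (1 + \<epsilon>)" if "k \<ge> K" for k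
    proof -
      define i where "i = nat \<lfloor>x * 2 ^ k\<rfloor>"
      have i: "real i \<le> x * 2 ^ k" "x * 2 ^ k < real i + 1" using x by (auto simp: i_def)
      have "x * 2 ^ k < 2 ^ k" using x by simp
      then have "real i < 2 ^ k" using i(1) by linarith
      then have "real i < real (2 ^ k)" by (simp only: of_nat_power of_nat_numeral)
      then have il: "i < 2 ^ k" by (simp only: of_nat_less_iff)
      have xJ: "x \<in> J k i" using i by (simp add: J_def field_simps)
      then have "i \<notin> bad k" using K[OF that] by (auto simp: U_def)
      then have "(1 / 2 ^ k) powr (1 + \<epsilon>) \<le> measure \<mu> (J k i)" using il by (simp add: bad_def)
      also have "\<dots> \<le> measure \<mu> (cball_open x (1 / 2 ^ k))"
      proof (rule finite_measure_mono)
        show "J k i \<subseteq> cball_open x (1 / 2 ^ k)"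
        proof
          fix y assume y: "y \<in> J k i"
          have "real i + 1 \<le> 2 ^ k" 
          proof -
            have "real (Suc i) \<le> real (2 ^ k)" using il by (simp only: of_nat_le_iff Suc_le_eq)
            then show ?thesis by simp
          qed
          then have "(real i + 1) / 2 ^ k \<le> 1" by simp
          then have "y < 1" using y unfolding J_def by (meson atLeastLessThan_iff less_le_trans)
          moreover have "y \<ge> 0" 
          proof -
            have "0 \<le> real i / 2 ^ k" by simp
            then show ?thesis using y unfolding J_def by (meson atLeastLessThan_iff order_trans)
          qed
          moreover have "(real i + 1) / 2 ^ k = real i / 2 ^ k + 1 / 2 ^ k" by (simp add: add_divide_distrib)
          then have "\<bar>x - y\<bar> < 1 / 2 ^ k" using xJ y unfolding J_def by auto
          ultimately show "y \<in> cball_open x (1 / 2 ^ k)"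
            using cdist_le[of x y 0] by (auto simp: cball_open_def circ_def)
        qed
      qed simp
      finally show ?thesis .
    qed
    show ?case unfolding upper_local_dim_def
    proof (rule Limsup_bounded)
      \<comment> \<open>The second \<epsilon> pays for the factor 2 lost when r is rounded down to a
        dyadic scale.\<close>
      have "\<forall>\<^sub>F r in at_right (0::real). r powr (1 + 2 * \<epsilon>) < (r / 2) powr (1 + \<epsilon>)"
      proof -
        define c :: real where "c = (1/2) powr (1 + \<epsilon>)"
        have "\<forall>\<^sub>F r in at_right (0::real). 0 < r \<and> r < c powr (1 / \<epsilon>)"
          using eventually_at_right_real[of 0 "c powr (1 / \<epsilon>)"] by (auto simp: c_def elim: eventually_mono)
        then show ?thesis
        proof eventually_elim
          case (elim r)
          have "r powr \<epsilon> < (c powr (1 / \<epsilon>)) powr \<epsilon>" using elim assms by (intro powr_less_mono2) auto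
          also have "\<dots> = c" using assms by (simp add: powr_powr c_def)
          finally have "r powr (1 + \<epsilon>) * r powr \<epsilon> < r powr (1 + \<epsilon>) * c" using elim by simp
          moreover have "r powr (1 + \<epsilon>) * c = (r / 2) powr (1 + \<epsilon>)"
            using elim by (simp add: c_def powr_divide)
          moreover have "r powr (1 + \<epsilon>) * r powr \<epsilon> = r powr (1 + 2 * \<epsilon>)"
            by (simp add: powr_add[symmetric] add.commute)
          ultimately show ?case by linarith
        qed
      qed
      moreover have "\<forall>\<^sub>F r in at_right (0::real). r < (1/2) ^ K"
        using eventually_at_right_real[of 0 "(1/2) ^ K"] by (auto elim: eventually_mono)
      ultimately show "\<forall>\<^sub>F r in at_right 0. log_ratio (measure \<mu> (cball_open x r)) r \<le> ereal (1 + 2 * \<epsilon>)"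
        using eventually_unit_interval
      proof eventually_elim
        case (elim r)
        define k where "k = (LEAST k. (1/2) ^ k \<le> r)"
        have "\<exists>k. (1/2) ^ k \<le> r" using real_arch_pow_inv[of r "1/2"] elim by (auto intro: less_imp_le)
        then have k: "(1/2) ^ k \<le> r" unfolding k_def by (rule LeastI_ex)
        have k0: "k > 0" using k elim by (intro Nat.gr0I) auto
        have "\<not> (1/2) ^ (k - 1) \<le> r" using k0 unfolding k_def by (intro not_less_Least) auto
        then have k2: "r / 2 < (1/2) ^ k" using k0 by (cases k) auto
        have "k \<ge> K"
        proof (rule ccontr)
          assume "\<not> k \<ge> K"
          then have "(1/2) ^ K \<le> (1/2::real) ^ k" by (intro power_decreasing) auto
          then show False using k elim by linarith
        qed
        have e: "(1/2) ^ k = 1 / (2::real) ^ k" by (simp add: power_one_over)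
        have "r powr (1 + 2 * \<epsilon>) \<le> (r / 2) powr (1 + \<epsilon>)" using elim by simp
        also have "\<dots> \<le> (1 / 2 ^ k) powr (1 + \<epsilon>)" using k2 e elim assms by (intro powr_mono2) auto
        also have "\<dots> \<le> measure \<mu> (cball_open x (1 / 2 ^ k))" by (rule lower) fact
        also have "\<dots> \<le> measure \<mu> (cball_open x r)"
          using k e by (intro finite_measure_mono cball_open_mono) auto
        finally show ?case using elim by (intro log_ratio_le) auto
      qed
    qed
  qed
qed

lemma upper_local_dim_le_1: "AE x in \<mu>. upper_local_dim \<mu> x \<le> 1"
proof -
  have "AE x in \<mu>. \<forall>n. upper_local_dim \<mu> x \<le> ereal (1 + 2 * (1 / Suc n))"
    unfolding AE_all_countable by (intro allI upper_local_dim_le_aux) simp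
  then show ?thesis
  proof eventually_elim
    case (elim x)
    have "upper_local_dim \<mu> x \<le> ereal s" if "s > 1" for s
    proof -
      have "(s - 1) / 2 > 0" using that by simp
      then obtain n where "inverse (real (Suc n)) < (s - 1) / 2" using reals_Archimedean by blast
      then have "1 + 2 * (1 / Suc n) \<le> s" by (simp add: inverse_eq_divide)
      then show ?thesis using elim[rule_format, of n] by (meson ereal_less_eq(3) order_trans)
    qed
    then show ?case using ereal_ge_if_reals_above[of 1] by (simp add: one_ereal_def)
  qed
qed

end

section \<open>Dimensions of a measure with two extremal sequences of scales\<close>

text \<open>Isolates what the dimensions require of the construction: balls obey exponents below
  \<beta> at all scales and exponents close to 1 at the scales \<open>r n\<close>, while the sets
  \<open>E n\<close>, of almost full measure, have at the scales \<open>\<rho> n\<close> heavy balls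
  and economical covers with exponents just above \<beta>. The bound \<open>\<rho> n\<close> \<le>
  2^-n makes the Hausdorff sums over n converge.\<close>

locale exact_scaling = circle_measure +
  fixes \<beta> :: real and r \<rho> :: "nat \<Rightarrow> real" and E :: "nat \<Rightarrow> real set"
  assumes beta: "0 \<le> \<beta>" "\<beta> \<le> 1"
    and ball_upper: "\<And>s. s < \<beta> \<Longrightarrow> \<forall>\<^sub>F e in at_right 0. \<forall>x\<in>circ. measure \<mu> (cball_open x e) \<le> e powr s"
    and r_lim: "filterlim r (at_right 0) sequentially"
    and ball_sparse: "\<And>s. s < 1 \<Longrightarrow> \<forall>\<^sub>F n in sequentially. \<forall>x\<in>circ. measure \<mu> (cball_open x (r n)) \<le> r n powr s"
    and E_sets [measurable]: "\<And>n. E n \<in> sets borel" and E_circ: "\<And>n. E n \<subseteq> circ"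
    and E_sum: "summable (\<lambda>n. measure \<mu> (circ - E n))"
    and rho: "\<And>n. 0 < \<rho> n" "\<And>n. \<rho> n \<le> (1/2) ^ n"
    and E_dense: "\<And>s. s > \<beta> \<Longrightarrow> \<forall>\<^sub>F n in sequentially. \<forall>x\<in>E n. \<rho> n powr s \<le> measure \<mu> (cball_open x (\<rho> n))"
    and E_cover: "\<And>s. s > \<beta> \<Longrightarrow> \<forall>\<^sub>F n in sequentially. \<exists>C. finite C \<and> C \<subseteq> circ \<and>
        real (card C) \<le> \<rho> n powr - s \<and> E n \<subseteq> (\<Union>c\<in>C. cball_closed c (\<rho> n / 2))"
begin

lemma rho_lim: "filterlim \<rho> (at_right 0) sequentially"
proof -
  have "\<rho> \<longlonglongrightarrow> 0"
  proof (rule tendsto_sandwich[OF _ _ tendsto_const])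
    show "(\<lambda>n. (1/2::real) ^ n) \<longlonglongrightarrow> 0" by (rule LIMSEQ_power_zero) simp
  qed (use rho in \<open>auto intro!: always_eventually less_imp_le\<close>)
  then show ?thesis using rho(1) by (intro tendsto_imp_filterlim_at_right) auto
qed

text \<open>Box dimension is not countably stable, so it is estimated on one \<open>tail m\<close>,
  which lies in every \<open>E n\<close> with n \<ge> m. The union \<open>core\<close> has full
  measure by Borel-Cantelli and serves for local and Hausdorff dimension.\<close>

definition "tail m = circ \<inter> (\<Inter>n\<in>{m..}. E n)"
definition "core = (\<Union>m. tail m)"

lemma tail_sets [measurable]: "tail m \<in> sets borel"
  unfolding tail_def by measurable

lemma tail_circ: "tail m \<subseteq> circ" by (auto simp: tail_def)

lemma core_sets [measurable]: "core \<in> sets borel" unfolding core_def by measurable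

lemma core_circ: "core \<subseteq> circ" by (auto simp: core_def tail_def)

lemma AE_core: "AE x in \<mu>. x \<in> core"
proof -
  have "AE x in \<mu>. eventually (\<lambda>n. x \<in> space \<mu> - (circ - E n)) sequentially"
    using E_sum by (intro borel_cantelli_AE1) (auto simp: emeasure_eq_measure)
  with AE_circ show ?thesis
    by eventually_elim (auto simp: core_def tail_def eventually_sequentially)
qed

lemma measure_core: "measure \<mu> core = 1"
  using prob_eq_1[of core] AE_core by simp

lemma tail_measure_lim: "(\<lambda>m. measure \<mu> (tail m)) \<longlonglongrightarrow> 1"
proof -
  have "incseq tail" unfolding incseq_def tail_def by fastforce
  then have "(\<lambda>m. measure \<mu> (tail m)) \<longlonglongrightarrow> measure \<mu> (\<Union>m. tail m)"
    by (intro finite_Lim_measure_incseq) auto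
  then show ?thesis using measure_core by (simp add: core_def)
qed

lemma lower_local_ge: "x \<in> circ \<Longrightarrow> ereal \<beta> \<le> lower_local_dim \<mu> x"
proof (rule ereal_le_if_reals_below)
  fix s assume x: "x \<in> circ" and s: "s < \<beta>"
  show "ereal s \<le> lower_local_dim \<mu> x" unfolding lower_local_dim_def
  proof (rule Liminf_bounded)
    show "\<forall>\<^sub>F e in at_right 0. ereal s \<le> log_ratio (measure \<mu> (cball_open x e)) e"
      using ball_upper[OF s] eventually_unit_interval
      by eventually_elim (use x in \<open>auto intro!: log_ratio_ge\<close>)
  qed
qed

lemma upper_local_ge: "x \<in> circ \<Longrightarrow> 1 \<le> upper_local_dim \<mu> x"
proof -
  assume x: "x \<in> circ"
  have "ereal 1 \<le> upper_local_dim \<mu> x"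
  proof (rule ereal_le_if_reals_below)
    fix s :: real assume s: "s < 1"
    show "ereal s \<le> upper_local_dim \<mu> x" unfolding upper_local_dim_def
    proof (rule Limsup_ge_along[OF r_lim])
      have "\<forall>\<^sub>F n in sequentially. 0 < r n \<and> r n < 1"
        using eventually_compose_filterlim[OF eventually_unit_interval r_lim] .
      then show "\<forall>\<^sub>F n in sequentially. ereal s \<le> log_ratio (measure \<mu> (cball_open x (r n))) (r n)"
        using ball_sparse[OF s]
        by eventually_elim (use x in \<open>auto intro!: log_ratio_ge\<close>)
    qed simp
  qed
  then show ?thesis by (simp add: one_ereal_def)
qed

lemma rho_unit: "\<forall>\<^sub>F n in sequentially. 0 < \<rho> n \<and> \<rho> n < 1"
  using eventually_compose_filterlim[OF eventually_unit_interval rho_lim] .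

lemma lower_local_le: "x \<in> core \<Longrightarrow> lower_local_dim \<mu> x \<le> ereal \<beta>"
proof (rule ereal_ge_if_reals_above)
  fix s assume x: "x \<in> core" and s: "s > \<beta>"
  then obtain m where m: "\<And>n. n \<ge> m \<Longrightarrow> x \<in> E n" by (auto simp: core_def tail_def)
  show "lower_local_dim \<mu> x \<le> ereal s" unfolding lower_local_dim_def
  proof (rule Liminf_le_along[OF rho_lim])
    show "\<forall>\<^sub>F n in sequentially. log_ratio (measure \<mu> (cball_open x (\<rho> n))) (\<rho> n) \<le> ereal s"
      using E_dense[OF s] rho_unit eventually_ge_at_top[of m]
      by eventually_elim (use m in \<open>auto intro!: log_ratio_le\<close>)
  qed simp
qed

lemma AE_local_dims: "AE x in \<mu>. lower_local_dim \<mu> x = ereal \<beta> \<and> upper_local_dim \<mu> x = 1"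
  using AE_core upper_local_dim_le_1
proof eventually_elim
  case (elim x)
  then show ?case
    using lower_local_ge[of x] lower_local_le[of x] upper_local_ge[of x] core_circ by (auto intro: antisym)
qed

text \<open>The closed ball lies in the open ball of twice the radius, which costs 2^s \<le> 2. For
  diameter 0 there is no such open ball; letting d tend to 0 shows instead that the point has no
  mass.\<close>

lemma measure_small_set:
  assumes U: "U \<subseteq> circ" "x \<in> U" and s: "0 < s" "s < 1"
    and e: "0 < e" "\<And>d x. 0 < d \<Longrightarrow> d < e \<Longrightarrow> x \<in> circ \<Longrightarrow> measure \<mu> (cball_open x d) \<le> d powr s"
    and d: "2 * cdiam U < e"
  shows "measure \<mu> (cball_closed x (cdiam U)) \<le> 2 * cdiam U powr s"
proof (cases "cdiam U = 0")
  case True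
  have le: "measure \<mu> (cball_closed x (cdiam U)) \<le> d powr s" if "0 < d" "d < e" for d
  proof -
    have "measure \<mu> (cball_closed x (cdiam U)) \<le> measure \<mu> (cball_open x d)"
      using that True by (intro finite_measure_mono cball_closed_subset_open) auto
    also have "\<dots> \<le> d powr s" using that U by (intro e) auto
    finally show ?thesis .
  qed
  have "((\<lambda>d. d powr s) \<longlongrightarrow> 0 powr s) (at_right (0::real))"
    by (rule tendsto_powr') (use s in \<open>auto intro!: tendsto_eq_intros eventually_at_right_less[THEN eventually_mono] simp: less_imp_le\<close>)
  then have lim: "((\<lambda>d. d powr s) \<longlongrightarrow> 0) (at_right (0::real))" by simp
  have "measure \<mu> (cball_closed x (cdiam U)) \<le> 0"
  proof (rule tendsto_lowerbound[OF lim])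
    show "\<forall>\<^sub>F d in at_right 0. measure \<mu> (cball_closed x (cdiam U)) \<le> d powr s"
      using eventually_at_right_real[OF e(1)] by eventually_elim (use le in auto)
  qed simp
  then show ?thesis using True by simp
next
  case False
  then have pos: "cdiam U > 0" using cdiam_nonneg[of U] by simp
  have "measure \<mu> (cball_closed x (cdiam U)) \<le> measure \<mu> (cball_open x (2 * cdiam U))"
    using pos by (intro finite_measure_mono cball_closed_subset_open) auto
  also have "\<dots> \<le> (2 * cdiam U) powr s" using pos d U by (intro e) auto
  also have "\<dots> = 2 powr s * cdiam U powr s" using pos by (simp add: powr_mult)
  also have "\<dots> \<le> 2 * cdiam U powr s"
    using powr_mono[of s 1 2] s by (intro mult_right_mono) auto
  finally show ?thesis .
qed

text \<open>Mass distribution principle: for s < \<beta>, a fine cover of Z with s-sum below 1/2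
  would give Z mass below 1.\<close>

lemma dim_H_ge:
  assumes Z: "Z \<in> sets borel" "Z \<subseteq> circ" "measure \<mu> Z = 1"
  shows "ereal \<beta> \<le> dim_H Z"
  unfolding dim_H_def
proof (rule Inf_greatest, clarify)
  fix s assume s: "0 \<le> s" "hausdorff_measure s Z = 0"
  have "\<beta> \<le> s"
  proof (rule ccontr)
    assume "\<not> \<beta> \<le> s"
    then have sb: "s < \<beta>" by simp
    obtain e where e: "0 < e" "\<And>d x. 0 < d \<Longrightarrow> d < e \<Longrightarrow> x \<in> circ \<Longrightarrow> measure \<mu> (cball_open x d) \<le> d powr s"
      using ball_upper[OF sb] unfolding eventually_at_right_field by blast
    have "hausdorff_delta s (e / 3) Z \<le> hausdorff_measure s Z"
      unfolding hausdorff_measure_def using e by (intro SUP_upper) auto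
    moreover have "(0::ennreal) < ennreal (1/2)" by (subst ennreal_less_zero_iff) simp
    ultimately have "hausdorff_delta s (e / 3) Z < ennreal (1/2)"
      using s by (metis le_less_trans)
    then obtain U :: "nat \<Rightarrow> real set" where U: "\<And>n. U n \<subseteq> circ" "\<And>n. cdiam (U n) \<le> e / 3" "Z \<subseteq> (\<Union>n. U n)"
      and sum: "(\<Sum>n. ennreal (diam_pow s (U n))) < ennreal (1/2)"
      unfolding hausdorff_delta_def by (auto simp: INF_less_iff)
    \<comment> \<open>Covering sets may be nonmeasurable, so each is enlarged to a closed ball about
      one of its points with its diameter as radius.\<close>
    define V where "V n = (if U n = {} then {} else cball_closed (SOME x. x \<in> U n) (cdiam (U n)))" for n
    have V_sets: "V n \<in> sets borel" for n by (simp add: V_def)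
    have UV: "U n \<subseteq> V n" for n
    proof
      fix y assume y: "y \<in> U n"
      then have "(SOME x. x \<in> U n) \<in> U n" by (rule someI)
      then show "y \<in> V n" using y U(1)[of n] cdist_le_cdiam[of _ "U n" y] by (auto simp: V_def cball_closed_def)
    qed
    have V_le: "measure \<mu> (V n) \<le> 2 * diam_pow s (U n)" for n
    proof (cases "U n = {}")
      case False
      then have x: "(SOME x. x \<in> U n) \<in> U n" by (simp add: some_in_eq)
      show ?thesis
      \<comment> \<open>For s = 0 every nonempty set counts as 1, and the total mass 1 is a
        sufficient bound.\<close>
      proof (cases "s = 0")
        case True
        have "measure \<mu> (V n) \<le> 1" by (rule prob_le_1)
        then have "measure \<mu> (V n) \<le> 2" by linarith
        then show ?thesis using True False by (simp add: diam_pow_def)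
      next
        case s0: False
        have "measure \<mu> (V n) \<le> 2 * cdiam (U n) powr s"
          unfolding V_def using False measure_small_set[OF U(1) x, of s e] s0 s sb beta e U(2)[of n]
          by (auto simp: field_simps)
        then show ?thesis using False s0 by (simp add: diam_pow_def)
      qed
    qed (simp add: V_def diam_pow_def)
    have "emeasure \<mu> Z \<le> emeasure \<mu> (\<Union>n. V n)"
      using U(3) UV V_sets by (intro emeasure_mono) (auto, blast)
    also have "\<dots> \<le> (\<Sum>n. emeasure \<mu> (V n))"
      using V_sets by (intro emeasure_subadditive_countably) auto
    also have "\<dots> \<le> (\<Sum>n. 2 * ennreal (diam_pow s (U n)))"
    proof (intro suminf_le summableI)
      fix n
      have "emeasure \<mu> (V n) \<le> ennreal (2 * diam_pow s (U n))"
        using V_le by (simp add: emeasure_eq_measure ennreal_leI)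
      also have "\<dots> = 2 * ennreal (diam_pow s (U n))"
        by (subst ennreal_mult) (auto simp: diam_pow_def)
      finally show "emeasure \<mu> (V n) \<le> 2 * ennreal (diam_pow s (U n))" .
    qed
    also have "\<dots> = 2 * (\<Sum>n. ennreal (diam_pow s (U n)))" by simp
    also have "\<dots> < 2 * ennreal (1/2)"
      using sum by (intro ennreal_mult_strict_left_mono) auto
    also have "\<dots> = 1"
      by (metis ennreal_1 ennreal_mult ennreal_numeral field_sum_of_halves mult_2 zero_le_divide_1_iff zero_le_numeral)
    finally show False using Z by (simp add: emeasure_eq_measure)
  qed
  then show "ereal \<beta> \<le> ereal s" by simp
qed

text \<open>Every point of \<open>core\<close> lies in some \<open>E n\<close> with n \<ge> N, so
  the covers of all these \<open>E n\<close> together cover it. With s1 between \<beta> and s, the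
  cover at scale \<rho> contributes at most \<rho>^(-s1) \<rho>^s, and the tail of this summable
  series is arbitrarily small.\<close>

lemma hausdorff_core_zero:
  assumes "s > \<beta>" shows "hausdorff_measure s core = 0"
proof -
  have s0: "s > 0" using assms beta by simp
  define s1 where "s1 = (s + \<beta>) / 2"
  have s1: "\<beta> < s1" "s1 < s" using assms by (auto simp: s1_def)
  obtain n0 where "\<forall>n\<ge>n0. \<exists>C. finite C \<and> C \<subseteq> circ \<and>
        real (card C) \<le> \<rho> n powr - s1 \<and> E n \<subseteq> (\<Union>c\<in>C. cball_closed c (\<rho> n / 2))"
    using E_cover[OF s1(1)] unfolding eventually_sequentially by blast
  then obtain C where C: "\<And>n. n \<ge> n0 \<Longrightarrow> finite (C n)" "\<And>n. n \<ge> n0 \<Longrightarrow> C n \<subseteq> circ"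
     "\<And>n. n \<ge> n0 \<Longrightarrow> real (card (C n)) \<le> \<rho> n powr - s1"
     "\<And>n. n \<ge> n0 \<Longrightarrow> E n \<subseteq> (\<Union>c\<in>C n. cball_closed c (\<rho> n / 2))"
    by metis
  have "hausdorff_delta s \<delta> core \<le> 0" if \<delta>: "\<delta> > 0" for \<delta>
  proof (rule ennreal_le_epsilon)
    fix \<eta> :: real assume eta: "0 < \<eta>"
    have summ: "summable (\<lambda>n. \<rho> n powr (s - s1))"
    proof (rule summable_comparison_test_ev)
      show "summable (\<lambda>n. ((1/2) powr (s - s1)) ^ n)"
        using s1 powr_less_mono2[of "s - s1" "1/2" 1] by (intro summable_geometric) simp
      have "\<rho> n powr (s - s1) \<le> ((1/2) powr (s - s1)) ^ n" for n
      proof -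
        have "\<rho> n powr (s - s1) \<le> ((1/2) ^ n) powr (s - s1)"
          using rho(1)[of n] rho(2)[of n] s1 by (intro powr_mono2) auto
        also have "\<dots> = ((1/2) powr (s - s1)) ^ n"
          by (simp add: powr_realpow[symmetric] powr_powr mult.commute)
        finally show ?thesis .
      qed
      then show "\<forall>\<^sub>F n in sequentially. norm (\<rho> n powr (s - s1)) \<le> ((1/2) powr (s - s1)) ^ n" by simp
    qed
    have "(\<lambda>i. suminf (\<lambda>k. \<rho> (k + i) powr (s - s1))) \<longlonglongrightarrow> 0"
      using suminf_exist_split2[OF summ] .
    then have "\<forall>\<^sub>F i in sequentially. suminf (\<lambda>k. \<rho> (k + i) powr (s - s1)) < \<eta>"
      using eta by (rule order_tendstoD)
    moreover have "\<forall>\<^sub>F i in sequentially. (1/2::real) ^ i < \<delta>"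
      using LIMSEQ_power_zero[of "1/2::real"] \<delta> by (intro order_tendstoD) auto
    ultimately have "\<forall>\<^sub>F i in sequentially. suminf (\<lambda>k. \<rho> (k + i) powr (s - s1)) < \<eta> \<and> (1/2::real) ^ i < \<delta> \<and> i \<ge> n0"
      using eventually_ge_at_top[of n0] by eventually_elim auto
    then obtain N where N: "suminf (\<lambda>k. \<rho> (k + N) powr (s - s1)) < \<eta>" "(1/2) ^ N < \<delta>" "N \<ge> n0"
      unfolding eventually_sequentially by blast
    \<comment> \<open>The finite covers are padded with empty sets, which \<open>diam_pow\<close>
      weighs as 0; the double sequence is then enumerated by \<open>prod_decode\<close>.\<close>
    define W where "W = (\<lambda>(n, i). if i < card (C (n + N)) then cball_closed (from_nat_into (C (n + N)) i) (\<rho> (n + N) / 2) else {})"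
    have W_circ: "W p \<subseteq> circ" for p by (auto simp: W_def cball_closed_def split: prod.splits)
    have W_diam: "cdiam (W (n, i)) \<le> \<rho> (n + N)" for n i
      using cdiam_cball_closed[of "\<rho> (n + N) / 2"] rho(1)[of "n + N"] cdiam_le[of "{}" "\<rho> (n + N)"]
      by (auto simp: W_def)
    have W_delta: "cdiam (W p) \<le> \<delta>" for p
    proof -
      obtain n i where p: "p = (n, i)" by (cases p) auto
      have "(1/2::real) ^ (n + N) \<le> (1/2) ^ N" by (intro power_decreasing) auto
      then show ?thesis using W_diam[of n i] rho(2)[of "n + N"] N(2) unfolding p by linarith
    qed
    have cov: "core \<subseteq> (\<Union>k. W (prod_decode k))"
    proof
      fix x assume "x \<in> core"
      then obtain m where m: "\<And>n. n \<ge> m \<Longrightarrow> x \<in> E n" by (auto simp: core_def tail_def)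
      have "x \<in> E (m + N)" using m by simp
      then obtain c where c: "c \<in> C (m + N)" "x \<in> cball_closed c (\<rho> (m + N) / 2)"
        using C(4)[of "m + N"] N(3) by fastforce
      have fin: "finite (C (m + N))" using C(1) N(3) by simp
      then have "c \<in> from_nat_into (C (m + N)) ` {..<card (C (m + N))}"
        using c(1) bij_betw_from_nat_into_finite[OF fin] by (simp add: bij_betw_def)
      then obtain i where "i < card (C (m + N))" "c = from_nat_into (C (m + N)) i" by auto
      then have "x \<in> W (m, i)" using c(2) by (simp add: W_def)
      then have "x \<in> W (prod_decode (prod_encode (m, i)))" by simp
      then show "x \<in> (\<Union>k. W (prod_decode k))" by blast
    qed
    have "hausdorff_delta s \<delta> core \<le> (\<Sum>k. ennreal (diam_pow s (W (prod_decode k))))"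
      unfolding hausdorff_delta_def
      by (rule INF_lower) (use W_circ W_delta cov in auto)
    also have "\<dots> = (\<Sum>n. \<Sum>i. ennreal (diam_pow s (W (n, i))))"
      by (rule suminf_ennreal_2dimen[of _ "\<lambda>p. ennreal (diam_pow s (W p))"]) simp
    also have "\<dots> \<le> (\<Sum>n. ennreal (\<rho> (n + N) powr (s - s1)))"
    proof (intro suminf_le summableI)
      fix n
      let ?c = "card (C (n + N))"
      have "(\<Sum>i. ennreal (diam_pow s (W (n, i)))) = (\<Sum>i<?c. ennreal (diam_pow s (W (n, i))))"
        by (rule suminf_finite) (auto simp: W_def diam_pow_def)
      also have "\<dots> \<le> (\<Sum>i<?c. ennreal (\<rho> (n + N) powr s))"
      proof (intro sum_mono ennreal_leI)
        fix i
        show "diam_pow s (W (n, i)) \<le> \<rho> (n + N) powr s"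
          using W_diam[of n i] cdiam_nonneg[of "W (n, i)"] s0 by (auto simp: diam_pow_def intro!: powr_mono2)
      qed
      also have "\<dots> = ennreal (\<Sum>i<?c. \<rho> (n + N) powr s)" by (rule sum_ennreal) simp
      also have "\<dots> \<le> ennreal (\<rho> (n + N) powr (s - s1))"
      proof (rule ennreal_leI)
        have "(\<Sum>i<?c. \<rho> (n + N) powr s) = real ?c * \<rho> (n + N) powr s" by simp
        also have "\<dots> \<le> \<rho> (n + N) powr - s1 * \<rho> (n + N) powr s"
          using C(3)[of "n + N"] N(3) by (intro mult_right_mono) auto
        also have "\<dots> = \<rho> (n + N) powr (s - s1)" by (simp add: powr_add[symmetric])
        finally show "(\<Sum>i<?c. \<rho> (n + N) powr s) \<le> \<rho> (n + N) powr (s - s1)" .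
      qed
      finally show "(\<Sum>i. ennreal (diam_pow s (W (n, i)))) \<le> ennreal (\<rho> (n + N) powr (s - s1))" .
    qed
    also have "\<dots> = ennreal (\<Sum>n. \<rho> (n + N) powr (s - s1))"
      using summable_ignore_initial_segment[OF summ] by (intro suminf_ennreal2) auto
    also have "\<dots> \<le> ennreal \<eta>" using N(1) by (intro ennreal_leI) simp
    finally show "hausdorff_delta s \<delta> core \<le> 0 + ennreal \<eta>" by simp
  qed
  then show ?thesis unfolding hausdorff_measure_def by (auto intro!: antisym SUP_least)
qed

lemma dim_H_measure_eq: "dim_H_measure \<mu> = ereal \<beta>"
proof (rule antisym)
  have "dim_H core \<le> ereal \<beta>"
  proof (rule ereal_ge_if_reals_above)
    fix s assume "s > \<beta>"
    then show "dim_H core \<le> ereal s"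
      unfolding dim_H_def using hausdorff_core_zero[of s] beta by (intro Inf_lower) auto
  qed
  moreover have "dim_H_measure \<mu> \<le> dim_H core"
    unfolding dim_H_measure_def using measure_core core_circ by (intro Inf_lower) auto
  ultimately show "dim_H_measure \<mu> \<le> ereal \<beta>" by simp
  show "ereal \<beta> \<le> dim_H_measure \<mu>"
    unfolding dim_H_measure_def by (rule Inf_greatest) (use dim_H_ge in auto)
qed

section \<open>Box dimensions\<close>

lemma cover_number_ge:
  assumes Z: "Z \<in> sets borel" "Z \<subseteq> circ" and e: "0 < e" "e < 1"
    and b: "\<And>x. x \<in> circ \<Longrightarrow> measure \<mu> (cball_open x e) \<le> e powr s"
  shows "measure \<mu> Z \<le> real (cover_number Z e) * e powr s"
proof -
  obtain C where C: "finite C" "card C = cover_number Z e" "C \<subseteq> circ" "Z \<subseteq> (\<Union>c\<in>C. cball_closed c (e / 2))"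
    using cover_number_cover[OF e Z(2)] .
  have "measure \<mu> Z \<le> measure \<mu> (\<Union>c\<in>C. cball_closed c (e / 2))"
    using C by (intro finite_measure_mono) auto
  also have "\<dots> \<le> (\<Sum>c\<in>C. measure \<mu> (cball_closed c (e / 2)))"
    using C by (intro finite_measure_subadditive_finite) auto
  also have "\<dots> \<le> (\<Sum>c\<in>C. e powr s)"
  proof (rule sum_mono)
    fix c assume c: "c \<in> C"
    have "measure \<mu> (cball_closed c (e / 2)) \<le> measure \<mu> (cball_open c e)"
      using e by (intro finite_measure_mono cball_closed_subset_open) auto
    also have "\<dots> \<le> e powr s" using c C(3) by (intro b) auto
    finally show "measure \<mu> (cball_closed c (e / 2)) \<le> e powr s" .
  qed
  finally show ?thesis using C(2) by simp
qed

text \<open>Taken at c = \<mu>(Z) > 0: the correction \<open>ln c / ln (1 / e)\<close> tends to 0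
  with e, so the mass of the set leaves the exponent unchanged.\<close>

lemma box_ratio_ge:
  assumes "0 < c" "c \<le> real N * e powr s" "0 < e" "e < 1"
  shows "s + ln c / ln (1 / e) \<le> ln (real N) / ln (1 / e)"
proof -
  have N: "real N > 0" using assms(1,2) by (cases "N = 0") auto
  have "ln c \<le> ln (real N * e powr s)" using assms(1,2) by (intro ln_mono) auto
  also have "\<dots> = ln (real N) + s * ln e" using N assms(3) by (simp add: ln_mult ln_powr)
  finally have "s * ln (1 / e) + ln c \<le> ln (real N)" using assms(3) by (simp add: ln_div)
  moreover have l: "ln (1 / e) > 0" using assms(3,4) by (simp add: ln_div)
  ultimately have "(s * ln (1 / e) + ln c) / ln (1 / e) \<le> ln (real N) / ln (1 / e)"
    by (intro divide_right_mono) auto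
  then show ?thesis using l by (simp add: add_divide_distrib)
qed

lemma log_const_lim: "((\<lambda>e::real. s + ln c / ln (1 / e)) \<longlongrightarrow> s) (at_right 0)"
  by real_asymp

lemma lower_box_ge:
  assumes Z: "Z \<in> sets borel" "Z \<subseteq> circ" "measure \<mu> Z > 0"
  shows "ereal \<beta> \<le> lower_box_dim Z"
proof (rule ereal_le_if_reals_below)
  fix s assume s: "s < \<beta>"
  obtain s' where s': "s < s'" "s' < \<beta>" using s dense by blast
  show "ereal s \<le> lower_box_dim Z" unfolding lower_box_dim_def
  proof (rule Liminf_bounded)
    have "\<forall>\<^sub>F e in at_right 0. s < s' + ln (measure \<mu> Z) / ln (1 / e)"
      using log_const_lim s'(1) by (rule order_tendstoD)
    then show "\<forall>\<^sub>F e in at_right 0. ereal s \<le> ereal (ln (real (cover_number Z e)) / ln (1 / e))"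
      using eventually_unit_interval ball_upper[OF s'(2)]
    proof eventually_elim
      case (elim e)
      then have "measure \<mu> Z \<le> real (cover_number Z e) * e powr s'"
        by (intro cover_number_ge Z) auto
      from box_ratio_ge[OF Z(3) this] elim show ?case by simp
    qed
  qed
qed

lemma upper_box_ge:
  assumes Z: "Z \<in> sets borel" "Z \<subseteq> circ" "measure \<mu> Z > 0"
  shows "1 \<le> upper_box_dim Z"
proof -
  have "ereal 1 \<le> upper_box_dim Z"
  proof (rule ereal_le_if_reals_below)
    fix s :: real assume s: "s < 1"
    obtain s' where s': "s < s'" "s' < 1" using s dense by blast
    show "ereal s \<le> upper_box_dim Z" unfolding upper_box_dim_def
    proof (rule Limsup_ge_along[OF r_lim])
      have "\<forall>\<^sub>F e in at_right 0. s < s' + ln (measure \<mu> Z) / ln (1 / e)"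
        using log_const_lim s'(1) by (rule order_tendstoD)
      then have "\<forall>\<^sub>F e in at_right 0. (0 < e \<and> e < 1) \<and> s < s' + ln (measure \<mu> Z) / ln (1 / e)"
        using eventually_unit_interval by eventually_elim auto
      from eventually_compose_filterlim[OF this r_lim] ball_sparse[OF s'(2)]
      show "\<forall>\<^sub>F n in sequentially. ereal s \<le> ereal (ln (real (cover_number Z (r n))) / ln (1 / r n))"
      proof eventually_elim
        case (elim n)
        then have "measure \<mu> Z \<le> real (cover_number Z (r n)) * r n powr s'"
          by (intro cover_number_ge Z) auto
        from box_ratio_ge[OF Z(3) this] elim show ?case by simp
      qed
    qed simp
  qed
  then show ?thesis by (simp add: one_ereal_def)
qed

text \<open>For n \<ge> m the whole tail lies in \<open>E n\<close>, so the economical covers bound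
  the ratio along the sequence of scales \<open>\<rho> n\<close>, and this bounds the
  liminf.\<close>

lemma lower_box_tail_le: "lower_box_dim (tail m) \<le> ereal \<beta>"
proof (rule ereal_ge_if_reals_above)
  fix s assume s: "s > \<beta>"
  show "lower_box_dim (tail m) \<le> ereal s" unfolding lower_box_dim_def
  proof (rule Liminf_le_along[OF rho_lim])
    show "\<forall>\<^sub>F n in sequentially. ereal (ln (real (cover_number (tail m) (\<rho> n))) / ln (1 / \<rho> n)) \<le> ereal s"
      using E_cover[OF s] rho_unit eventually_ge_at_top[of m]
    proof eventually_elim
      case (elim n)
      then obtain C where C: "finite C" "C \<subseteq> circ" "real (card C) \<le> \<rho> n powr - s" "E n \<subseteq> (\<Union>c\<in>C. cball_closed c (\<rho> n / 2))"
        by blast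
      have "tail m \<subseteq> E n" using elim by (auto simp: tail_def)
      then have "cover_number (tail m) (\<rho> n) \<le> card C" using C(4) by (intro cover_number_le[OF C(1,2)]) blast
      then have N: "real (cover_number (tail m) (\<rho> n)) \<le> \<rho> n powr - s" using C(3) by linarith
      have l: "ln (1 / \<rho> n) > 0" "ln (1 / \<rho> n) = - ln (\<rho> n)" using elim by (simp_all add: ln_div)
      have "ln (real (cover_number (tail m) (\<rho> n))) \<le> s * ln (1 / \<rho> n)"
      proof (cases "cover_number (tail m) (\<rho> n) = 0")
        case True
        have "0 \<le> s * ln (1 / \<rho> n)" using l s beta by (intro mult_nonneg_nonneg) auto
        then show ?thesis using True by simp
      next
        case False
        then have "ln (real (cover_number (tail m) (\<rho> n))) \<le> ln (\<rho> n powr - s)"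
          using N by (intro ln_mono) auto
        then show ?thesis using elim l by (simp add: ln_powr)
      qed
      then show ?case unfolding ereal_less_eq(3) pos_divide_le_eq[OF l(1)] .
    qed
  qed simp
qed

text \<open>The infimum is already \<beta> for each \<epsilon> in (0,1): a late tail is admissible,
  and every admissible set has positive measure. The limit is that of an eventually constant
  function.\<close>

lemma lower_box_dim_measure_eq: "lower_box_dim_measure \<mu> = ereal \<beta>"
proof -
  have "Inf {lower_box_dim Z |Z. Z \<in> sets \<mu> \<and> Z \<subseteq> circ \<and> measure \<mu> Z > 1 - \<epsilon>} = ereal \<beta>"
    if e: "0 < \<epsilon>" "\<epsilon> < 1" for \<epsilon>
  proof (rule antisym)
    have "\<forall>\<^sub>F m in sequentially. 1 - \<epsilon> < measure \<mu> (tail m)"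
      using e by (intro order_tendstoD(1)[OF tail_measure_lim]) auto
    then obtain m where m: "1 - \<epsilon> < measure \<mu> (tail m)" unfolding eventually_sequentially by blast
    then have "Inf {lower_box_dim Z |Z. Z \<in> sets \<mu> \<and> Z \<subseteq> circ \<and> measure \<mu> Z > 1 - \<epsilon>} \<le> lower_box_dim (tail m)"
      using tail_circ[of m] tail_sets[of m] by (intro Inf_lower CollectI exI[of _ "tail m"]) auto
    then show "Inf {lower_box_dim Z |Z. Z \<in> sets \<mu> \<and> Z \<subseteq> circ \<and> measure \<mu> Z > 1 - \<epsilon>} \<le> ereal \<beta>"
      using lower_box_tail_le[of m] by (rule order_trans)
    show "ereal \<beta> \<le> Inf {lower_box_dim Z |Z. Z \<in> sets \<mu> \<and> Z \<subseteq> circ \<and> measure \<mu> Z > 1 - \<epsilon>}"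
    proof (rule Inf_greatest, clarify)
      fix Z assume "Z \<in> sets \<mu>" "Z \<subseteq> circ" "1 - \<epsilon> < measure \<mu> Z"
      then show "ereal \<beta> \<le> lower_box_dim Z" using e by (intro lower_box_ge) auto
    qed
  qed
  then have "\<forall>\<^sub>F \<epsilon> in at_right 0. Inf {lower_box_dim Z |Z. Z \<in> sets \<mu> \<and> Z \<subseteq> circ \<and> measure \<mu> Z > 1 - \<epsilon>} = ereal \<beta>"
    using eventually_unit_interval by (auto elim: eventually_mono)
  from tendsto_eventually[OF this] show ?thesis
    unfolding lower_box_dim_measure_def by (intro tendsto_Lim) simp_all
qed

lemma upper_box_dim_measure_eq: "upper_box_dim_measure \<mu> = 1"
proof -
  have "Inf {upper_box_dim Z |Z. Z \<in> sets \<mu> \<and> Z \<subseteq> circ \<and> measure \<mu> Z > 1 - \<epsilon>} = 1"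
    if e: "0 < \<epsilon>" "\<epsilon> < 1" for \<epsilon>
  proof (rule antisym)
    have "Inf {upper_box_dim Z |Z. Z \<in> sets \<mu> \<and> Z \<subseteq> circ \<and> measure \<mu> Z > 1 - \<epsilon>} \<le> upper_box_dim circ"
      using measure_circ e by (intro Inf_lower) auto
    then show "Inf {upper_box_dim Z |Z. Z \<in> sets \<mu> \<and> Z \<subseteq> circ \<and> measure \<mu> Z > 1 - \<epsilon>} \<le> 1"
      using upper_box_dim_le_1[of circ] by simp
    show "1 \<le> Inf {upper_box_dim Z |Z. Z \<in> sets \<mu> \<and> Z \<subseteq> circ \<and> measure \<mu> Z > 1 - \<epsilon>}"
    proof (rule Inf_greatest, clarify)
      fix Z assume "Z \<in> sets \<mu>" "Z \<subseteq> circ" "1 - \<epsilon> < measure \<mu> Z"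
      then show "1 \<le> upper_box_dim Z" using e by (intro upper_box_ge) auto
    qed
  qed
  then have "\<forall>\<^sub>F \<epsilon> in at_right 0. Inf {upper_box_dim Z |Z. Z \<in> sets \<mu> \<and> Z \<subseteq> circ \<and> measure \<mu> Z > 1 - \<epsilon>} = 1"
    using eventually_unit_interval by (auto elim: eventually_mono)
  from tendsto_eventually[OF this] show ?thesis
    unfolding upper_box_dim_measure_def by (intro tendsto_Lim) simp_all
qed

end

section \<open>The invariant measure\<close>

context circle_measure
begin

lemma prob_UNIV [simp]: "measure \<mu> UNIV = 1"
  using prob_space by simp

text \<open>For \<open>z \<in> [0,1)\<close> the integrand counts translates of \<open>z\<close> below \<open>x\<close>, so this extends \<open>x \<mapsto> \<mu> [0,x)\<close> from \<open>[0,1]\<close> to the line.\<close>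
definition lifted_cdf :: "real \<Rightarrow> real" where
  "lifted_cdf x = (\<integral>z. real_of_int \<lceil>x - z\<rceil> \<partial>\<mu>)"

lemma ceiling_measurable: "(\<lambda>z. real_of_int \<lceil>x - z\<rceil>) \<in> borel_measurable \<mu>"
  unfolding ceiling_def by measurable

lemma integrable_ceiling: "integrable \<mu> (\<lambda>z. real_of_int \<lceil>x - z\<rceil>)"
proof (rule integrable_const_bound)
  show "AE z in \<mu>. norm (real_of_int \<lceil>x - z\<rceil>) \<le> \<bar>x\<bar> + 2"
    using AE_circ by eventually_elim (auto simp: circ_def abs_le_iff, linarith+)
qed (rule ceiling_measurable)

lemma lifted_cdf_mono: "mono lifted_cdf"
  unfolding lifted_cdf_def mono_def
  by (intro allI impI integral_mono integrable_ceiling) (simp add: ceiling_mono)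

lemma lifted_cdf_plus_1: "lifted_cdf (x + 1) = lifted_cdf x + 1"
proof -
  have "lifted_cdf (x + 1) = (\<integral>z. real_of_int \<lceil>x - z\<rceil> + 1 \<partial>\<mu>)"
    unfolding lifted_cdf_def
  proof (intro Bochner_Integration.integral_cong refl)
    fix z
    have "x + 1 - z = (x - z) + 1" by simp
    then show "real_of_int \<lceil>x + 1 - z\<rceil> = real_of_int \<lceil>x - z\<rceil> + 1" by (simp only: ceiling_add_one of_int_add of_int_1)
  qed
  then show ?thesis using integrable_ceiling by (simp add: lifted_cdf_def prob_space)
qed

text \<open>For z in [0,1) the difference x - z lies in (-1,1], where the ceiling is 1 if z < x and
  0 otherwise.\<close>

lemma lifted_cdf_eq_measure:
  assumes "0 \<le> x" "x \<le> 1" shows "lifted_cdf x = measure \<mu> {..<x}"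
proof -
  have "lifted_cdf x = (\<integral>z. indicator {..<x} z \<partial>\<mu>)"
    unfolding lifted_cdf_def
  proof (rule integral_cong_AE)
    show "AE z in \<mu>. real_of_int \<lceil>x - z\<rceil> = indicator {..<x} z"
      using AE_circ
    proof eventually_elim
      case (elim z)
      have "\<lceil>x - z\<rceil> = 1" if "z < x" using that elim assms by (intro ceiling_unique) (auto simp: circ_def)
      moreover have "\<lceil>x - z\<rceil> = 0" if "\<not> z < x" using that elim assms by (intro ceiling_unique) (auto simp: circ_def)
      ultimately show ?case by (auto simp: indicator_def)
    qed
  qed (auto intro: ceiling_measurable)
  then show ?thesis by simp
qed

lemma lifted_cdf_0: "lifted_cdf 0 = 0"
proof -
  have "measure \<mu> {..<0} = measure \<mu> {}"
    by (rule finite_measure_eq_AE) (use AE_circ in \<open>auto simp: circ_def elim: eventually_mono\<close>)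
  then show ?thesis using lifted_cdf_eq_measure[of 0] by simp
qed

lemma measure_lessThan:
  "measure \<mu> {..<x} = (if x \<le> 0 then 0 else if x \<ge> 1 then 1 else lifted_cdf x)"
proof -
  have "measure \<mu> {..<x} = measure \<mu> {}" if "x \<le> 0"
    by (rule finite_measure_eq_AE) (use AE_circ that in \<open>auto simp: circ_def elim: eventually_mono\<close>)
  moreover have "measure \<mu> {..<x} = measure \<mu> UNIV" if "x \<ge> 1"
    by (rule finite_measure_eq_AE) (use AE_circ that in \<open>auto simp: circ_def elim: eventually_mono\<close>)
  ultimately show ?thesis using lifted_cdf_eq_measure[of x] prob_space by auto
qed

end

text \<open>The open rays to the left form a generating family stable under intersection, and
  \<open>measure_lessThan\<close> expresses their masses by the lifted distribution
  function.\<close>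

lemma circle_measure_eqI:
  assumes "circle_measure \<mu>" "circle_measure \<nu>"
    and eq: "\<And>x. circle_measure.lifted_cdf \<mu> x = circle_measure.lifted_cdf \<nu> x"
  shows "\<mu> = \<nu>"
proof -
  interpret m: circle_measure \<mu> by fact
  interpret n: circle_measure \<nu> by fact
  show ?thesis
  proof (rule measure_eqI_generator_eq[where E = "range lessThan" and \<Omega> = UNIV and A = "\<lambda>i. {..<real i}"])
    show "Int_stable (range lessThan :: real set set)"
    proof (rule Int_stableI)
      fix X Y :: "real set" assume "X \<in> range lessThan" "Y \<in> range lessThan"
      then obtain a b where "X = {..<a}" "Y = {..<b}" by blast
      then have "X \<inter> Y = {..<min a b}" by auto
      then show "X \<inter> Y \<in> range lessThan" by blast
    qed
    show "emeasure \<mu> X = emeasure \<nu> X" if "X \<in> range lessThan" for X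
    proof -
      obtain a where X: "X = {..<a}" using \<open>X \<in> range lessThan\<close> by blast
      show ?thesis
        unfolding X m.emeasure_eq_measure n.emeasure_eq_measure m.measure_lessThan n.measure_lessThan eq by (rule refl)
    qed
    show "sets \<mu> = sigma_sets UNIV (range lessThan)" "sets \<nu> = sigma_sets UNIV (range lessThan)"
      by (simp_all add: borel_Iio)
    show "(\<Union>i. {..<real i}) = UNIV" by (auto intro: reals_Archimedean2)
  qed auto
qed

section \<open>Images of measures under circle maps\<close>

locale monotone_lift =
  fixes F :: "real \<Rightarrow> real"
  assumes F_mono: "strict_mono F" and F_plus_1: "F (x + 1) = F x + 1"
begin

lemma F_plus_int: "F (x + of_int j) = F x + of_int j"
  by (rule periodic_plus_int[of F]) (rule F_plus_1)

lemma F_measurable [measurable]: "F \<in> borel_measurable borel"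
  using F_mono strict_mono_mono by (intro borel_measurable_mono)

lemma circ_map_measurable [measurable]: "circ_map F \<in> borel_measurable borel"
  unfolding circ_map_def[abs_def] proj_def frac_def by measurable

lemma circ_map_circ: "circ_map F x \<in> circ"
  by (simp add: circ_map_def proj_def circ_def frac_lt_1)

text \<open>Both ceilings are at most j under the same condition x \<le> z + j, as F is increasing
  and commutes with integer translations.\<close>

lemma ceiling_F_diff: "\<lceil>F x - F z\<rceil> = \<lceil>x - z\<rceil>"
proof -
  have "\<lceil>F x - F z\<rceil> \<le> j \<longleftrightarrow> \<lceil>x - z\<rceil> \<le> j" for j
  proof -
    have "\<lceil>F x - F z\<rceil> \<le> j \<longleftrightarrow> F x \<le> F (z + of_int j)"
      by (simp add: ceiling_le_iff F_plus_int algebra_simps)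
    also have "\<dots> \<longleftrightarrow> x \<le> z + of_int j" using F_mono by (simp add: strict_mono_less_eq)
    also have "\<dots> \<longleftrightarrow> \<lceil>x - z\<rceil> \<le> j" by (simp add: ceiling_le_iff algebra_simps)
    finally show ?thesis .
  qed
  then show ?thesis by (meson antisym order_refl)
qed

text \<open>The lift preserves the integer part of differences, so pushing a measure forward changes its lifted distribution function by a constant.\<close>
lemma lifted_cdf_distr:
  assumes "circle_measure \<mu>"
  shows "circle_measure (distr \<mu> borel (circ_map F))"
    and "\<exists>c. \<forall>x. circle_measure.lifted_cdf (distr \<mu> borel (circ_map F)) (F x) = circle_measure.lifted_cdf \<mu> x + c"
proof -
  interpret circle_measure \<mu> by fact
  let ?\<nu> = "distr \<mu> borel (circ_map F)"
  have meas: "circ_map F \<in> measurable \<mu> borel" using circ_map_measurable by measurable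
  have "circ_map F -` (UNIV - circ) = {}" using circ_map_circ by auto
  then have "emeasure ?\<nu> (UNIV - circ) = 0"
    using meas by (subst emeasure_distr) auto
  then show nu: "circle_measure ?\<nu>"
    using prob_space_distr[OF meas] by unfold_locales (simp add: circ_prob_def)
  interpret n: circle_measure ?\<nu> by fact
  have "n.lifted_cdf (F x) = lifted_cdf x + (\<integral>z. real_of_int \<lfloor>F z\<rfloor> \<partial>\<mu>)" for x
  proof -
    have int: "integrable \<mu> (\<lambda>z. real_of_int \<lfloor>F z\<rfloor>)"
    proof (rule integrable_const_bound)
      show "AE z in \<mu>. norm (real_of_int \<lfloor>F z\<rfloor>) \<le> \<bar>F 0\<bar> + 2"
        using AE_circ
      proof eventually_elim
        case (elim z)
        then have "F 0 \<le> F z" "F z < F (0 + 1)" using F_mono by (auto simp: circ_def strict_mono_less_eq strict_mono_less)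
        then have "F 0 \<le> F z" "F z < F 0 + 1" using F_plus_1[of 0] by auto
        then show ?case by (simp add: abs_le_iff) linarith
      qed
      show "(\<lambda>z. real_of_int \<lfloor>F z\<rfloor>) \<in> borel_measurable \<mu>" by measurable
    qed
    have "n.lifted_cdf (F x) = (\<integral>z. real_of_int \<lceil>F x - circ_map F z\<rceil> \<partial>\<mu>)"
      unfolding n.lifted_cdf_def ceiling_def using meas by (subst integral_distr) auto
    also have "\<dots> = (\<integral>z. real_of_int \<lceil>x - z\<rceil> + real_of_int \<lfloor>F z\<rfloor> \<partial>\<mu>)"
    proof (intro Bochner_Integration.integral_cong refl)
      fix z
      have "F x - circ_map F z = (F x - F z) + of_int \<lfloor>F z\<rfloor>" by (simp add: circ_map_def proj_def frac_def)
      then show "real_of_int \<lceil>F x - circ_map F z\<rceil> = real_of_int \<lceil>x - z\<rceil> + real_of_int \<lfloor>F z\<rfloor>"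
        by (simp only: ceiling_add_of_int ceiling_F_diff of_int_add)
    qed
    also have "\<dots> = lifted_cdf x + (\<integral>z. real_of_int \<lfloor>F z\<rfloor> \<partial>\<mu>)"
      unfolding lifted_cdf_def by (rule Bochner_Integration.integral_add[OF integrable_ceiling int])
    finally show ?thesis .
  qed
  then show "\<exists>c. \<forall>x. n.lifted_cdf (F x) = lifted_cdf x + c" by blast
qed

end

text \<open>Monotonicity and commutation with the unit translation keep \<psi> within distance 1 of
  the identity, and iterating the translation by \<tau> then forces c = \<tau>. So \<psi> fixes
  every k \<tau> - h; these points are dense, and a monotone map fixing a dense set is the
  identity.\<close>

lemma translation_equivariant_identity:
  fixes \<psi> :: "real \<Rightarrow> real"
  assumes mono: "mono \<psi>" and one: "\<And>y. \<psi> (y + 1) = \<psi> y + 1" and c: "\<And>y. \<psi> (y + \<tau>) = \<psi> y + c"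
    and zero: "\<psi> 0 = 0" and irr: "\<tau> \<notin> \<rat>"
  shows "\<psi> y = y"
proof -
  have ints: "\<psi> (y + of_int j) = \<psi> y + of_int j" for y j
    by (rule periodic_plus_int[of \<psi>]) (rule one)
  have taus: "\<psi> (y + of_int j * \<tau>) = \<psi> y + of_int j * c" for y j
  proof (induction j rule: int_induct[of _ 0])
    case (step1 i)
    then show ?case using c[of "y + of_int i * \<tau>"] by (simp add: algebra_simps)
  next
    case (step2 i)
    then show ?case using c[of "y + of_int i * \<tau> - \<tau>"] by (simp add: algebra_simps)
  qed simp
  have near: "\<bar>\<psi> y - y\<bar> \<le> 1" for y
  proof -
    have "\<psi> (0 + of_int \<lfloor>y\<rfloor>) \<le> \<psi> y" "\<psi> y \<le> \<psi> (0 + of_int (\<lfloor>y\<rfloor> + 1))"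
      using mono by (auto simp: mono_def intro!: monoD[OF mono])
    then show ?thesis unfolding ints zero by linarith
  qed
  have "c = \<tau>"
  proof (rule ccontr)
    assume "c \<noteq> \<tau>"
    then obtain n :: nat where n: "1 < real n * \<bar>c - \<tau>\<bar>" using reals_Archimedean3[of "\<bar>c - \<tau>\<bar>"] by auto
    have "\<bar>of_int (int n) * c - of_int (int n) * \<tau>\<bar> \<le> 1"
      using near[of "0 + of_int (int n) * \<tau>"] unfolding taus zero by simp
    moreover have "of_int (int n) * c - of_int (int n) * \<tau> = real n * (c - \<tau>)" by (simp add: right_diff_distrib)
    ultimately show False using n by (simp add: abs_mult)
  qed
  then have orbit: "\<psi> (of_int k * \<tau> - of_int h) = of_int k * \<tau> - of_int h" for k h
    using taus[of "of_int (- h)" k] ints[of 0 "- h"] zero by (simp add: algebra_simps)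
  have between: "\<exists>k h. a < of_int k * \<tau> - of_int h \<and> of_int k * \<tau> - of_int h < b" if "a < b" for a b
  proof -
    have "(b - a) / 2 > 0" using \<open>a < b\<close> by simp
    from sequence_of_fractional_parts_is_dense[OF irr this, of "(a + b) / 2"]
    obtain h k where "\<bar>of_int k * \<tau> - of_int h - (a + b) / 2\<bar> < (b - a) / 2" by metis
    then show ?thesis by (intro exI[of _ k] exI[of _ h]) (auto simp: abs_less_iff field_simps)
  qed
  show ?thesis
  proof (rule linorder_cases[of "\<psi> y" y])
    assume "\<psi> y < y"
    then obtain k h where "\<psi> y < of_int k * \<tau> - of_int h" "of_int k * \<tau> - of_int h < y" using between by blast
    then show ?thesis using monoD[OF mono, of "of_int k * \<tau> - of_int h" y] orbit[of k h] by simp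
  next
    assume "y < \<psi> y"
    then obtain k h where "y < of_int k * \<tau> - of_int h" "of_int k * \<tau> - of_int h < \<psi> y" using between by blast
    then show ?thesis using monoD[OF mono, of y "of_int k * \<tau> - of_int h"] orbit[of k h] by simp
  qed
qed

section \<open>The image of Lebesgue measure under a conjugacy\<close>

locale circle_conjugacy =
  fixes h g :: "real \<Rightarrow> real"
  assumes gh [simp]: "g (h x) = x" and hg [simp]: "h (g x) = x"
    and h_mono: "strict_mono h" and h_plus_1: "h (x + 1) = h x + 1" and h_0 [simp]: "h 0 = 0"
begin

lemma g_mono: "strict_mono g"
  by (rule strict_monoI) (metis h_mono hg strict_mono_less)

lemma g_0 [simp]: "g 0 = 0" by (metis gh h_0)

lemma h_1 [simp]: "h 1 = 1" using h_plus_1[of 0] by simp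

lemma g_1 [simp]: "g 1 = 1" by (metis gh h_1)

lemma g_plus_1: "g (x + 1) = g x + 1"
  by (metis gh h_plus_1 hg)

lemma h_less [simp]: "h x < h y \<longleftrightarrow> x < y" using h_mono by (simp add: strict_mono_less)
lemma h_le [simp]: "h x \<le> h y \<longleftrightarrow> x \<le> y" using h_mono by (simp add: strict_mono_less_eq)
lemma g_less [simp]: "g x < g y \<longleftrightarrow> x < y" using g_mono by (simp add: strict_mono_less)
lemma g_le [simp]: "g x \<le> g y \<longleftrightarrow> x \<le> y" using g_mono by (simp add: strict_mono_less_eq)

lemma h_measurable [measurable]: "h \<in> borel_measurable borel"
  using h_mono strict_mono_mono by (intro borel_measurable_mono)

sublocale H: monotone_lift h by unfold_locales (use h_mono h_plus_1 in auto)
sublocale G: monotone_lift g by unfold_locales (use g_mono g_plus_1 in auto)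

definition \<mu> where "\<mu> = distr (uniform_measure lborel {0..<1}) borel h"

lemma emeasure_mu: "A \<in> sets borel \<Longrightarrow> emeasure \<mu> A = emeasure lborel ({0..<1} \<inter> h -` A)"
proof -
  assume A: "A \<in> sets borel"
  have "h -` A \<in> sets borel" using measurable_sets[OF h_measurable A] by simp
  then show ?thesis unfolding \<mu>_def using A
    by (simp add: emeasure_distr emeasure_uniform_measure divide_ennreal_def)
qed

lemma h_in_circ: "h y \<in> circ \<longleftrightarrow> y \<in> {0..<1}"
  using h_le[of 0 y] h_less[of y 1] by (auto simp: circ_def simp del: h_le h_less)

sublocale circle_measure \<mu>
proof
  have "prob_space \<mu>" unfolding \<mu>_def
    by (intro prob_space.prob_space_distr prob_space_uniform_measure) auto
  moreover have "emeasure \<mu> (UNIV - circ) = 0"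
  proof -
    have "{0..<1} \<inter> h -` (UNIV - circ) = {}" by (auto simp: h_in_circ)
    then show ?thesis using emeasure_mu[of "UNIV - circ"] circ_sets by (simp add: sets.Diff)
  qed
  moreover have "sets \<mu> = sets borel" by (simp add: \<mu>_def)
  ultimately show "circ_prob \<mu>" by (simp add: circ_prob_def)
qed

lemma measure_interval:
  assumes "0 \<le> a" "a \<le> b" "b \<le> 1"
  shows "measure \<mu> {a..<b} = g b - g a"
proof -
  have "0 \<le> g a" "g a \<le> g b" "g b \<le> 1" using assms g_le[of 0 a] g_le[of a b] g_le[of b 1] by (auto simp del: g_le)
  moreover have "a \<le> h y \<longleftrightarrow> g a \<le> y" "h y < b \<longleftrightarrow> y < g b" for y
    using h_le[of "g a" y] h_less[of y "g b"] by auto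
  ultimately have "{0..<1} \<inter> h -` {a..<b} = {g a..<g b}" by auto
  then have "emeasure \<mu> {a..<b} = ennreal (g b - g a)"
    using \<open>g a \<le> g b\<close> by (subst emeasure_mu) auto
  then show ?thesis using \<open>g a \<le> g b\<close> by (simp add: emeasure_eq_measure)
qed

lemma lifted_cdf_mu: "lifted_cdf x = g x"
proof -
  have unit: "lifted_cdf x = g x" if "0 \<le> x" "x < 1" for x
  proof -
    have "lifted_cdf x = measure \<mu> {..<x}" using that by (intro lifted_cdf_eq_measure) auto
    also have "\<dots> = measure \<mu> {0..<x}"
      by (rule finite_measure_eq_AE) (use AE_circ in \<open>auto simp: circ_def elim: eventually_mono\<close>)
    also have "\<dots> = g x" using measure_interval[of 0 x] that by simp
    finally show ?thesis .
  qed
  have ints: "lifted_cdf (x + of_int j) = lifted_cdf x + of_int j" for x j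
    by (rule periodic_plus_int[of lifted_cdf]) (rule lifted_cdf_plus_1)
  have "lifted_cdf (frac x + of_int \<lfloor>x\<rfloor>) = g (frac x + of_int \<lfloor>x\<rfloor>)"
    unfolding ints G.F_plus_int by (simp add: unit frac_lt_1)
  then show ?thesis by (simp add: frac_def)
qed

text \<open>A ball of the circle may wrap around 0. Its preimage in [0,1) lies in three integer
  translates of the interval from g(x - r) to g(x + r), hence the factor 3.\<close>

lemma measure_ball_le:
  assumes x: "x \<in> circ" and r: "0 < r" "r \<le> 1/2"
  shows "measure \<mu> (cball_open x r) \<le> 3 * (g (x + r) - g (x - r))"
proof -
  let ?l = "g (x - r)" and ?u = "g (x + r)"
  have lu: "?l \<le> ?u" using r by simp
  let ?S = "\<lambda>j::int. {?l - of_int j .. ?u - of_int j}"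
  have sub: "{0..<1} \<inter> h -` cball_open x r \<subseteq> (\<Union>j\<in>{-1,0,1}. ?S j)"
  proof
    fix y assume y: "y \<in> {0..<1} \<inter> h -` cball_open x r"
    then have z: "h y \<in> circ" "cdist x (h y) < r" by (auto simp: cball_open_def)
    obtain m where m: "\<bar>x - h y - of_int m\<bar> < r" using z cdist_witness by metis
    have "\<bar>x - h y\<bar> < 1" using x z by (auto simp: circ_def)
    then have "\<bar>real_of_int m\<bar> < 2" using m r by linarith
    then have "m \<in> {-1, 0, 1}" by auto
    moreover have "h (y + of_int m) = h y + of_int m" by (rule H.F_plus_int)
    then have "x - r < h (y + of_int m)" "h (y + of_int m) < x + r" using m by auto
    then have "?l < y + of_int m" "y + of_int m < ?u" by (metis gh g_less)+
    then have "y \<in> ?S m" by auto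
    ultimately show "y \<in> (\<Union>j\<in>{-1,0,1}. ?S j)" by blast
  qed
  have "emeasure \<mu> (cball_open x r) \<le> emeasure lborel (\<Union>j\<in>{-1,0,1}. ?S j)"
    by (subst emeasure_mu) (use sub in \<open>auto intro!: emeasure_mono\<close>)
  also have "\<dots> \<le> (\<Sum>j\<in>{-1,0,1}. emeasure lborel (?S j))"
    by (rule emeasure_subadditive_finite) auto
  also have "\<dots> = (\<Sum>j\<in>{-1,0,1::int}. ennreal (?u - ?l))"
    using lu by (intro sum.cong) auto
  also have "\<dots> = ennreal (3 * (?u - ?l))"
    using lu by (subst sum_ennreal) auto
  finally show ?thesis using lu by (simp add: emeasure_eq_measure)
qed

lemma measure_ball_ge:
  assumes "0 \<le> a" "a \<le> x" "x \<le> b" "b \<le> 1" "b - a < r"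
  shows "measure \<mu> (cball_open x r) \<ge> g b - g a"
proof -
  have "g b - g a = measure \<mu> {a..<b}" using assms by (subst measure_interval) auto
  also have "\<dots> \<le> measure \<mu> (cball_open x r)"
  proof (rule finite_measure_mono)
    show "{a..<b} \<subseteq> cball_open x r"
    proof
      fix z assume z: "z \<in> {a..<b}"
      then have "cdist x z < r" using cdist_le[of x z 0] assms by auto
      then show "z \<in> cball_open x r" using z assms by (auto simp: cball_open_def circ_def)
    qed
  qed simp
  finally show ?thesis .
qed

end

locale rotation_conjugacy = circle_conjugacy +
  fixes \<tau> :: real
  assumes irrational: "\<tau> \<notin> \<rat>"
begin

definition "F x = h (g x + \<tau>)"

sublocale F: monotone_lift F
proof
  show "strict_mono F" by (simp add: F_def strict_mono_def)
  show "F (x + 1) = F x + 1" for x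
    using h_plus_1[of "g x + \<tau>"] unfolding F_def g_plus_1 by (simp add: add_ac)
qed

text \<open>By \<open>lifted_cdf_distr\<close> the image measure has lifted distribution function g
  - \<tau> + c. Every such function vanishes at 0, which forces c = \<tau>, so the image has the
  same function g.\<close>

lemma mu_invariant: "invariant_measure (circ_map F) \<mu>"
proof -
  let ?\<nu> = "distr \<mu> borel (circ_map F)"
  interpret n: circle_measure ?\<nu> by (rule F.lifted_cdf_distr(1)) (rule circle_measure_axioms)
  obtain c where c: "\<And>x. n.lifted_cdf (F x) = lifted_cdf x + c"
    using F.lifted_cdf_distr(2)[OF circle_measure_axioms] by blast
  have nF: "n.lifted_cdf y = g y - \<tau> + c" for y
    using c[of "h (g y - \<tau>)"] by (simp add: F_def lifted_cdf_mu)
  then have "c = \<tau>" using n.lifted_cdf_0 by simp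
  then have "?\<nu> = \<mu>"
    using nF lifted_cdf_mu by (intro circle_measure_eqI n.circle_measure_axioms circle_measure_axioms) auto
  then show ?thesis using circ_prob by (simp add: invariant_measure_def)
qed

text \<open>Read in the coordinate of the conjugacy, the lifted distribution function of \<nu> meets
  the conditions of \<open>translation_equivariant_identity\<close>, hence it equals g.\<close>

lemma invariant_measure_unique:
  assumes "invariant_measure (circ_map F) \<nu>"
  shows "\<nu> = \<mu>"
proof -
  interpret n: circle_measure \<nu> using assms by unfold_locales (simp add: invariant_measure_def)
  have inv: "distr \<nu> borel (circ_map F) = \<nu>" using assms by (simp add: invariant_measure_def)
  obtain c where c: "\<And>x. n.lifted_cdf (F x) = n.lifted_cdf x + c"
    using F.lifted_cdf_distr(2)[OF n.circle_measure_axioms] unfolding inv by blast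
  have "n.lifted_cdf (h y) = y" for y
  proof (rule translation_equivariant_identity[OF _ _ _ _ irrational])
    show "mono (\<lambda>y. n.lifted_cdf (h y))" using n.lifted_cdf_mono by (simp add: mono_def)
    show "n.lifted_cdf (h (y + 1)) = n.lifted_cdf (h y) + 1" for y
      by (simp add: h_plus_1 n.lifted_cdf_plus_1)
    show "n.lifted_cdf (h (y + \<tau>)) = n.lifted_cdf (h y) + c" for y
      using c[of "h y"] by (simp add: F_def)
    show "n.lifted_cdf (h 0) = 0" by (simp add: n.lifted_cdf_0)
  qed
  from this[of "g x" for x] have "n.lifted_cdf x = g x" for x by simp
  then show ?thesis
    using lifted_cdf_mu by (intro circle_measure_eqI n.circle_measure_axioms circle_measure_axioms) auto
qed

end

section \<open>Scaling of the invariant measure\<close>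

text \<open>The relation between \<gamma> and b says (q L)^b = q: mass 1/q on length 1/(q L) has
  exponent b.\<close>

locale scaled_stages = stages +
  fixes \<beta> :: real and b :: "nat \<Rightarrow> real"
  assumes irrational: "\<tau> \<notin> \<rat>" and beta: "0 \<le> \<beta>" "\<beta> \<le> 1"
    and b: "\<And>n. 0 < b n" "\<And>n. b n < 1" "b \<longlonglongrightarrow> \<beta>"
    and gamma_eq: "\<And>n. \<gamma> n = 1 / b n - 1" and eps_lim: "\<epsilon> \<longlonglongrightarrow> 0"
begin

sublocale C: rotation_conjugacy lim_H lim_G \<tau>
proof
  show "lim_H 0 = 0" by (metis lim_G_0 lim_H_lim_G)
qed (use lim_H_strict_mono lim_H_plus_1 irrational in auto)

definition T where "T n = real (q n) * L n"

lemma T_pos: "T n > 0" unfolding T_def using q_pos[of n] L_ge_1[of n] by simp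

lemma T_powr: "T n powr b n = q n" "1 / q n = (1 / T n) powr b n"
proof -
  have "T n = real (q n) powr (1 + \<gamma> n)" using q_pos[of n] by (simp add: T_def L_def powr_add)
  also have "1 + \<gamma> n = 1 / b n" by (simp add: gamma_eq)
  finally show 1: "T n powr b n = q n" using b(1)[of n] q_pos[of n] by (simp add: powr_powr)
  show "1 / q n = (1 / T n) powr b n" using T_pos[of n] by (simp add: powr_divide 1)
qed

lemma L_large: "64 * 2 ^ n * m n \<le> L n" "64 * 2 ^ n \<le> L n"
  using q_large(3)[of n] big_ge(1,2)[of n] unfolding L_def by linarith+

lemma q_eps: "64 * M n \<le> real (q n) powr \<epsilon> n" "64 * 2 ^ n * m n \<le> real (q n) powr \<epsilon> n"
  using q_large(2)[of n] big_ge(2,3)[of n] by linarith+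

lemma q_two_power: "64 * 2 ^ n \<le> real (q n)"
  using q_large(1)[of n] big_ge(1)[of n] by linarith

lemma inverse_q_le: "1 / real (q n) \<le> 1/2"
proof -
  have "(1::real) \<le> 2 ^ n" by simp
  then have "2 \<le> real (q n)" using q_two_power[of n] by linarith
  then show ?thesis using q_pos[of n] by (simp add: divide_le_eq)
qed

text \<open>Turns the factor q^\<epsilon> that absorbs constants into a loss of \<epsilon> in the
  exponent at any scale r \<le> 1/q.\<close>

lemma powr_eps_le:
  assumes "0 < r" "r \<le> 1 / real (q n)"
  shows "real (q n) powr \<epsilon> n \<le> r powr - \<epsilon> n"
proof -
  have "real (q n) \<le> 1 / r" using assms q_pos[of n] by (simp add: field_simps)
  then have "real (q n) powr \<epsilon> n \<le> (1 / r) powr \<epsilon> n" using eps[of n] by (intro powr_mono2) auto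
  then show ?thesis using assms(1) by (simp add: powr_divide powr_minus_divide)
qed

section \<open>Upper bounds for the mass of balls\<close>

lemma lim_G_diff:
  assumes "\<And>x y. \<bar>G n x - G n y\<bar> \<le> K * \<bar>x - y\<bar>" "x \<le> y"
  shows "lim_G y - lim_G x \<le> K * (y - x) + 4 / q n" "G n y - G n x - 4 / q n \<le> lim_G y - lim_G x"
  using assms(1)[of y x] assms(2) lim_G(1)[of x n] lim_G(1)[of y n] by (auto simp: abs_le_iff)

text \<open>For r \<ge> 1/q the approximation error 4/q is at most 4 r, and K \<ge> 1 gives 3 (2 K r
  + 4 r) \<le> 18 K r.\<close>

lemma ball_bound:
  assumes lip: "\<And>x y. \<bar>G n x - G n y\<bar> \<le> K * \<bar>x - y\<bar>" and K: "1 \<le> K"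
    and x: "x \<in> circ" and r: "1 / q n \<le> r" "r \<le> 1/2"
  shows "measure C.\<mu> (cball_open x r) \<le> 18 * K * r"
proof -
  have r0: "0 < r" using r(1) q_pos[of n] by (smt (verit) divide_pos_pos)
  have "measure C.\<mu> (cball_open x r) \<le> 3 * (lim_G (x + r) - lim_G (x - r))"
    using r0 r by (intro C.measure_ball_le x) auto
  also have "\<dots> \<le> 3 * (K * (2 * r) + 4 / q n)"
    using lim_G_diff(1)[OF lip, of "x - r" "x + r"] r0 by simp
  also have "4 / q n \<le> 4 * r" using r(1) by simp
  also have "3 * (K * (2 * r) + 4 * r) \<le> 18 * K * r"
  proof -
    have "1 * r \<le> K * r" using K r0 by (intro mult_right_mono) auto
    then show ?thesis by simp
  qed
  finally show ?thesis by simp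
qed

lemma G_Suc_lipschitz: "\<bar>G (Suc n) x - G (Suc n) y\<bar> \<le> (M n * L n) * \<bar>x - y\<bar>"
proof (rule field_differentiable_bound[of UNIV "G (Suc n)" "deriv (G (Suc n))", simplified])
  fix z
  show "(G (Suc n) has_real_derivative deriv (G (Suc n)) z) (at z)" by (rule G_deriv)
  have "(G (Suc n) has_real_derivative 1 / bulge_speed (L n) (q n * G n z) * deriv (G n) z) (at z)"
    using next_G_deriv[OF HG L_ge_1 q_pos, of n n n z] by (simp add: G_Suc L_def)
  then have "deriv (G (Suc n)) z = 1 / bulge_speed (L n) (q n * G n z) * deriv (G n) z"
    by (rule DERIV_imp_deriv)
  also have "\<dots> \<le> L n * M n"
  proof (rule mult_mono)
    have s: "1 / L n \<le> bulge_speed (L n) (q n * G n z)" "0 < bulge_speed (L n) (q n * G n z)"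
      using bulge_speed_ge[OF L_ge_1] bulge_speed_pos[OF L_ge_1] by auto
    then show "1 / bulge_speed (L n) (q n * G n z) \<le> L n"
      using L_ge_1[of n] by (simp add: divide_le_eq mult.commute)
  qed (use M L_ge_1[of n] G_deriv(2)[of n z] in \<open>auto intro: less_imp_le\<close>)
  finally show "\<bar>deriv (G (Suc n)) z\<bar> \<le> M n * L n"
    using G_deriv(2)[of "Suc n" z] by (simp add: mult.commute)
qed

text \<open>Two regimes meet at 1/T. For r \<le> 1/T the Lipschitz constant M L of
  \<open>G (Suc n)\<close> applies, and L = T^(1-b) \<le> r^(b-1). For larger r the ball is enlarged
  to radius 1/q, of mass at most 18 M/q, and 1/q = T^(-b) \<le> r^b. Either way the bound is 18 M
  r^b, with 18 M absorbed by r^(-\<epsilon>).\<close>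

lemma scale_bound:
  assumes x: "x \<in> circ" and r: "1 / q (Suc n) \<le> r" "r \<le> 1 / q n"
  shows "measure C.\<mu> (cball_open x r) \<le> r powr (b n - \<epsilon> n)"
proof -
  have r0: "0 < r" using r(1) q_pos[of "Suc n"] by (smt (verit) divide_pos_pos)
  have r2: "r \<le> 1/2" using r(2) inverse_q_le[of n] by linarith
  have le: "measure C.\<mu> (cball_open x r) \<le> 18 * M n * r powr b n"
  proof (cases "r \<le> 1 / T n")
    case True
    have "1 * 1 \<le> M n * L n" by (intro mult_mono) (use M_ge_1[of n] L_ge_1[of n] in auto)
    then have "measure C.\<mu> (cball_open x r) \<le> 18 * (M n * L n) * r"
      by (intro ball_bound[OF G_Suc_lipschitz] x r r2) simp
    also have "L n \<le> r powr (b n - 1)"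
    proof -
      have "L n = T n powr (1 - b n)"
        using T_pos[of n] q_pos[of n] by (simp add: powr_diff T_powr) (simp add: T_def)
      also have "\<dots> \<le> (1 / r) powr (1 - b n)"
        using b(1,2)[of n] True r0 T_pos[of n] by (intro powr_mono2) (auto simp: field_simps)
      also have "\<dots> = r powr (b n - 1)" using r0 by (simp add: powr_divide powr_diff)
      finally show ?thesis .
    qed
    then have "18 * (M n * L n) * r \<le> 18 * (M n * r powr (b n - 1)) * r"
      using M_ge_1[of n] r0 by (intro mult_right_mono mult_left_mono) auto
    also have "\<dots> = 18 * M n * r powr b n" using r0 by (simp add: powr_diff)
    finally show ?thesis .
  next
    case False
    have "measure C.\<mu> (cball_open x r) \<le> measure C.\<mu> (cball_open x (1 / q n))"
      using r by (intro C.finite_measure_mono cball_open_mono) auto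
    also have "\<dots> \<le> 18 * M n * (1 / q n)"
      by (intro ball_bound[OF G_lipschitz] M_ge_1 x inverse_q_le) simp
    also have "1 / q n \<le> r powr b n"
      unfolding T_powr(2) using False b(1,2)[of n] T_pos[of n] by (intro powr_mono2) auto
    then have "18 * M n * (1 / q n) \<le> 18 * M n * r powr b n"
      using M_ge_1[of n] by (intro mult_left_mono) auto
    finally show ?thesis .
  qed
  also have "18 * M n * r powr b n \<le> r powr - \<epsilon> n * r powr b n"
    using q_eps(1)[of n] powr_eps_le[OF r0 r(2)] M_ge_1[of n] by (intro mult_right_mono) auto
  also have "\<dots> = r powr (b n - \<epsilon> n)" by (simp add: powr_add[symmetric])
  finally show ?thesis .
qed

lemma q_inverse_antimono: "j \<le> k \<Longrightarrow> 1 / real (q k) \<le> 1 / real (q j)"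
proof (rule lift_Suc_antimono_le[of "\<lambda>n. 1 / real (q n)"])
  show "1 / real (q (Suc n)) \<le> 1 / real (q n)" for n
    using q_inverse_half[of n] q_pos[of n] by (smt (verit) divide_nonneg_pos field_sum_of_halves)
qed

lemma all_scales:
  assumes s: "s < \<beta>"
  shows "\<forall>\<^sub>F r in at_right 0. \<forall>x\<in>circ. measure C.\<mu> (cball_open x r) \<le> r powr s"
proof -
  have "(\<lambda>n. b n - \<epsilon> n) \<longlonglongrightarrow> \<beta> - 0" by (intro tendsto_intros b eps_lim)
  then have "\<forall>\<^sub>F n in sequentially. s < b n - \<epsilon> n" using s by (intro order_tendstoD) auto
  then obtain N where N: "\<And>n. n \<ge> N \<Longrightarrow> s < b n - \<epsilon> n" unfolding eventually_sequentially by blast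
  have "\<forall>\<^sub>F r in at_right 0. 0 < r \<and> r < 1 / real (q N)"
    using eventually_at_right_real[of 0 "1 / real (q N)"] q_pos[of N] by (auto elim: eventually_mono)
  then show ?thesis
  proof (rule eventually_mono, intro ballI)
    fix r x assume r: "0 < r \<and> r < 1 / real (q N)" and x: "x \<in> circ"
    \<comment> \<open>The least such k puts r between 1/q(k) and 1/q(k-1), the range of
      \<open>scale_bound\<close> with n = k - 1.\<close>
    define k where "k = (LEAST k. 1 / real (q k) \<le> r)"
    have "\<forall>\<^sub>F k in sequentially. 1 / real (q k) < r" using r by (intro order_tendstoD(2)[OF q_lim]) auto
    then have "\<exists>k. 1 / real (q k) \<le> r" unfolding eventually_sequentially by (meson order_refl less_imp_le)
    then have k: "1 / real (q k) \<le> r" unfolding k_def by (rule LeastI_ex)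
    have "k > N"
    proof (rule ccontr)
      assume "\<not> k > N"
      then have "1 / real (q N) \<le> 1 / real (q k)" by (intro q_inverse_antimono) simp
      then show False using k r by linarith
    qed
    then obtain n where n: "k = Suc n" "n \<ge> N" by (cases k) auto
    have "\<not> 1 / real (q n) \<le> r" using n(1) unfolding k_def by (intro not_less_Least) auto
    then have nr: "r \<le> 1 / real (q n)" by simp
    have "measure C.\<mu> (cball_open x r) \<le> r powr (b n - \<epsilon> n)"
      using k n(1) nr x by (intro scale_bound) auto
    also have "\<dots> \<le> r powr s"
      using N[OF n(2)] r nr inverse_q_le[of n] by (intro powr_mono') auto
    finally show "measure C.\<mu> (cball_open x r) \<le> r powr s" .
  qed
qed

text \<open>At radius 1/q the concentration of stage n is still invisible: the Lipschitz constant of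
  \<open>G n\<close> was fixed before \<open>q n\<close>, so a ball has mass at most 18 M/q.\<close>

lemma sparse_scales:
  assumes s: "s < 1"
  shows "\<forall>\<^sub>F n in sequentially. \<forall>x\<in>circ. measure C.\<mu> (cball_open x (1 / q n)) \<le> (1 / q n) powr s"
proof -
  have "(\<lambda>n. 1 - \<epsilon> n) \<longlonglongrightarrow> 1 - 0" by (intro tendsto_intros eps_lim)
  then have "\<forall>\<^sub>F n in sequentially. s < 1 - \<epsilon> n" using s by (intro order_tendstoD) auto
  then show ?thesis
  proof (rule eventually_mono, intro ballI)
    fix n x assume n: "s < 1 - \<epsilon> n" and x: "x \<in> circ"
    have "measure C.\<mu> (cball_open x (1 / q n)) \<le> 18 * M n * (1 / q n)"
      by (intro ball_bound[OF G_lipschitz] M_ge_1 x inverse_q_le) simp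
    also have "\<dots> \<le> real (q n) powr \<epsilon> n * (1 / q n)"
      using q_eps(1)[of n] M_ge_1[of n] by (intro mult_right_mono) auto
    also have "\<dots> = (1 / q n) powr (1 - \<epsilon> n)"
      using q_pos[of n] by (simp add: powr_diff powr_divide)
    also have "\<dots> \<le> (1 / q n) powr s"
      using n inverse_q_le[of n] by (intro powr_mono') auto
    finally show "measure C.\<mu> (cball_open x (1 / q n)) \<le> (1 / q n) powr s" .
  qed
qed

text \<open>Half the width of the heavy interval around the peak, in the coordinate stretched by q.
  The factor 2^n makes the tail masses, of order 1/(L w), summable, and is itself absorbed by
  q^\<epsilon>.\<close>

definition w where "w n = 2 ^ n / L n"
definition lo where "lo n j = H n ((real j + 1/2 - w n) / q n)"
definition hi where "hi n j = H n ((real j + 1/2 + w n) / q n)"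
definition E where "E n = {z \<in> circ. \<exists>j<q n. lo n j \<le> z \<and> z \<le> hi n j}"
text \<open>Twice the bound 2 m w / q for the length of the interval from \<open>lo n j\<close> to
  \<open>hi n j\<close>. An interval so short lies in the ball of radius \<rho> about any of its
  points and in the closed ball of radius \<rho>/2 about its midpoint.\<close>

definition \<rho> where "\<rho> n = 4 * m n * w n / q n"

lemma w_pos: "0 < w n" unfolding w_def using L_ge_1[of n] by simp

lemma w_le: "w n \<le> 1/64"
proof -
  have "2 ^ n * 64 \<le> L n" using L_large(2)[of n] by (simp add: mult.commute)
  then show ?thesis unfolding w_def using L_ge_1[of n] by (simp add: divide_le_eq)
qed

lemma H_strict_mono: "x < y \<Longrightarrow> H n x < H n y"
  by (rule DERIV_pos_imp_increasing) (use H_deriv in blast)+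

lemma H_mono: "x \<le> y \<Longrightarrow> H n x \<le> H n y"
  using H_strict_mono[of x y n] by (cases "x = y") auto

lemma H_0: "H n 0 = 0" using H_G[of n 0] G_0[of n] by simp

lemma H_1: "H n 1 = 1" using HG[of n] H_0[of n] unfolding conj_pair_def by (metis add_0)

lemma interval_bounds:
  assumes "j < q n"
  shows "0 \<le> lo n j" "lo n j < hi n j" "hi n j < 1" "hi n j - lo n j < \<rho> n"
proof -
  have j: "real j + 1 \<le> q n" using assms by (simp add: Suc_leI flip: of_nat_Suc)
  have "0 \<le> (real j + 1/2 - w n) / q n" using w_le[of n] by simp
  then show "0 \<le> lo n j" unfolding lo_def using H_mono[of 0 _ n] by (simp add: H_0)
  have lh: "(real j + 1/2 - w n) / q n < (real j + 1/2 + w n) / q n"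
    using w_pos[of n] q_pos[of n] by (intro divide_strict_right_mono) auto
  then show "lo n j < hi n j" unfolding lo_def hi_def by (rule H_strict_mono)
  have "(real j + 1/2 + w n) / q n < 1" using j w_le[of n] q_pos[of n] by (simp add: divide_less_eq)
  then show "hi n j < 1" unfolding hi_def using H_strict_mono[of _ 1 n] by (simp add: H_1)
  have d: "(real j + 1/2 + w n) / q n - (real j + 1/2 - w n) / q n = 2 * w n / q n"
    by (simp add: diff_divide_distrib[symmetric])
  have "hi n j - lo n j \<le> m n * (2 * w n / q n)"
    using H_lipschitz[of n "(real j + 1/2 + w n) / q n" "(real j + 1/2 - w n) / q n"] lh
    unfolding d hi_def[symmetric] lo_def[symmetric] using w_pos[of n] by (simp add: abs_le_iff)
  also have "\<dots> < \<rho> n" unfolding \<rho>_def using m_ge_1[of n] w_pos[of n] q_pos[of n]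
    by (simp add: field_simps)
  finally show "hi n j - lo n j < \<rho> n" .
qed

lemma rho_pos: "0 < \<rho> n"
  unfolding \<rho>_def using m_ge_1[of n] w_pos[of n] q_pos[of n] by (intro divide_pos_pos mult_pos_pos) auto

lemma T_rho: "T n = 4 * m n * 2 ^ n / \<rho> n"
  unfolding \<rho>_def T_def w_def using m_ge_1[of n] L_ge_1[of n] q_pos[of n] by (simp add: field_simps)

lemma rho_le: "\<rho> n \<le> 1 / q n" "\<rho> n \<le> (1/2) ^ n"
proof -
  have "4 * m n * 2 ^ n \<le> L n"
  proof -
    have "4 * m n * 2 ^ n \<le> 64 * 2 ^ n * m n" using m_ge_1[of n] by simp
    then show ?thesis using L_large(1)[of n] by linarith
  qed
  then have "4 * m n * w n \<le> 1" unfolding w_def using L_ge_1[of n] by (simp add: divide_le_eq)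
  then show 1: "\<rho> n \<le> 1 / q n" unfolding \<rho>_def by (intro divide_right_mono) auto
  have "2 ^ n \<le> real (q n)" using q_two_power[of n] by (smt (verit) zero_le_power)
  then have "1 / q n \<le> (1/2) ^ n" using q_pos[of n] by (simp add: field_simps power_one_over)
  then show "\<rho> n \<le> (1/2) ^ n" using 1 by linarith
qed

text \<open>Since \<rho> = c/T with c = 4 m 2^n \<ge> 1, one gets \<rho>^b \<le> c/q, and 2 c \<le>
  q^\<epsilon> \<le> \<rho>^(-\<epsilon>). The factor 2 leaves room for intervals that carry only
  half of the mass 1/q.\<close>

lemma rho_powr_le: "\<rho> n powr (b n + \<epsilon> n) \<le> 1 / (2 * q n)"
proof -
  define c where "c = 4 * m n * 2 ^ n"
  have "m n * 2 ^ n \<ge> 1 * 1" using m_ge_1[of n] by (intro mult_mono) auto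
  then have c: "c \<ge> 1" by (simp add: c_def)
  have "2 * c \<le> \<rho> n powr - \<epsilon> n"
  proof -
    have "2 * c \<le> 64 * 2 ^ n * m n" using m_ge_1[of n] by (simp add: c_def)
    also have "\<dots> \<le> real (q n) powr \<epsilon> n" by (rule q_eps)
    also have "\<dots> \<le> \<rho> n powr - \<epsilon> n" by (rule powr_eps_le[OF rho_pos rho_le(1)])
    finally show ?thesis .
  qed
  then have e: "2 * c * \<rho> n powr \<epsilon> n \<le> 1"
    using rho_pos[of n] by (simp add: powr_minus field_simps)
  have "(1 / T n) powr b n = \<rho> n powr b n / c powr b n"
    using rho_pos[of n] c by (simp add: T_rho c_def[symmetric] powr_divide)
  moreover have "c powr b n \<le> c powr 1" using b(1,2)[of n] c by (intro powr_mono) auto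
  ultimately have "\<rho> n powr b n / c \<le> 1 / q n"
    unfolding T_powr(2) using c by (auto intro!: divide_left_mono)
  then have "\<rho> n powr b n \<le> c / q n" using c by (simp add: field_simps)
  then have "\<rho> n powr b n * \<rho> n powr \<epsilon> n \<le> c / q n * \<rho> n powr \<epsilon> n" by (intro mult_right_mono) auto
  also have "\<dots> = (2 * c * \<rho> n powr \<epsilon> n) * (1 / (2 * q n))" by simp
  also have "\<dots> \<le> 1 * (1 / (2 * q n))" using e by (intro mult_right_mono) auto
  finally show ?thesis by (simp add: powr_add)
qed

text \<open>\<open>bulge_tail\<close> with L w = 2^n, together with L - 1/L \<ge> L/2.\<close>

lemma tail_small: "bulge (L n) (1/2 - w n) \<le> (1/2) ^ n / 2"
proof -
  have L2: "L n \<ge> 64"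
  proof -
    have "(1::real) \<le> 2 ^ n" by simp
    then show ?thesis using L_large(2)[of n] by linarith
  qed
  have "bulge (L n) (1/2 - w n) \<le> 1 / (4 * (L n - 1 / L n) * w n)"
    using w_pos[of n] w_le[of n] L2 by (intro bulge_tail) auto
  also have "\<dots> \<le> 1 / (2 * 2 ^ n)"
  proof (rule divide_left_mono)
    have i: "1 / L n \<le> 1" using L2 by simp
    then have "L n / 2 \<le> L n - 1 / L n" using L2 by linarith
    then have "L n / 2 * w n \<le> (L n - 1 / L n) * w n" using w_pos[of n] by (intro mult_right_mono) auto
    moreover have "L n / 2 * w n = 2 ^ n / 2" unfolding w_def using L2 by simp
    ultimately have "2 ^ n / 2 \<le> (L n - 1 / L n) * w n" by simp
    then show "2 * 2 ^ n \<le> 4 * (L n - 1 / L n) * w n" unfolding mult.assoc[of 4] by linarith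
    have "0 < L n - 1 / L n" using i L2 by linarith
    then show "0 < 4 * (L n - 1 / L n) * w n * (2 * 2 ^ n)"
      using w_pos[of n] by (intro mult_pos_pos) auto
  qed simp
  also have "\<dots> = (1/2) ^ n / 2" by (simp add: power_one_over)
  finally show ?thesis .
qed

text \<open>\<open>G (Suc n)\<close> maps the interval onto [j/q, (j+1)/q] short of two tails, each
  at most 2^-n/2 of the whole. Passing to the limit costs 4/q(n+1), at most 2^-n/q(n) by
  \<open>q_Suc\<close>.\<close>

lemma interval_mass:
  assumes "j < q n"
  shows "lim_G (hi n j) - lim_G (lo n j) \<ge> (1 - 2 * (1/2) ^ n) / q n"
proof -
  let ?t = "bulge (L n) (1/2 - w n)"
  have q: "real (q n) > 0" by (rule q_pos)
  have shift: "bulge (L n) (real j + y) = real j + bulge (L n) y" for y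
    using bulge_plus_int[OF L_ge_1, of n y "int j"] by (simp add: add.commute)
  have sym: "bulge (L n) (1/2 + w n) = 1 - ?t"
    using bulge_half[OF L_ge_1, of n "1/2 - w n"] by (simp add: algebra_simps)
  have lo: "G (Suc n) (lo n j) = (real j + ?t) / q n"
    using shift[of "1/2 - w n"] q by (simp add: G_Suc next_G_def lo_def G_H L_def[symmetric] add_diff_eq)
  have hi: "G (Suc n) (hi n j) = (real j + (1 - ?t)) / q n"
    using shift[of "1/2 + w n"] sym q by (simp add: G_Suc next_G_def hi_def G_H L_def[symmetric] add.assoc)
  have "G (Suc n) (hi n j) - G (Suc n) (lo n j) = (1 - 2 * ?t) / q n"
    unfolding lo hi diff_divide_distrib[symmetric] by (simp add: algebra_simps)
  also have "\<dots> \<ge> (1 - (1/2) ^ n) / q n"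
    using tail_small[of n] by (intro divide_right_mono) auto
  finally have main: "G (Suc n) (hi n j) - G (Suc n) (lo n j) \<ge> (1 - (1/2) ^ n) / q n" .
  have "4 / real (q (Suc n)) \<le> (1/2) ^ n / q n"
  proof -
    have "4 * 2 ^ n * real (q n) \<le> q (Suc n)" using q_Suc[of n] q by (smt (verit) mult_right_mono zero_le_power)
    then have "4 / real (q (Suc n)) \<le> 4 / (4 * 2 ^ n * real (q n))"
      using q q_pos[of "Suc n"] by (intro divide_left_mono) auto
    also have "\<dots> = (1/2) ^ n / q n" by (simp add: power_one_over)
    finally show ?thesis .
  qed
  moreover have "(1 - 2 * (1/2) ^ n) / q n = (1 - (1/2) ^ n) / q n - (1/2) ^ n / q n"
    by (simp add: diff_divide_distrib[symmetric])
  ultimately show ?thesis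
    using main lim_G_diff(2)[OF G_Suc_lipschitz[of n] less_imp_le[OF interval_bounds(2)[OF assms]]] by linarith
qed

lemma E_sets: "E n \<in> sets borel"
proof -
  have "E n = circ \<inter> (\<Union>j\<in>{..<q n}. {lo n j..hi n j})" by (auto simp: E_def)
  then show ?thesis by simp
qed

lemma disjoint_intervals: "disjoint_family_on (\<lambda>j. {lo n j..<hi n j}) {..<q n}"
  unfolding disjoint_family_on_def
proof (intro ballI impI)
  \<comment> \<open>The index is recovered from any point of its interval, since w < 1/2 keeps q
    times \<open>G n z\<close> within one unit cell.\<close>
  have fl: "\<lfloor>q n * G n z\<rfloor> = int j" if "z \<in> {lo n j..<hi n j}" for z j
  proof -
    have "G n (lo n j) \<le> G n z" "G n z < G n (hi n j)"
      using that G_strict_mono[of "lo n j" z n] G_strict_mono[of z "hi n j" n] by (auto simp: le_less)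
    then have "real j + 1/2 - w n \<le> q n * G n z" "q n * G n z < real j + 1/2 + w n"
      using q_pos[of n] by (simp_all add: lo_def hi_def G_H field_simps)
    then show ?thesis using w_le[of n] by (intro floor_unique) auto
  qed
  fix i j :: nat assume "i \<noteq> j"
  show "{lo n i..<hi n i} \<inter> {lo n j..<hi n j} = {}"
  proof (rule equals0I)
    fix z assume "z \<in> {lo n i..<hi n i} \<inter> {lo n j..<hi n j}"
    then have "int i = int j" using fl[of z i] fl[of z j] by simp
    then show False using \<open>i \<noteq> j\<close> by simp
  qed
qed

lemma E_mass: "measure C.\<mu> (circ - E n) \<le> 2 * (1/2) ^ n"
proof -
  have "1 - 2 * (1/2) ^ n = (\<Sum>j<q n. (1 - 2 * (1/2) ^ n) / q n)" using q_pos[of n] by simp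
  also have "\<dots> \<le> (\<Sum>j<q n. measure C.\<mu> {lo n j..<hi n j})"
  proof (rule sum_mono)
    fix j assume "j \<in> {..<q n}"
    then have j: "j < q n" by simp
    have "measure C.\<mu> {lo n j..<hi n j} = lim_G (hi n j) - lim_G (lo n j)"
      using interval_bounds[OF j] by (intro C.measure_interval) auto
    then show "(1 - 2 * (1/2) ^ n) / q n \<le> measure C.\<mu> {lo n j..<hi n j}" using interval_mass[OF j] by simp
  qed
  also have "\<dots> = measure C.\<mu> (\<Union>j\<in>{..<q n}. {lo n j..<hi n j})"
    using disjoint_intervals by (intro C.finite_measure_finite_Union[symmetric]) auto
  also have "\<dots> \<le> measure C.\<mu> (E n)"
  proof (rule C.finite_measure_mono)
    show "(\<Union>j\<in>{..<q n}. {lo n j..<hi n j}) \<subseteq> E n"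
    proof
      fix z assume "z \<in> (\<Union>j\<in>{..<q n}. {lo n j..<hi n j})"
      then obtain j where j: "j < q n" "lo n j \<le> z" "z < hi n j" by auto
      then show "z \<in> E n" using interval_bounds(1,3)[OF j(1)] by (auto simp: E_def circ_def intro!: exI[of _ j])
    qed
  qed (simp add: E_sets)
  finally have "1 - 2 * (1/2) ^ n \<le> measure C.\<mu> (E n)" .
  moreover have "measure C.\<mu> (circ - E n) = measure C.\<mu> circ - measure C.\<mu> (E n)"
    using E_sets by (intro C.finite_measure_Diff) (auto simp: E_def)
  ultimately show ?thesis by (simp add: C.measure_circ)
qed

lemma eventually_exponent:
  assumes "s > \<beta>" shows "\<forall>\<^sub>F n in sequentially. \<rho> n powr s \<le> 1 / (2 * q n)"
proof -
  have "(\<lambda>n. b n + \<epsilon> n) \<longlonglongrightarrow> \<beta> + 0" by (intro tendsto_intros b eps_lim)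
  then have "\<forall>\<^sub>F n in sequentially. b n + \<epsilon> n < s" using assms by (intro order_tendstoD) auto
  then show ?thesis
  proof (rule eventually_mono)
    fix n assume "b n + \<epsilon> n < s"
    then have "\<rho> n powr s \<le> \<rho> n powr (b n + \<epsilon> n)"
      using rho_pos[of n] rho_le(1)[of n] inverse_q_le[of n] by (intro powr_mono') auto
    then show "\<rho> n powr s \<le> 1 / (2 * q n)" using rho_powr_le[of n] by linarith
  qed
qed

sublocale S: exact_scaling C.\<mu> \<beta> "\<lambda>n. 1 / q n" \<rho> E
proof
  show "filterlim (\<lambda>n. 1 / real (q n)) (at_right 0) sequentially"
    using q_pos by (intro tendsto_imp_filterlim_at_right[OF q_lim]) auto
  show "summable (\<lambda>n. measure C.\<mu> (circ - E n))"
    by (rule summable_comparison_test_ev[of _ "\<lambda>n. 2 * (1/2) ^ n"])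
       (use E_mass in \<open>auto intro!: always_eventually summable_mult summable_geometric\<close>)
  show "\<forall>\<^sub>F n in sequentially. \<forall>x\<in>E n. \<rho> n powr s \<le> measure C.\<mu> (cball_open x (\<rho> n))" if "s > \<beta>" for s
    using eventually_exponent[OF that] eventually_ge_at_top[of 2]
  proof eventually_elim
    case (elim n)
    show ?case
    proof
      fix x assume "x \<in> E n"
      then obtain j where j: "j < q n" "lo n j \<le> x" "x \<le> hi n j" by (auto simp: E_def)
      \<comment> \<open>From n = 2 on, each interval keeps at least half of the mass 1/q.\<close>
      have "(1/2::real) ^ n \<le> (1/2) ^ 2" using elim by (intro power_decreasing) auto
      then have "(1/2) / q n \<le> (1 - 2 * (1/2) ^ n) / q n" by (intro divide_right_mono) (auto simp: power2_eq_square)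
      also have "\<dots> \<le> lim_G (hi n j) - lim_G (lo n j)" by (rule interval_mass[OF j(1)])
      also have "\<dots> \<le> measure C.\<mu> (cball_open x (\<rho> n))"
        using interval_bounds[OF j(1)] j by (intro C.measure_ball_ge) auto
      finally show "\<rho> n powr s \<le> measure C.\<mu> (cball_open x (\<rho> n))" using elim by simp
    qed
  qed
  show "\<forall>\<^sub>F n in sequentially. \<exists>C. finite C \<and> C \<subseteq> circ \<and> real (card C) \<le> \<rho> n powr - s \<and>
      E n \<subseteq> (\<Union>c\<in>C. cball_closed c (\<rho> n / 2))" if "s > \<beta>" for s
    using eventually_exponent[OF that]
  proof eventually_elim
    case (elim n)
    let ?C = "(\<lambda>j. (lo n j + hi n j) / 2) ` {..<q n}"
    have "card ?C \<le> q n" using card_image_le[of "{..<q n}"] by simp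
    moreover have "real (q n) \<le> \<rho> n powr - s"
    proof -
      have "\<rho> n powr s * (2 * q n) \<le> 1" using elim q_pos[of n] by (simp add: field_simps)
      moreover have "\<rho> n powr s * (1 * q n) \<le> \<rho> n powr s * (2 * q n)"
        by (intro mult_left_mono mult_right_mono) auto
      ultimately have "\<rho> n powr s * q n \<le> 1" by simp
      then show ?thesis using rho_pos[of n] by (simp add: powr_minus field_simps)
    qed
    moreover have "?C \<subseteq> circ"
    proof
      fix c assume "c \<in> ?C"
      then obtain j where j: "j < q n" "c = (lo n j + hi n j) / 2" by auto
      then show "c \<in> circ" using interval_bounds[OF j(1)] by (auto simp: circ_def)
    qed
    moreover have "E n \<subseteq> (\<Union>c\<in>?C. cball_closed c (\<rho> n / 2))"
    proof
      fix z assume z: "z \<in> E n"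
      then obtain j where j: "j < q n" "lo n j \<le> z" "z \<le> hi n j" by (auto simp: E_def)
      have "cdist ((lo n j + hi n j) / 2) z \<le> \<bar>(lo n j + hi n j) / 2 - z\<bar>" using cdist_le[of _ _ 0] by simp
      also have "\<dots> \<le> \<rho> n / 2" using interval_bounds(4)[OF j(1)] j by (auto simp: abs_le_iff field_simps)
      finally have "z \<in> cball_closed ((lo n j + hi n j) / 2) (\<rho> n / 2)" using z by (auto simp: cball_closed_def E_def)
      then show "z \<in> (\<Union>c\<in>?C. cball_closed c (\<rho> n / 2))" using j(1) by auto
    qed
    ultimately show ?case by (intro exI[of _ ?C]) auto
  qed
  show "E n \<subseteq> circ" for n by (auto simp: E_def)
qed (use beta all_scales sparse_scales E_sets rho_pos rho_le in auto)

end

theorem theorem1p5: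
  fixes \<tau> \<beta> :: real
  assumes "liouville \<tau>" and "0 \<le> \<beta>" and "\<beta> \<le> 1"
  shows "\<exists>F. circle_diffeo_lift F \<and> has_rotation_number F \<tau> \<and>
           (\<exists>\<mu>. invariant_measure (circ_map F) \<mu> \<and>
                (\<forall>\<nu>. invariant_measure (circ_map F) \<nu> \<longrightarrow> \<nu> = \<mu>) \<and>
                (AE x in \<mu>. lower_local_dim \<mu> x = ereal \<beta> \<and> upper_local_dim \<mu> x = 1) \<and>
                dim_H_measure \<mu> = ereal \<beta> \<and> lower_box_dim_measure \<mu> = ereal \<beta> \<and>
                upper_box_dim_measure \<mu> = 1)"
proof -
  \<comment> \<open>A convex combination of \<beta> and 1/2 with weights (n+1)/(n+2) and 1/(n+2):
    strictly inside (0,1) and tending to \<beta>.\<close>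
  define b where "b = (\<lambda>n::nat. (\<beta> * (real n + 1) + 1/2) / (real n + 2))"
  define \<gamma> where "\<gamma> = (\<lambda>n. 1 / b n - 1)"
  define \<epsilon> where "\<epsilon> = (\<lambda>n::nat. 1 / (real n + 1))"
  have b: "0 < b n" "b n < 1" for n
  proof -
    define X where "X = \<beta> * (real n + 1)"
    have "X \<le> real n + 1" using mult_right_mono[OF assms(3), of "real n + 1"] by (simp add: X_def)
    then have "\<beta> * (real n + 1) + 1/2 < real n + 2" unfolding X_def[symmetric] by simp
    then show "b n < 1" unfolding b_def by (subst divide_less_eq_1_pos) auto
    have "0 \<le> \<beta> * (real n + 1)" using assms(2) by simp
    then show "0 < b n" unfolding b_def by (intro divide_pos_pos) linarith+
  qed
  have b_lim: "b \<longlonglongrightarrow> \<beta>" unfolding b_def by real_asymp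
  have e_lim: "\<epsilon> \<longlonglongrightarrow> 0" unfolding \<epsilon>_def by real_asymp
  have g: "\<gamma> n > 0" for n using b[of n] by (simp add: \<gamma>_def)
  have e: "\<epsilon> n > 0" for n by (simp add: \<epsilon>_def)
  obtain H G :: "nat \<Rightarrow> real \<Rightarrow> real" and q :: "nat \<Rightarrow> nat" and M m :: "nat \<Rightarrow> real" where
    "stages \<tau> \<gamma> \<epsilon> H G q M m"
    using stages_exist[of \<tau> \<gamma> \<epsilon>, OF assms(1) g e] by blast
  then interpret stages \<tau> \<gamma> \<epsilon> H G q M m .
  interpret scaled_stages \<tau> \<gamma> \<epsilon> H G q M m \<beta> b
    by unfold_locales (use assms b b_lim e_lim in \<open>auto simp: liouville_def \<gamma>_def\<close>)
  have F: "C.F = shift \<tau>" by (simp add: fun_eq_iff C.F_def shift_def)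
  show ?thesis
    using shift_diffeo shift_rotation_number C.mu_invariant C.invariant_measure_unique
      S.AE_local_dims S.dim_H_measure_eq S.lower_box_dim_measure_eq S.upper_box_dim_measure_eq
    unfolding F by blast
qed

end
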